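(* Let $\mathcal{S}$ be a classical or quantum state space on three or more letters, that is, either the simplex of probability vectors on a finite alphabet with at least three letters, or the set of density matrices on a complex Hilbert space of finite dimension at least three. Let $\mathcal{A}$ be a set of actions on $\mathcal{S}$ such that $F(s)=\sup_{a\in\mathcal{A}}E[a(s)]$ is finite for every $s\in\mathcal{S}$, and let $D_F$ be the associated regret. If $D_F$ satisfies the sufficiency property, then $F$ is proportional to the entropy function $H$ (i.e. $F$ is a constant real multiple of $H$ on $\mathcal{S}$), and $D_F$ is proportional to information divergence (relative entropy), i.e. there is a constant $c$ such that $D_F(s_1,s_2)=c\cdot D(s_1\Vert s_2)$ for all $s_1,s_2\in\mathcal{S}$.
   Context: An action $a\in\mathcal{A}$ is an affine map from the state space $\mathcal{S}$ (a finite-dimensional compact convex set) into the set of probability distributions on the real numbers; $E[a(s)]$ denotes the mean of the distribution $a(s)$. Put $F(s)=\sup_{a\in\mathcal{A}}E[a(s)]$, a convex function on $\mathcal{S}$. A sequence of actions $(a_n)_n$ is asymptotically optimal for the state $s$ if $E[a_n(s)]\to F(s)$ as $n\to\infty$. The regret is $$D_F(s_1,s_2)=F(s_1)-\sup_{(a_n)_n}\limsup_{n\to\infty}E[a_n(s_1)],$$ where the supremum is over all sequences $(a_n)_n$ in $\mathcal{A}$ that are asymptotically optimal for $s_2$. A completely positive transformation between state spaces means a completely positive map sending states to states (trace preserving in the quantum case; a stochastic map in the classical case). A completely positive transformation $\Phi:\mathcal{S}\to\mathcal{T}$ is sufficient for a family of states $(s_\theta)_\theta$ in $\mathcal{S}$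 if there exists a completely positive transformation $\Psi:\mathcal{T}\to\mathcal{S}$ with $\Psi(\Phi(s_\theta))=s_\theta$ for all $\theta$. The regret $D_F$ on $\mathcal{S}$ satisfies the sufficiency property if $D_F(\Phi(s_1),\Phi(s_2))=D_F(s_1,s_2)$ for all $s_1,s_2\in\mathcal{S}$ and every completely positive transformation $\Phi:\mathcal{S}\to\mathcal{S}$ that is sufficient for $(s_1,s_2)$. The entropy is $H(s)=-\sum_i s_i\log s_i$ for probability vectors and $H(s)=-\mathrm{Tr}(s\log s)$ for density matrices. Information divergence (relative entropy) is $D(s_1\Vert s_2)=\sum_i s_{1,i}\log(s_{1,i}/s_{2,i})$ for probability vectors and $D(s_1\Vert s_2)=\mathrm{Tr}\left(s_1(\log s_1-\log s_2)\right)$ for density matrices, with value $+\infty$ if the support of $s_1$ is not contained in that of $s_2$.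
   Formalization: "F is proportional to H" is proved as F = k·H plus an affine function on the state space; the literal claim fails for a single action with constant value 1, where F = 1 and the regret vanishes but H = 0 at pure states. *)

theory Defs
  imports "HOL-Probability.Probability"
begin

section \<open>Actions, optimal value and regret\<close>

definition affine_on :: "'v::real_vector set \<Rightarrow> ('v \<Rightarrow> real) \<Rightarrow> bool" where
  "affine_on S f \<longleftrightarrow>
     (\<forall>s\<in>S. \<forall>t\<in>S. \<forall>u\<in>{0..1}. f ((1 - u) *\<^sub>R s + u *\<^sub>R t) = (1 - u) * f s + u * f t)"

text \<open>Measures carry no vector space structure, so affinity of an action is expressed on every
  Borel set. The mean is required to exist, since otherwise the Lebesgue integral would silently
  be \<open>0\<close>. Values outside \<open>S\<close> are irrelevant.\<close>

definition action_on :: "'v::real_vector set \<Rightarrow> ('v \<Rightarrow> real measure) \<Rightarrow> bool" where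
  "action_on S a \<longleftrightarrow>
     (\<forall>s\<in>S. real_distribution (a s) \<and> integrable (a s) (\<lambda>x. x)) \<and>
     (\<forall>B\<in>sets borel. affine_on S (\<lambda>s. measure (a s) B))"

definition mean :: "real measure \<Rightarrow> real" where
  "mean M = integral\<^sup>L M (\<lambda>x. x)"

definition optimal_value :: "('v \<Rightarrow> real measure) set \<Rightarrow> 'v \<Rightarrow> ereal" where
  "optimal_value A s = (SUP a\<in>A. ereal (mean (a s)))"

definition asymptotically_optimal ::
    "('v \<Rightarrow> real measure) set \<Rightarrow> (nat \<Rightarrow> 'v \<Rightarrow> real measure) \<Rightarrow> 'v \<Rightarrow> bool" where
  "asymptotically_optimal A a s \<longleftrightarrow>
     (\<forall>n. a n \<in> A) \<and> (\<lambda>n. ereal (mean (a n s))) \<longlonglongrightarrow> optimal_value A s"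

text \<open>The regret may be \<open>\<infinity>\<close>, because the inner upper limits may be \<open>-\<infinity>\<close>.\<close>

definition regret :: "('v \<Rightarrow> real measure) set \<Rightarrow> 'v \<Rightarrow> 'v \<Rightarrow> ereal" where
  "regret A s1 s2 = optimal_value A s1 -
     (SUP a\<in>{a. asymptotically_optimal A a s2}. limsup (\<lambda>n. ereal (mean (a n s1))))"

text \<open>The regret determines the optimal value only up to an affine function: a single action with
  constant value \<open>1\<close> has optimal value \<open>1\<close>, while its regret vanishes identically.\<close>

lemma action_on_const: "action_on S (\<lambda>_. return borel (r::real))"
proof -
  have "real_distribution (return borel r)"
    unfolding real_distribution_def real_distribution_axioms_def
    by (simp add: prob_space_return)
  moreover have "integrable (return borel r) (\<lambda>x. x)"
    by (simp add: integrable_iff_bounded nn_integral_return)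
  ultimately show ?thesis
    by (auto simp: action_on_def affine_on_def algebra_simps)
qed

lemma optimal_value_const: "optimal_value {\<lambda>_. return borel (r::real)} s = ereal r"
  by (simp add: optimal_value_def mean_def integral_return)

lemma regret_const: "regret {\<lambda>_. return borel (r::real)} s1 s2 = 0"
proof -
  let ?A = "{\<lambda>_. return borel r} :: ('a \<Rightarrow> real measure) set"
  have "{a. asymptotically_optimal ?A a s2} = {\<lambda>_ _. return borel r}"
    by (auto simp: asymptotically_optimal_def optimal_value_const mean_def integral_return)
  thus ?thesis
    by (simp add: regret_def optimal_value_const mean_def integral_return Limsup_const)
qed


section \<open>Sufficiency\<close>

text \<open>The parameter \<open>CP\<close> stands for the completely positive transformations: \<open>stochastic_map\<close> in the
  classical and \<open>quantum_channel\<close> in the quantum case.\<close>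

definition sufficient_for :: "(('w \<Rightarrow> 'v) \<Rightarrow> bool) \<Rightarrow> ('v \<Rightarrow> 'w) \<Rightarrow> 'v set \<Rightarrow> bool" where
  "sufficient_for CP \<Phi> \<Theta> \<longleftrightarrow> (\<exists>\<Psi>. CP \<Psi> \<and> (\<forall>s\<in>\<Theta>. \<Psi> (\<Phi> s) = s))"

definition sufficiency_property ::
    "'v set \<Rightarrow> (('v \<Rightarrow> 'v) \<Rightarrow> bool) \<Rightarrow> ('v \<Rightarrow> real measure) set \<Rightarrow> bool" where
  "sufficiency_property S CP A \<longleftrightarrow>
     (\<forall>\<Phi>. CP \<Phi> \<longrightarrow> (\<forall>s1\<in>S. \<forall>s2\<in>S. sufficient_for CP \<Phi> {s1, s2} \<longrightarrow>
        regret A (\<Phi> s1) (\<Phi> s2) = regret A s1 s2))"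


section \<open>Classical state spaces\<close>

definition prob_vectors :: "(real^'n) set" where
  "prob_vectors = {p. (\<forall>i. 0 \<le> p $ i) \<and> (\<Sum>i\<in>UNIV. p $ i) = 1}"

definition stochastic_map :: "(real^'n \<Rightarrow> real^'m) \<Rightarrow> bool" where
  "stochastic_map \<Phi> \<longleftrightarrow>
     (\<exists>M :: real^'n^'m. (\<forall>i j. 0 \<le> M $ i $ j) \<and> (\<forall>j. (\<Sum>i\<in>UNIV. M $ i $ j) = 1) \<and>
        \<Phi> = (\<lambda>p. M *v p))"

text \<open>The conventions \<open>0 log 0 = 0\<close> and \<open>0 log (0/0) = 0\<close> hold because of \<open>ln 0 = 0\<close>.\<close>

definition shannon_entropy :: "real^'n \<Rightarrow> real" where
  "shannon_entropy p = - (\<Sum>i\<in>UNIV. p $ i * ln (p $ i))"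

definition classical_divergence :: "real^'n \<Rightarrow> real^'n \<Rightarrow> ereal" where
  "classical_divergence p q =
     (if {i. p $ i \<noteq> 0} \<subseteq> {i. q $ i \<noteq> 0}
      then ereal (\<Sum>i\<in>UNIV. p $ i * ln (p $ i / q $ i)) else \<infinity>)"


section \<open>Quantum state spaces\<close>

definition adjoint_mat :: "complex^'n^'m \<Rightarrow> complex^'m^'n" where
  "adjoint_mat X = (\<chi> i j. cnj (X $ j $ i))"

definition cdot :: "complex^'n \<Rightarrow> complex^'n \<Rightarrow> complex" where
  "cdot v w = (\<Sum>i\<in>UNIV. cnj (v $ i) * w $ i)"

definition positive_mat :: "complex^'n^'n \<Rightarrow> bool" where
  "positive_mat X \<longleftrightarrow> (\<forall>v. cdot v (X *v v) \<in> \<real>\<^sub>\<ge>\<^sub>0)"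

definition density_matrices :: "(complex^'n^'n) set" where
  "density_matrices = {s. positive_mat s \<and> trace s = 1}"

text \<open>\<open>X\<close> represents the \<open>k \<times> k\<close> block matrix with blocks \<open>X i j\<close> for \<open>i, j < k\<close>, that is, an
  operator on the \<open>k\<close>-fold direct sum of the Hilbert space; the amplification of \<open>\<Phi>\<close> by the
  identity on \<open>k \<times> k\<close> matrices acts blockwise.\<close>

definition positive_block_mat :: "nat \<Rightarrow> (nat \<Rightarrow> nat \<Rightarrow> complex^'n^'n) \<Rightarrow> bool" where
  "positive_block_mat k X \<longleftrightarrow>
     (\<forall>v :: nat \<Rightarrow> complex^'n. (\<Sum>i<k. \<Sum>j<k. cdot (v i) (X i j *v v j)) \<in> \<real>\<^sub>\<ge>\<^sub>0)"

definition complex_linear_map :: "(complex^'n^'n \<Rightarrow> complex^'m^'m) \<Rightarrow> bool" where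
  "complex_linear_map \<Phi> \<longleftrightarrow>
     (\<forall>X Y. \<Phi> (X + Y) = \<Phi> X + \<Phi> Y) \<and>
     (\<forall>c X. \<Phi> (\<chi> i j. c * X $ i $ j) = (\<chi> i j. c * \<Phi> X $ i $ j))"

definition completely_positive :: "(complex^'n^'n \<Rightarrow> complex^'m^'m) \<Rightarrow> bool" where
  "completely_positive \<Phi> \<longleftrightarrow> complex_linear_map \<Phi> \<and>
     (\<forall>k X. positive_block_mat k X \<longrightarrow> positive_block_mat k (\<lambda>i j. \<Phi> (X i j)))"

definition quantum_channel :: "(complex^'n^'n \<Rightarrow> complex^'m^'m) \<Rightarrow> bool" where
  "quantum_channel \<Phi> \<longleftrightarrow> completely_positive \<Phi> \<and> (\<forall>X. trace (\<Phi> X) = trace X)"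

definition unitary_mat :: "complex^'n^'n \<Rightarrow> bool" where
  "unitary_mat U \<longleftrightarrow> adjoint_mat U ** U = mat 1 \<and> U ** adjoint_mat U = mat 1"

definition diag_mat :: "real^'n \<Rightarrow> complex^'n^'n" where
  "diag_mat d = (\<chi> i j. if i = j then complex_of_real (d $ i) else 0)"

text \<open>Functional calculus of a Hermitian matrix. The result does not depend on the chosen
  diagonalization, as \<open>hermitian_fun_diag\<close> below shows.\<close>

definition hermitian_fun :: "(real \<Rightarrow> real) \<Rightarrow> complex^'n^'n \<Rightarrow> complex^'n^'n" where
  "hermitian_fun f X =
     (THE Y. \<exists>U d. unitary_mat U \<and> X = U ** diag_mat d ** adjoint_mat U \<and>
        Y = U ** diag_mat (\<chi> i. f (d $ i)) ** adjoint_mat U)"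

lemma diag_mat_mult_left: "(diag_mat d ** X) $ i $ j = complex_of_real (d $ i) * X $ i $ j"
proof -
  have "(diag_mat d ** X) $ i $ j =
      (\<Sum>k\<in>UNIV. if i = k then complex_of_real (d $ i) * X $ k $ j else 0)"
    by (simp add: matrix_matrix_mult_def diag_mat_def if_distrib[of "\<lambda>x. x * _"] cong: if_cong)
  thus ?thesis by simp
qed

lemma diag_mat_mult_right: "(X ** diag_mat d) $ i $ j = X $ i $ j * complex_of_real (d $ j)"
proof -
  have "(X ** diag_mat d) $ i $ j =
      (\<Sum>k\<in>UNIV. if k = j then X $ i $ k * complex_of_real (d $ k) else 0)"
    by (simp add: matrix_matrix_mult_def diag_mat_def if_distrib[of "\<lambda>x. _ * x"] cong: if_cong)
  thus ?thesis by simp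
qed

lemma hermitian_fun_diag:
  assumes "unitary_mat U"
  shows "hermitian_fun f (U ** diag_mat d ** adjoint_mat U) =
    U ** diag_mat (\<chi> i. f (d $ i)) ** adjoint_mat U"
proof -
  have unique: "V ** diag_mat (\<chi> i. f (e $ i)) ** adjoint_mat V =
      U ** diag_mat (\<chi> i. f (d $ i)) ** adjoint_mat U"
    if V: "unitary_mat V" and eq: "U ** diag_mat d ** adjoint_mat U = V ** diag_mat e ** adjoint_mat V"
    for V e
  proof -
    define W where "W = adjoint_mat V ** U"
    have "W ** diag_mat d = adjoint_mat V ** (U ** diag_mat d ** adjoint_mat U) ** U"
      using assms by (simp add: W_def unitary_mat_def matrix_mul_assoc[symmetric])
    also have "\<dots> = (adjoint_mat V ** V) ** diag_mat e ** W"
      by (simp add: eq W_def matrix_mul_assoc)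
    finally have comm: "W ** diag_mat d = diag_mat e ** W"
      using V by (simp add: unitary_mat_def)
    have "W ** diag_mat (\<chi> i. f (d $ i)) = diag_mat (\<chi> i. f (e $ i)) ** W"
    proof -
      have "W $ i $ j * complex_of_real (f (d $ j)) = complex_of_real (f (e $ i)) * W $ i $ j" for i j
      proof -
        have "W $ i $ j * complex_of_real (d $ j) = complex_of_real (e $ i) * W $ i $ j"
          using arg_cong[OF comm, of "\<lambda>M. M $ i $ j"]
          by (simp add: diag_mat_mult_left diag_mat_mult_right)
        thus ?thesis by (cases "W $ i $ j = 0") (auto simp: mult.commute)
      qed
      thus ?thesis by (simp add: vec_eq_iff diag_mat_mult_left diag_mat_mult_right)
    qed
    hence "V ** (W ** diag_mat (\<chi> i. f (d $ i))) ** adjoint_mat U =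
        V ** (diag_mat (\<chi> i. f (e $ i)) ** W) ** adjoint_mat U"
      by simp
    moreover have "V ** (W ** diag_mat (\<chi> i. f (d $ i))) ** adjoint_mat U =
        (V ** adjoint_mat V) ** U ** diag_mat (\<chi> i. f (d $ i)) ** adjoint_mat U"
      by (simp add: W_def matrix_mul_assoc)
    moreover have "V ** (diag_mat (\<chi> i. f (e $ i)) ** W) ** adjoint_mat U =
        V ** diag_mat (\<chi> i. f (e $ i)) ** adjoint_mat V ** (U ** adjoint_mat U)"
      by (simp add: W_def matrix_mul_assoc)
    ultimately show ?thesis
      using V assms by (simp add: unitary_mat_def)
  qed
  show ?thesis
    unfolding hermitian_fun_def
  proof (rule the_equality)
    show "\<exists>V e. unitary_mat V \<and>
        U ** diag_mat d ** adjoint_mat U = V ** diag_mat e ** adjoint_mat V \<and>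
        U ** diag_mat (\<chi> i. f (d $ i)) ** adjoint_mat U =
        V ** diag_mat (\<chi> i. f (e $ i)) ** adjoint_mat V"
      using assms by blast
  qed (use unique in blast)
qed

text \<open>With \<open>ln 0 = 0\<close>, the logarithm of a positive matrix is taken on its support and is \<open>0\<close> on its
  kernel. This is the usual convention in both formulas below; the support is the range.\<close>

definition von_neumann_entropy :: "complex^'n^'n \<Rightarrow> real" where
  "von_neumann_entropy s = - Re (trace (s ** hermitian_fun ln s))"

definition quantum_divergence :: "complex^'n^'n \<Rightarrow> complex^'n^'n \<Rightarrow> ereal" where
  "quantum_divergence s t =
     (if range ((*v) s) \<subseteq> range ((*v) t)
      then ereal (Re (trace (s ** (hermitian_fun ln s - hermitian_fun ln t)))) else \<infinity>)"

end

theory Submission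
  imports Defs
begin

text \<open>The regret sees an action set only through its optimal value \<open>F\<close>: it is the Bregman divergence
  \<open>F s - F t - F'(t; s - t)\<close> with the one-sided directional derivative (\<open>regret_eq\<close>), and \<open>F\<close> is
  convex. Conversely the regret determines \<open>F\<close> up to an affine function
  (\<open>regret_determines_value\<close>). A symmetry of the regret is therefore a symmetry of \<open>F\<close> modulo
  affine functions.

  In the classical case the symmetries come from the maps that merge two letters \<open>i\<close>, \<open>j\<close> and split
  the merged mass again in the proportion \<open>w : 1 - w\<close>. For fixed \<open>i\<close>, \<open>j\<close> any two of them undo each
  other on their ranges, so the regret does not depend on \<open>w\<close>, and \<open>F\<close> satisfies a grouping
  identity (\<open>value_split_map\<close>): splitting a mass \<open>m\<close> changes \<open>F\<close> by \<open>m\<close> times a function of the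
  proportion, apart from an affine correction. The remaining letters do not enter that change because
  an affine function on the simplex is determined by its values at the vertices. With at least three
  letters the function of the proportion is the same for all pairs of letters, and grouping three
  letters in two ways gives the fundamental equation of information. Its convex solutions are
  multiples of the binary entropy: taking right derivatives turns it into the logarithmic Cauchy
  equation, whose solutions of constant sign are multiples of the logarithm
  (\<open>fundamental_equation_of_information\<close>). Induction on the size of the support extends this to all
  probability vectors (\<open>entropy_from_grouping\<close>).

  In the quantum case the density matrices that are diagonal in a fixed orthonormal basis form a
  classical state space, and stochastic maps on it lift to channels. Hence \<open>F\<close> is a multiple of the
  negative entropy plus an affine function on each of these simplices, and the factor \<open>\<kappa>\<close> does not
  depend on the basis because unitary conjugation preserves the regret
  (\<open>value_on_commuting_states\<close>). It remains to glue the affine functions. Let \<open>E\<close> be the negative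
  entropy and \<open>G = F - \<kappa> E\<close>. Every state commutes with the maximally mixed state \<open>c\<close>, so \<open>G\<close> is
  affine on every line through \<open>c\<close>. As \<open>E\<close> is stationary at \<open>c\<close>, convexity of \<open>F\<close> near \<open>c\<close> makes
  \<open>G\<close> convex, and a function that is convex and also affine on every line through an interior point
  is affine (\<open>value_minus_entropy_affine\<close>).

  Finally the regret is computed from the directional derivative of the entropy. For density matrices
  that need not commute, this derivative is squeezed between two applications of the inequality of
  Peierls, one in an eigenbasis of the base point and one in eigenbases of the nearby states, which
  converge along a subsequence by compactness of the unitary group (\<open>quantum_entropy_slope\<close>). If the
  support condition fails, the derivative is \<open>-\<infinity>\<close>, which gives the value \<open>\<infinity>\<close> of the divergence.\<close>

section \<open>Means of mixtures\<close>

lemma nn_integral_mixture: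
  fixes f :: "real \<Rightarrow> ennreal"
  assumes M: "real_distribution M" and N: "real_distribution N" and K: "real_distribution K"
    and u: "0 \<le> u" "u \<le> 1"
    and mix: "\<And>B. B \<in> sets borel \<Longrightarrow> measure K B = (1 - u) * measure M B + u * measure N B"
    and f: "f \<in> borel_measurable borel"
  shows "(\<integral>\<^sup>+x. f x \<partial>K) = ennreal (1 - u) * (\<integral>\<^sup>+x. f x \<partial>M) + ennreal u * (\<integral>\<^sup>+x. f x \<partial>N)"
proof -
  interpret M: real_distribution M by fact
  interpret N: real_distribution N by fact
  interpret K: real_distribution K by fact
  show ?thesis
    using f
  proof (induction rule: borel_measurable_induct)
    case (cong f g)
    then have "f = g" by (simp add: fun_eq_iff)
    then show ?case using cong by simp
  next
    case (set B)
    have "emeasure K B = ennreal ((1 - u) * measure M B + u * measure N B)"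
      using mix[OF set] by (simp add: K.emeasure_eq_measure)
    also have "\<dots> = ennreal (1 - u) * emeasure M B + ennreal u * emeasure N B"
      using u by (simp add: ennreal_plus ennreal_mult M.emeasure_eq_measure N.emeasure_eq_measure)
    finally show ?case using set by simp
  next
    case (mult g c)
    then have "g \<in> borel_measurable M" "g \<in> borel_measurable N" "g \<in> borel_measurable K"
      by auto
    then show ?case using mult.IH
      by (simp add: nn_integral_cmult distrib_left mult.left_commute)
  next
    case (add f g)
    then have "g \<in> borel_measurable M" "g \<in> borel_measurable N" "g \<in> borel_measurable K"
      "f \<in> borel_measurable M" "f \<in> borel_measurable N" "f \<in> borel_measurable K"
      by auto
    then show ?case using add.IH
      by (simp add: nn_integral_add distrib_left ac_simps)
  next
    case (seq U)
    have m: "U i \<in> borel_measurable M" "U i \<in> borel_measurable N" "U i \<in> borel_measurable K" for i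
      using seq(1) by auto
    have sup: "integral\<^sup>N L (SUP i. U i) = (SUP i. integral\<^sup>N L (U i))" if "sets L = sets borel" for L
    proof -
      have "U i \<in> borel_measurable L" for i
        using seq(1) measurable_cong_sets[OF that refl] by auto
      moreover have "(SUP i. U i) = (\<lambda>x. SUP i. U i x)"
        by (simp add: fun_eq_iff image_comp)
      ultimately show ?thesis
        using nn_integral_monotone_convergence_SUP[OF seq.hyps(3)] by simp
    qed
    have inc: "incseq (\<lambda>i. integral\<^sup>N L (U i))" for L :: "real measure"
      using seq.hyps(3) by (auto simp: incseq_def le_fun_def intro!: nn_integral_mono)
    have "(SUP i. ennreal (1 - u) * integral\<^sup>N M (U i) + ennreal u * integral\<^sup>N N (U i))
      = (SUP i. ennreal (1 - u) * integral\<^sup>N M (U i)) + (SUP i. ennreal u * integral\<^sup>N N (U i))"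
      using inc[of M] inc[of N]
      by (intro ennreal_SUP_add) (auto simp: incseq_def intro!: mult_left_mono)
    then show ?case
      unfolding sup[OF M.events_eq_borel] sup[OF N.events_eq_borel] sup[OF K.events_eq_borel] seq.IH
      by (simp only: SUP_mult_left_ennreal)
  qed
qed

text \<open>Actions are affine only as functions into measures, event by event. This is what makes their means
  affine functions of the state.\<close>

lemma integral_mixture:
  assumes M: "real_distribution M" and N: "real_distribution N" and K: "real_distribution K"
    and u: "0 \<le> u" "u \<le> 1"
    and mix: "\<And>B. B \<in> sets borel \<Longrightarrow> measure K B = (1 - u) * measure M B + u * measure N B"
    and iM: "integrable M (\<lambda>x. x)" and iN: "integrable N (\<lambda>x. x)" and iK: "integrable K (\<lambda>x. x)"
  shows "mean K = (1 - u) * mean M + u * mean N"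
proof -
  have fin: "(\<integral>\<^sup>+x. ennreal (c * x) \<partial>L) < \<infinity>" if "integrable L (\<lambda>x. x)" for c :: real and L
  proof -
    have "integrable L (\<lambda>x. c * x)" using that by simp
    then show ?thesis
      using real_integrable_def[of L "\<lambda>x. c * x"] by (simp add: less_top)
  qed
  have e: "enn2real (\<integral>\<^sup>+x. ennreal (c * x) \<partial>K) =
      (1 - u) * enn2real (\<integral>\<^sup>+x. ennreal (c * x) \<partial>M) + u * enn2real (\<integral>\<^sup>+x. ennreal (c * x) \<partial>N)" for c
  proof -
    have *: "(\<integral>\<^sup>+x. ennreal (c * x) \<partial>K) =
      ennreal (1 - u) * (\<integral>\<^sup>+x. ennreal (c * x) \<partial>M) + ennreal u * (\<integral>\<^sup>+x. ennreal (c * x) \<partial>N)"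
      by (rule nn_integral_mixture[OF M N K u mix]) auto
    show ?thesis
      unfolding * using fin[OF iM, of c] fin[OF iN, of c] u
      by (subst enn2real_plus) (auto simp: enn2real_mult ennreal_mult_less_top)
  qed
  have mean_eq: "mean L = enn2real (\<integral>\<^sup>+x. ennreal (1 * x) \<partial>L) - enn2real (\<integral>\<^sup>+x. ennreal ((-1) * x) \<partial>L)"
    if "integrable L (\<lambda>x. x)" for L
    using real_lebesgue_integral_def[OF that] by (simp add: mean_def)
  show ?thesis
    unfolding mean_eq[OF iM] mean_eq[OF iN] mean_eq[OF iK] e[of 1] e[of "-1"]
    by (simp add: algebra_simps)
qed

lemma mean_action_affine:
  assumes "action_on S a" "convex S" "s \<in> S" "t \<in> S" "0 \<le> u" "u \<le> 1"
  shows "mean (a ((1 - u) *\<^sub>R s + u *\<^sub>R t)) = (1 - u) * mean (a s) + u * mean (a t)"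
proof -
  have "(1 - u) *\<^sub>R s + u *\<^sub>R t \<in> S"
    using assms by (intro convexD) auto
  then show ?thesis
    using assms by (intro integral_mixture) (auto simp: action_on_def affine_on_def)
qed

section \<open>The regret as a Bregman divergence\<close>

text \<open>Infinite optimal values become \<open>0\<close>; the locale below assumes finiteness on the state space.\<close>

definition opt :: "('v \<Rightarrow> real measure) set \<Rightarrow> 'v \<Rightarrow> real" where
  "opt A s = real_of_ereal (optimal_value A s)"

text \<open>The base point is the second state, as in the regret.\<close>

definition slope :: "('v::real_vector \<Rightarrow> real) \<Rightarrow> 'v \<Rightarrow> 'v \<Rightarrow> real \<Rightarrow> real" where
  "slope f s t u = (f ((1 - u) *\<^sub>R t + u *\<^sub>R s) - f t) / u"

locale action_set =
  fixes S :: "'v::real_vector set" and A :: "('v \<Rightarrow> real measure) set"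
  assumes convex_states: "convex S"
    and actions: "\<And>a. a \<in> A \<Longrightarrow> action_on S a"
    and finite_value: "\<And>s. s \<in> S \<Longrightarrow> \<bar>optimal_value A s\<bar> \<noteq> \<infinity>"
begin

abbreviation F :: "'v \<Rightarrow> real" where "F \<equiv> opt A"

lemma optimal_value_eq: "s \<in> S \<Longrightarrow> optimal_value A s = ereal (F s)"
  using finite_value unfolding opt_def by (simp add: ereal_real')

lemma mean_le_F: "a \<in> A \<Longrightarrow> s \<in> S \<Longrightarrow> mean (a s) \<le> F s"
  by (metis SUP_upper ereal_less_eq(3) optimal_value_def optimal_value_eq)

lemma ex_near_F:
  assumes "s \<in> S" "0 < e"
  shows "\<exists>a\<in>A. F s - e < mean (a s)"
proof -
  have "ereal (F s - e) < (SUP a\<in>A. ereal (mean (a s)))"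
    using assms by (simp flip: optimal_value_def add: optimal_value_eq)
  then show ?thesis
    by (auto simp: less_SUP_iff)
qed

lemma segment_mem: "s \<in> S \<Longrightarrow> t \<in> S \<Longrightarrow> 0 \<le> u \<Longrightarrow> u \<le> 1 \<Longrightarrow> (1 - u) *\<^sub>R s + u *\<^sub>R t \<in> S"
  using convex_states by (intro convexD) auto

lemma mean_affine:
  assumes "a \<in> A" "s \<in> S" "t \<in> S" "0 \<le> u" "u \<le> 1"
  shows "mean (a ((1 - u) *\<^sub>R s + u *\<^sub>R t)) = (1 - u) * mean (a s) + u * mean (a t)"
  using assms actions convex_states by (intro mean_action_affine) auto

lemma convex_F: "convex_on S F"
proof (rule convex_onI)
  fix u :: real and s t assume *: "0 < u" "u < 1" "s \<in> S" "t \<in> S"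
  show "F ((1 - u) *\<^sub>R s + u *\<^sub>R t) \<le> (1 - u) * F s + u * F t"
  proof (rule field_le_epsilon)
    fix e :: real assume "0 < e"
    then obtain a where "a \<in> A" and a: "F ((1 - u) *\<^sub>R s + u *\<^sub>R t) - e < mean (a ((1 - u) *\<^sub>R s + u *\<^sub>R t))"
      using ex_near_F[OF segment_mem[of s t u]] * by force
    have "mean (a ((1 - u) *\<^sub>R s + u *\<^sub>R t)) = (1 - u) * mean (a s) + u * mean (a t)"
      using * \<open>a \<in> A\<close> by (intro mean_affine) auto
    also have "\<dots> \<le> (1 - u) * F s + u * F t"
      using * \<open>a \<in> A\<close> by (intro add_mono mult_left_mono mean_le_F) auto
    finally show "F ((1 - u) *\<^sub>R s + u *\<^sub>R t) \<le> (1 - u) * F s + u * F t + e"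
      using a by linarith
  qed
qed (rule convex_states)

text \<open>A sequence of times tending to \<open>0\<close> suffices to identify the directional derivative. This matters
  below for noncommuting density matrices, where the slopes are only controlled along a subsequence.\<close>

lemma regret_eq:
  assumes s: "s \<in> S" and t: "t \<in> S"
    and \<tau>: "\<And>n. 0 < \<tau> n" "\<And>n. \<tau> n \<le> 1" "\<tau> \<longlonglongrightarrow> 0"
    and L: "(\<lambda>n. ereal (slope F s t (\<tau> n))) \<longlonglongrightarrow> L"
  shows "regret A s t = ereal (F s) - (ereal (F t) + L)"
proof -
  define x where "x = (\<lambda>n. (1 - \<tau> n) *\<^sub>R t + \<tau> n *\<^sub>R s)"
  have x: "x n \<in> S" for n
    unfolding x_def using s t \<tau>(1,2)[of n] by (intro segment_mem) auto
  have mean_x: "mean (a (x n)) = (1 - \<tau> n) * mean (a t) + \<tau> n * mean (a s)" if "a \<in> A" for a n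
    unfolding x_def using s t that \<tau>(1,2)[of n] by (intro mean_affine) auto
  have Fx: "F (x n) = F t + \<tau> n * slope F s t (\<tau> n)" for n
    using \<tau>(1)[of n] by (simp add: slope_def x_def)
  have "(SUP a\<in>{a. asymptotically_optimal A a t}. limsup (\<lambda>n. ereal (mean (a n s)))) = ereal (F t) + L"
  proof (rule antisym)
    \<comment> \<open>Actions that are almost optimal at \<open>t\<close> lie below \<open>F\<close> at \<open>x k\<close>, so by affinity their value
      at \<open>s\<close> is at most that of the secant of \<open>F\<close> through \<open>t\<close> and \<open>x k\<close>.\<close>
    show "(SUP a\<in>{a. asymptotically_optimal A a t}. limsup (\<lambda>n. ereal (mean (a n s)))) \<le> ereal (F t) + L"
    proof (rule SUP_least)
      fix a assume "a \<in> {a. asymptotically_optimal A a t}"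
      then have a: "\<And>n. a n \<in> A" and lim: "(\<lambda>n. mean (a n t)) \<longlonglongrightarrow> F t"
        using optimal_value_eq[OF t] by (auto simp: asymptotically_optimal_def)
      have "limsup (\<lambda>n. ereal (mean (a n s))) \<le> ereal (F t + slope F s t (\<tau> k))" for k
      proof -
        have nz: "\<tau> k \<noteq> 0"
          using \<tau>(1)[of k] by simp
        have "mean (a n s) \<le> mean (a n t) + (F (x k) - mean (a n t)) / \<tau> k" for n
        proof -
          have "\<tau> k * (mean (a n s) - mean (a n t)) \<le> F (x k) - mean (a n t)"
            using mean_x[OF a, of n k] mean_le_F[OF a x, of n k] by (simp add: algebra_simps)
          then show ?thesis
            using \<tau>(1)[of k] by (simp add: field_simps)
        qed
        then have "limsup (\<lambda>n. ereal (mean (a n s))) \<le>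
            limsup (\<lambda>n. ereal (mean (a n t) + (F (x k) - mean (a n t)) / \<tau> k))"
          by (intro Limsup_mono) auto
        also have "\<dots> = ereal (F t + (F (x k) - F t) / \<tau> k)"
          using nz by (intro lim_imp_Limsup) (auto intro!: tendsto_intros lim)
        finally show ?thesis
          using nz by (simp add: Fx)
      qed
      then have "limsup (\<lambda>n. ereal (mean (a n s))) \<le> ereal (F t) + ereal (slope F s t (\<tau> k))" for k
        by simp
      moreover have "(\<lambda>k. ereal (F t) + ereal (slope F s t (\<tau> k))) \<longlonglongrightarrow> ereal (F t) + L"
        by (intro tendsto_add_ereal_general tendsto_const L) auto
      ultimately show "limsup (\<lambda>n. ereal (mean (a n s))) \<le> ereal (F t) + L"
        by (intro LIMSEQ_le_const) auto
    qed
  next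
    \<comment> \<open>The upper bound is attained by actions that are almost optimal at \<open>x n\<close>. The error has to be
      \<open>o(\<tau> n)\<close>, since it is divided by \<open>\<tau> n\<close> when extrapolating from \<open>x n\<close> to \<open>s\<close>.\<close>
    have "\<exists>a\<in>A. F (x n) - (\<tau> n)\<^sup>2 < mean (a (x n))" for n
      using \<tau>(1)[of n] by (intro ex_near_F x) auto
    then obtain a where a: "\<And>n. a n \<in> A" and near: "\<And>n. F (x n) - (\<tau> n)\<^sup>2 < mean (a n (x n))"
      by metis
    have lower_s: "F t + slope F s t (\<tau> n) - \<tau> n \<le> mean (a n s)" for n
    proof -
      have "F t + \<tau> n * slope F s t (\<tau> n) - (\<tau> n)\<^sup>2 \<le> (1 - \<tau> n) * mean (a n t) + \<tau> n * mean (a n s)"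
        using near[of n] by (simp add: mean_x[OF a] Fx)
      also have "\<dots> \<le> (1 - \<tau> n) * F t + \<tau> n * mean (a n s)"
        using mean_le_F[OF a t] \<tau>(2)[of n] by (intro add_right_mono mult_left_mono) auto
      finally have "\<tau> n * (F t + slope F s t (\<tau> n) - \<tau> n) \<le> \<tau> n * mean (a n s)"
        by (simp add: algebra_simps power2_eq_square)
      then show ?thesis
        using \<tau>(1)[of n] by simp
    qed
    \<comment> \<open>These actions are asymptotically optimal at \<open>t\<close> because \<open>F\<close>, being a supremum of affine
      functions, is lower semicontinuous along the segment: compare with a fixed action \<open>c\<close> that
      is almost optimal at \<open>t\<close>.\<close>
    have "(\<lambda>n. mean (a n t)) \<longlonglongrightarrow> F t"
    proof (rule LIMSEQ_I)
      fix e :: real assume e: "0 < e"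
      then obtain c where c: "c \<in> A" "F t - e / 2 < mean (c t)"
        using ex_near_F[OF t, of "e / 2"] by auto
      have "(\<lambda>n. (1 - \<tau> n) * mean (c t) + \<tau> n * mean (c s) - (\<tau> n)\<^sup>2 - \<tau> n * (F s - F t))
          \<longlonglongrightarrow> (1 - 0) * mean (c t) + 0 * mean (c s) - 0\<^sup>2 - 0 * (F s - F t)"
        by (intro tendsto_intros \<tau>(3))
      then have "(\<lambda>n. (1 - \<tau> n) * mean (c t) + \<tau> n * mean (c s) - (\<tau> n)\<^sup>2 - \<tau> n * (F s - F t))
          \<longlonglongrightarrow> mean (c t)"
        by simp
      then have "eventually (\<lambda>n. F t - e / 2 <
          (1 - \<tau> n) * mean (c t) + \<tau> n * mean (c s) - (\<tau> n)\<^sup>2 - \<tau> n * (F s - F t)) sequentially"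
        using c(2) order_tendstoD(1) by blast
      moreover have "eventually (\<lambda>n. \<tau> n < 1 / 2) sequentially"
        using order_tendstoD(2)[OF \<tau>(3), of "1/2"] by auto
      ultimately have "eventually (\<lambda>n. \<bar>mean (a n t) - F t\<bar> < e) sequentially"
      proof eventually_elim
        case (elim n)
        have "mean (c (x n)) - (\<tau> n)\<^sup>2 < mean (a n (x n))"
          using near[of n] mean_le_F[OF c(1) x, of n] by linarith
        then have "(1 - \<tau> n) * mean (c t) + \<tau> n * mean (c s) - (\<tau> n)\<^sup>2 <
            (1 - \<tau> n) * mean (a n t) + \<tau> n * mean (a n s)"
          by (simp add: mean_x a c)
        also have "\<dots> \<le> (1 - \<tau> n) * mean (a n t) + \<tau> n * F s"
          using mean_le_F[OF a s] \<tau>(1)[of n] by (intro add_left_mono mult_left_mono) auto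
        finally have "(1 - \<tau> n) * mean (a n t) + \<tau> n * F t > F t - e / 2"
          using elim by (simp add: algebra_simps)
        then have "(1 - \<tau> n) * (F t - mean (a n t)) < e / 2"
          by (simp add: algebra_simps)
        moreover have "0 \<le> F t - mean (a n t)"
          using mean_le_F[OF a t] by simp
        then have "(1/2) * (F t - mean (a n t)) \<le> (1 - \<tau> n) * (F t - mean (a n t))"
          using elim by (intro mult_right_mono) auto
        ultimately show ?case
          using mean_le_F[OF a t, of n] by (simp add: abs_if)
      qed
      then show "\<exists>no. \<forall>n\<ge>no. norm (mean (a n t) - F t) < e"
        by (simp add: eventually_sequentially)
    qed
    then have opt: "asymptotically_optimal A a t"
      using a optimal_value_eq[OF t] by (simp add: asymptotically_optimal_def)
    have "(\<lambda>n. ereal (F t) + ereal (slope F s t (\<tau> n)) + ereal (- \<tau> n)) \<longlonglongrightarrow> ereal (F t) + L + ereal (- 0)"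
      by (intro tendsto_add_ereal_general tendsto_const L tendsto_intros \<tau>(3) iffD2[OF lim_ereal]) auto
    then have "ereal (F t) + L = limsup (\<lambda>n. ereal (F t) + ereal (slope F s t (\<tau> n)) + ereal (- \<tau> n))"
      by (simp add: lim_imp_Limsup)
    also have "\<dots> \<le> limsup (\<lambda>n. ereal (mean (a n s)))"
      using lower_s by (intro Limsup_mono) auto
    also have "\<dots> \<le> (SUP a\<in>{a. asymptotically_optimal A a t}. limsup (\<lambda>n. ereal (mean (a n s))))"
      using opt by (intro SUP_upper) auto
    finally show "ereal (F t) + L \<le> (SUP a\<in>{a. asymptotically_optimal A a t}. limsup (\<lambda>n. ereal (mean (a n s))))" .
  qed
  then show ?thesis
    using optimal_value_eq[OF s] by (simp add: regret_def)
qed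

end

section \<open>The regret determines the optimal value\<close>

lemma optimal_value_pullback: "optimal_value ((\<lambda>a s. a (\<phi> s)) ` A) s = optimal_value A (\<phi> s)"
  by (simp add: optimal_value_def image_comp)

lemma opt_pullback: "opt ((\<lambda>a s. a (\<phi> s)) ` A) s = opt A (\<phi> s)"
  by (simp add: opt_def optimal_value_pullback)

text \<open>Precomposing all actions with a map of states pulls the regret back along it. Invariance of the
  regret under a channel thus becomes equality of the regrets of two action sets.\<close>

lemma regret_pullback: "regret ((\<lambda>a s. a (\<phi> s)) ` A) s t = regret A (\<phi> s) (\<phi> t)"
proof -
  have "{b. asymptotically_optimal ((\<lambda>a s. a (\<phi> s)) ` A) b t} =
      (\<lambda>a n s. a n (\<phi> s)) ` {a. asymptotically_optimal A a (\<phi> t)}" (is "?L = ?R")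
  proof
    show "?R \<subseteq> ?L"
      by (auto simp: asymptotically_optimal_def optimal_value_pullback)
    show "?L \<subseteq> ?R"
    proof
      fix b assume b: "b \<in> ?L"
      then have "\<forall>n. \<exists>a\<in>A. b n = (\<lambda>s. a (\<phi> s))"
        by (auto simp: asymptotically_optimal_def)
      then obtain a where a: "\<And>n. a n \<in> A" "\<And>n. b n = (\<lambda>s. a n (\<phi> s))"
        by metis
      with b have "asymptotically_optimal A a (\<phi> t)"
        by (simp add: asymptotically_optimal_def optimal_value_pullback)
      then show "b \<in> ?R"
        using a(2) by (intro image_eqI[of _ _ a]) auto
    qed
  qed
  then show ?thesis
    by (simp add: regret_def optimal_value_pullback image_comp)
qed

lemma action_set_pullback:
  assumes A: "action_set S A" and "convex T" and \<phi>: "\<And>s. s \<in> T \<Longrightarrow> \<phi> s \<in> S"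
    and affine: "\<And>s t u. s \<in> T \<Longrightarrow> t \<in> T \<Longrightarrow> 0 \<le> u \<Longrightarrow> u \<le> 1 \<Longrightarrow>
      \<phi> ((1 - u) *\<^sub>R s + u *\<^sub>R t) = (1 - u) *\<^sub>R \<phi> s + u *\<^sub>R \<phi> t"
  shows "action_set T ((\<lambda>a s. a (\<phi> s)) ` A)"
proof -
  interpret action_set S A by fact
  show ?thesis
  proof
    show "convex T" by fact
    show "\<bar>optimal_value ((\<lambda>a s. a (\<phi> s)) ` A) s\<bar> \<noteq> \<infinity>" if "s \<in> T" for s
      using finite_value \<phi>[OF that] by (simp add: optimal_value_pullback)
    show "action_on T b" if "b \<in> (\<lambda>a s. a (\<phi> s)) ` A" for b
    proof -
      obtain a where "a \<in> A" and b: "b = (\<lambda>s. a (\<phi> s))" using \<open>b \<in> _\<close> by auto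
      from actions[OF this(1)] have a: "action_on S a" .
      show ?thesis
        unfolding action_on_def
      proof (intro conjI ballI)
        fix s assume "s \<in> T"
        then show "real_distribution (b s)" "integrable (b s) (\<lambda>x. x)"
          using a \<phi> by (auto simp: b action_on_def)
      next
        fix B :: "real set" assume "B \<in> sets borel"
        then have "affine_on S (\<lambda>s. measure (a s) B)"
          using a by (simp add: action_on_def)
        then show "affine_on T (\<lambda>s. measure (b s) B)"
          using \<phi> by (simp add: affine_on_def b affine)
      qed
    qed
  qed
qed

lemma convex_right_derivative:
  fixes f :: "real \<Rightarrow> real"
  assumes f: "convex_on {a..b} f" and x: "a < x" "x < b"
  obtains r where "(f has_real_derivative r) (at_right x)"
    "\<And>y. y \<in> {a..b} \<Longrightarrow> f x + r * (y - x) \<le> f y"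
proof -
  \<comment> \<open>Slopes of a convex function are monotone, so the right derivative is the infimum of the slopes
    to the right of \<open>x\<close>.\<close>
  define \<sigma> where "\<sigma> = (\<lambda>y. (f y - f x) / (y - x))"
  have \<sigma>': "\<sigma> y = (f x - f y) / (x - y)" for y
    unfolding \<sigma>_def using minus_divide_divide[of "f x - f y" "x - y"] by simp
  have mono: "\<sigma> y \<le> \<sigma> z" if "x < y" "y \<le> z" "z \<le> b" for y z
  proof (cases "y = z")
    case False
    then show ?thesis
      using convex_on_slope_le(1)[OF f, of x z y] that x by (simp add: \<sigma>')
  qed simp
  have cross: "\<sigma> y \<le> \<sigma> z" if "a \<le> y" "y < x" "x < z" "z \<le> b" for y z
    using order_trans[OF convex_on_slope_le(1)[OF f, of y z x] convex_on_slope_le(2)[OF f, of y z x]]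
      that by (simp add: \<sigma>' \<sigma>_def[symmetric]) (simp add: \<sigma>_def \<sigma>'[symmetric])
  define r where "r = Inf (\<sigma> ` {x<..b})"
  have bdd: "bdd_below (\<sigma> ` {x<..b})"
    using cross[of a] x by (intro bdd_belowI2[of _ "\<sigma> a"]) auto
  have le: "r \<le> \<sigma> y" if "x < y" "y \<le> b" for y
    unfolding r_def using that by (intro cInf_lower bdd) auto
  have ge: "\<sigma> y \<le> r" if "a \<le> y" "y < x" for y
    unfolding r_def using that cross x by (intro cInf_greatest) auto
  have "(\<sigma> \<longlongrightarrow> r) (at_right x)"
  proof (rule order_tendstoI)
    fix l assume "l < r"
    then show "eventually (\<lambda>y. l < \<sigma> y) (at_right x)"
      using le x by (intro eventually_at_rightI[of x b]) force+
  next
    fix u assume "r < u"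
    then obtain y where "x < y" "y \<le> b" "\<sigma> y < u"
      unfolding r_def using x by (subst (asm) cInf_less_iff[OF _ bdd]) auto
    show "eventually (\<lambda>y. \<sigma> y < u) (at_right x)"
    proof (rule eventually_at_rightI[of x y])
      show "\<sigma> w < u" if "w \<in> {x<..<y}" for w
        using mono[of w y] that \<open>y \<le> b\<close> \<open>\<sigma> y < u\<close> by simp
    qed fact
  qed
  then have "(f has_real_derivative r) (at_right x)"
    by (simp add: has_field_derivative_iff \<sigma>_def)
  moreover have "f x + r * (y - x) \<le> f y" if "y \<in> {a..b}" for y
    using le[of y] ge[of y] that by (cases y x rule: linorder_cases) (auto simp: \<sigma>_def field_simps)
  ultimately show thesis using that by blast
qed

lemma convex_on_segment:
  assumes "convex_on S f" "s \<in> S" "t \<in> S"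
  shows "convex_on {0..1} (\<lambda>u. f ((1 - u) *\<^sub>R s + u *\<^sub>R t))"
proof (rule convex_onI)
  fix w x y :: real assume *: "0 < w" "w < 1" "x \<in> {0..1}" "y \<in> {0..1}"
  have S: "(1 - u) *\<^sub>R s + u *\<^sub>R t \<in> S" if "u \<in> {0..1}" for u
    using assms that by (intro convexD) (auto simp: convex_on_def)
  have "(1 - ((1 - w) *\<^sub>R x + w *\<^sub>R y)) *\<^sub>R s + ((1 - w) *\<^sub>R x + w *\<^sub>R y) *\<^sub>R t =
      (1 - w) *\<^sub>R ((1 - x) *\<^sub>R s + x *\<^sub>R t) + w *\<^sub>R ((1 - y) *\<^sub>R s + y *\<^sub>R t)"
    by (simp add: algebra_simps)
  then show "f ((1 - ((1 - w) *\<^sub>R x + w *\<^sub>R y)) *\<^sub>R s + ((1 - w) *\<^sub>R x + w *\<^sub>R y) *\<^sub>R t) \<le>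
      (1 - w) * f ((1 - x) *\<^sub>R s + x *\<^sub>R t) + w * f ((1 - y) *\<^sub>R s + y *\<^sub>R t)"
    using convex_onD[OF assms(1), of w] S * by simp
qed simp

text \<open>At an interior point \<open>u\<close> of a segment the right derivative is finite, and it serves all \<open>v \<ge> u\<close>
  at once.\<close>

lemma (in action_set) regret_segment:
  assumes s: "s \<in> S" and t: "t \<in> S" and u: "0 < u" "u < 1"
  obtains r where "\<And>v. u \<le> v \<Longrightarrow> v \<le> 1 \<Longrightarrow>
    regret A ((1 - v) *\<^sub>R s + v *\<^sub>R t) ((1 - u) *\<^sub>R s + u *\<^sub>R t) =
    ereal (F ((1 - v) *\<^sub>R s + v *\<^sub>R t) - F ((1 - u) *\<^sub>R s + u *\<^sub>R t) - r * (v - u))"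
proof -
  define f where "f = (\<lambda>u. F ((1 - u) *\<^sub>R s + u *\<^sub>R t))"
  have "convex_on {0..1} f"
    unfolding f_def using convex_F s t by (rule convex_on_segment)
  then obtain r where r: "(f has_real_derivative r) (at_right u)"
    using u by (rule convex_right_derivative)
  have "regret A ((1 - v) *\<^sub>R s + v *\<^sub>R t) ((1 - u) *\<^sub>R s + u *\<^sub>R t) =
    ereal (F ((1 - v) *\<^sub>R s + v *\<^sub>R t)) - (ereal (F ((1 - u) *\<^sub>R s + u *\<^sub>R t)) + ereal (r * (v - u)))"
    if v: "u \<le> v" "v \<le> 1" for v
  proof (rule regret_eq)
    show "(1 - v) *\<^sub>R s + v *\<^sub>R t \<in> S" "(1 - u) *\<^sub>R s + u *\<^sub>R t \<in> S"
      using s t u v by (auto intro!: segment_mem)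
    show "0 < inverse (real (Suc n))" "inverse (real (Suc n)) \<le> 1" for n
      by (auto simp: field_simps)
    show lim: "(\<lambda>n. inverse (real (Suc n))) \<longlonglongrightarrow> 0"
      by (rule LIMSEQ_inverse_real_of_nat)
    have slope: "slope F ((1 - v) *\<^sub>R s + v *\<^sub>R t) ((1 - u) *\<^sub>R s + u *\<^sub>R t) w = (f (u + w * (v - u)) - f u) / w" for w
    proof -
      have "(1 - w) *\<^sub>R ((1 - u) *\<^sub>R s + u *\<^sub>R t) + w *\<^sub>R ((1 - v) *\<^sub>R s + v *\<^sub>R t) =
        (1 - (u + w * (v - u))) *\<^sub>R s + (u + w * (v - u)) *\<^sub>R t"
        by (simp add: algebra_simps)
      then show ?thesis by (simp add: slope_def f_def)
    qed
    show "(\<lambda>n. ereal (slope F ((1 - v) *\<^sub>R s + v *\<^sub>R t) ((1 - u) *\<^sub>R s + u *\<^sub>R t) (inverse (real (Suc n)))))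
        \<longlonglongrightarrow> ereal (r * (v - u))"
    proof (cases "v = u")
      case True
      then show ?thesis unfolding slope by (simp add: zero_ereal_def)
    next
      case False
      then have uv: "u < v" using v by simp
      have "((\<lambda>y. (f y - f u) / (y - u)) \<longlongrightarrow> r) (at_right u)"
        using r by (simp add: has_field_derivative_iff)
      moreover have "filterlim (\<lambda>n. u + inverse (real (Suc n)) * (v - u)) (at_right u) sequentially"
      proof (rule tendsto_imp_filterlim_at_right)
        have "(\<lambda>n. u + inverse (real (Suc n)) * (v - u)) \<longlonglongrightarrow> u + 0 * (v - u)"
          by (intro tendsto_intros lim)
        then show "(\<lambda>n. u + inverse (real (Suc n)) * (v - u)) \<longlonglongrightarrow> u" by simp
        show "\<forall>\<^sub>F n in sequentially. u < u + inverse (real (Suc n)) * (v - u)"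
          using uv by (simp add: field_simps)
      qed
      ultimately have "(\<lambda>n. (f (u + inverse (real (Suc n)) * (v - u)) - f u) / (u + inverse (real (Suc n)) * (v - u) - u)) \<longlonglongrightarrow> r"
        by (rule filterlim_compose)
      then have "(\<lambda>n. (f (u + inverse (real (Suc n)) * (v - u)) - f u) / (inverse (real (Suc n)) * (v - u)) * (v - u)) \<longlonglongrightarrow> r * (v - u)"
        by (intro tendsto_intros) simp
      then show ?thesis
        unfolding slope using uv by (simp add: divide_simps)
    qed
  qed
  then show thesis
    using that[of r] by (simp add: algebra_simps)
qed

lemma affine_if_affine_on_overlapping_pieces:
  fixes h :: "real \<Rightarrow> real"
  assumes "\<And>v. 1/3 \<le> v \<Longrightarrow> v \<le> 1 \<Longrightarrow> h v - h (1/3) = \<alpha> * (v - 1/3)"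
    and "\<And>v. 0 \<le> v \<Longrightarrow> v \<le> 2/3 \<Longrightarrow> h v - h (2/3) = \<beta> * (2/3 - v)"
    and u: "0 \<le> u" "u \<le> 1"
  shows "h u = (1 - u) * h 0 + u * h 1"
proof -
  have "\<beta> = -\<alpha>"
    using assms(1)[of "2/3"] assms(2)[of "1/3"] by simp
  moreover have "h 1 = h (1/3) + \<alpha> * (2/3)" "h 0 = h (2/3) + \<beta> * (2/3)"
    using assms(1)[of 1] assms(2)[of 0] by auto
  moreover have "h (2/3) - h (1/3) = \<alpha> / 3"
    using assms(1)[of "2/3"] by simp
  ultimately have "h 0 = h (1/3) - \<alpha> / 3" "h 1 = h (1/3) + \<alpha> * (2/3)" by auto
  then have rhs: "(1 - u) * h 0 + u * h 1 = h (1/3) + \<alpha> * (u - 1/3)"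
    by (simp only:) (simp add: field_simps)
  show ?thesis
  proof (cases "1/3 \<le> u")
    case True
    then show ?thesis using assms(1)[of u] u rhs by simp
  next
    case False
    then show ?thesis using assms(2)[of u] u rhs \<open>\<beta> = -\<alpha>\<close> \<open>h (2/3) - h (1/3) = \<alpha> / 3\<close>
      by (simp add: algebra_simps)
  qed
qed

text \<open>If two optimal values have the same regret, their difference \<open>h\<close> equals its own one-sided linear
  approximation at every interior point of a segment, to the right and, by reversing the segment, to the
  left. Hence \<open>h\<close> is affine on \<open>[1/3, 1]\<close> and on \<open>[0, 2/3]\<close>, and therefore on \<open>[0, 1]\<close>.\<close>

theorem regret_determines_value:
  assumes A: "action_set S A" and B: "action_set S B"
    and eq: "\<And>s t. s \<in> S \<Longrightarrow> t \<in> S \<Longrightarrow> regret A s t = regret B s t"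
  shows "affine_on S (\<lambda>s. opt A s - opt B s)"
  unfolding affine_on_def
proof (intro ballI)
  interpret A: action_set S A by fact
  interpret B: action_set S B by fact
  have piece: "\<exists>\<alpha>. \<forall>v. u \<le> v \<longrightarrow> v \<le> 1 \<longrightarrow>
      (opt A ((1 - v) *\<^sub>R s + v *\<^sub>R t) - opt B ((1 - v) *\<^sub>R s + v *\<^sub>R t)) -
      (opt A ((1 - u) *\<^sub>R s + u *\<^sub>R t) - opt B ((1 - u) *\<^sub>R s + u *\<^sub>R t)) = \<alpha> * (v - u)"
    if st: "s \<in> S" "t \<in> S" and u: "0 < u" "u < 1" for s t u
  proof -
    obtain ra where ra: "\<And>v. u \<le> v \<Longrightarrow> v \<le> 1 \<Longrightarrow>
      regret A ((1 - v) *\<^sub>R s + v *\<^sub>R t) ((1 - u) *\<^sub>R s + u *\<^sub>R t) =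
      ereal (opt A ((1 - v) *\<^sub>R s + v *\<^sub>R t) - opt A ((1 - u) *\<^sub>R s + u *\<^sub>R t) - ra * (v - u))"
      using A.regret_segment[OF st u] by blast
    obtain rb where rb: "\<And>v. u \<le> v \<Longrightarrow> v \<le> 1 \<Longrightarrow>
      regret B ((1 - v) *\<^sub>R s + v *\<^sub>R t) ((1 - u) *\<^sub>R s + u *\<^sub>R t) =
      ereal (opt B ((1 - v) *\<^sub>R s + v *\<^sub>R t) - opt B ((1 - u) *\<^sub>R s + u *\<^sub>R t) - rb * (v - u))"
      using B.regret_segment[OF st u] by blast
    show ?thesis
    proof (intro exI allI impI)
      fix v assume v: "u \<le> v" "v \<le> 1"
      have "(1 - v) *\<^sub>R s + v *\<^sub>R t \<in> S" "(1 - u) *\<^sub>R s + u *\<^sub>R t \<in> S"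
        using st u v by (auto intro!: A.segment_mem)
      from eq[OF this] show "(opt A ((1 - v) *\<^sub>R s + v *\<^sub>R t) - opt B ((1 - v) *\<^sub>R s + v *\<^sub>R t)) -
          (opt A ((1 - u) *\<^sub>R s + u *\<^sub>R t) - opt B ((1 - u) *\<^sub>R s + u *\<^sub>R t)) = (ra - rb) * (v - u)"
        using ra[OF v] rb[OF v] by (simp add: algebra_simps)
    qed
  qed
  fix s t and u :: real assume s: "s \<in> S" and t: "t \<in> S" and u: "u \<in> {0..1}"
  define h where "h = (\<lambda>v. opt A ((1 - v) *\<^sub>R s + v *\<^sub>R t) - opt B ((1 - v) *\<^sub>R s + v *\<^sub>R t))"
  obtain \<alpha> where \<alpha>: "\<And>v. 1/3 \<le> v \<Longrightarrow> v \<le> 1 \<Longrightarrow> h v - h (1/3) = \<alpha> * (v - 1/3)"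
    using piece[OF s t, of "1/3"] unfolding h_def by auto
  have flip: "h (1 - v) = opt A ((1 - v) *\<^sub>R t + v *\<^sub>R s) - opt B ((1 - v) *\<^sub>R t + v *\<^sub>R s)" for v
    by (simp add: h_def add.commute)
  obtain \<beta> where \<beta>: "\<And>v. 1/3 \<le> v \<Longrightarrow> v \<le> 1 \<Longrightarrow> h (1 - v) - h (1 - 1/3) = \<beta> * (v - 1/3)"
    using piece[OF t s, of "1/3"] unfolding flip by auto
  have "h u = (1 - u) * h 0 + u * h 1"
  proof (rule affine_if_affine_on_overlapping_pieces[OF \<alpha>])
    show "h v - h (2/3) = \<beta> * (2/3 - v)" if "0 \<le> v" "v \<le> 2/3" for v
      using \<beta>[of "1 - v"] that by simp
  qed (use u in auto)
  then show "opt A ((1 - u) *\<^sub>R s + u *\<^sub>R t) - opt B ((1 - u) *\<^sub>R s + u *\<^sub>R t) =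
      (1 - u) * (opt A s - opt B s) + u * (opt A t - opt B t)"
    by (simp add: h_def)
qed

text \<open>Affine summands do not contribute to the regret. An infinite slope \<open>-\<infinity>\<close> is harmless for \<open>c = 0\<close>
  because \<open>0 * \<infinity> = 0\<close>.\<close>

lemma (in action_set) regret_of_decomposition:
  assumes dec: "\<And>s. s \<in> S \<Longrightarrow> F s = c * E s + l s" and l: "affine_on S l" and c: "0 \<le> c"
    and s: "s \<in> S" and t: "t \<in> S"
    and \<tau>: "\<And>n. 0 < \<tau> n" "\<And>n. \<tau> n \<le> 1" "\<tau> \<longlonglongrightarrow> 0"
    and L: "(\<lambda>n. ereal (slope E s t (\<tau> n))) \<longlonglongrightarrow> L" "L \<noteq> \<infinity>"
  shows "regret A s t = ereal c * (ereal (E s - E t) - L)"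
proof -
  have slope: "slope F s t u = c * slope E s t u + (l s - l t)" if "0 < u" "u \<le> 1" for u
  proof -
    have "(1 - u) *\<^sub>R t + u *\<^sub>R s \<in> S"
      using s t that by (intro segment_mem) auto
    moreover have "l ((1 - u) *\<^sub>R t + u *\<^sub>R s) = (1 - u) * l t + u * l s"
      using l s t that by (simp add: affine_on_def)
    ultimately show ?thesis
      using that by (simp add: slope_def dec t field_simps)
  qed
  have "(\<lambda>n. ereal c * ereal (slope E s t (\<tau> n)) + ereal (l s - l t)) \<longlonglongrightarrow> ereal c * L + ereal (l s - l t)"
    by (intro tendsto_add_ereal_general tendsto_cmult_ereal L tendsto_const) auto
  moreover have "ereal c * ereal (slope E s t (\<tau> n)) + ereal (l s - l t) = ereal (slope F s t (\<tau> n))" for n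
    using slope \<tau>(1,2)[of n] by simp
  ultimately have "(\<lambda>n. ereal (slope F s t (\<tau> n))) \<longlonglongrightarrow> ereal c * L + ereal (l s - l t)"
    by simp
  then have "regret A s t = ereal (F s) - (ereal (F t) + (ereal c * L + ereal (l s - l t)))"
    by (rule regret_eq[OF s t \<tau>])
  also have "\<dots> = ereal c * (ereal (E s - E t) - L)"
  proof (cases L)
    case (real r)
    then show ?thesis by (simp add: dec s t algebra_simps)
  next
    case MInf
    show ?thesis
    proof (cases "c = 0")
      case True
      then show ?thesis by (simp add: MInf dec s t zero_ereal_def[symmetric])
    next
      case False
      with c show ?thesis by (simp add: MInf)
    qed
  qed (use L in auto)
  finally show ?thesis .
qed

section \<open>The fundamental equation of information\<close>

text \<open>A constant sign makes an additive function monotone, so its value at \<open>n s\<close> is squeezed between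
  those at two consecutive integers.\<close>

lemma additive_nonpos_linear:
  fixes g :: "real \<Rightarrow> real"
  assumes add: "\<And>s t. 0 < s \<Longrightarrow> 0 < t \<Longrightarrow> g (s + t) = g s + g t"
    and nonpos: "\<And>s. 0 < s \<Longrightarrow> g s \<le> 0"
    and s: "0 < s"
  shows "g s = s * g 1"
proof (rule ccontr)
  assume "g s \<noteq> s * g 1"
  define d where "d = \<bar>g s - s * g 1\<bar>"
  have d: "0 < d" using \<open>g s \<noteq> s * g 1\<close> by (simp add: d_def)
  have mult: "g (real (Suc n) * t) = real (Suc n) * g t" if "0 < t" for n t
  proof (induction n)
    case (Suc n)
    have "real (Suc (Suc n)) * t = real (Suc n) * t + t" by (simp add: algebra_simps)
    moreover have "0 < real (Suc n) * t" using that by simp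
    ultimately have "g (real (Suc (Suc n)) * t) = real (Suc n) * g t + g t"
      using add[of "real (Suc n) * t" t] Suc that by simp
    then show ?case by (simp add: algebra_simps)
  qed simp
  have anti: "g y \<le> g x" if "0 < x" "x \<le> y" for x y
  proof (cases "x = y")
    case False
    then show ?thesis using add[of x "y - x"] nonpos[of "y - x"] that by simp
  qed simp
  obtain n :: nat where n: "max (1 / s) ((- g 1) / d) < real n"
    using reals_Archimedean2 by blast
  then have "0 < real n" using s by (meson divide_pos_pos less_max_iff_disj less_trans max_less_iff_conj zero_less_one)
  then obtain k where k: "n = Suc k" by (cases n) auto
  have ns: "1 < real n * s" using n s by (simp add: field_simps)
  define m where "m = nat \<lfloor>real n * s\<rfloor>"
  have m: "real m \<le> real n * s" "real n * s < real m + 1" "0 < m"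
    using ns unfolding m_def by (auto simp: of_nat_floor le_floor_iff)
  obtain j where j: "m = Suc j" using m(3) by (cases m) auto
  have gm: "g (real m) = real m * g 1" "g (real m + 1) = (real m + 1) * g 1"
    using mult[of 1 j] mult[of 1 "Suc j"] by (auto simp: j algebra_simps)
  have "real n * g s \<le> real m * g 1" "(real m + 1) * g 1 \<le> real n * g s"
    using anti[of "real m" "real n * s"] anti[of "real n * s" "real m + 1"] m mult[OF s, of k] gm ns
    by (auto simp: k)
  moreover have "real n * s * g 1 \<le> real m * g 1" "(real m + 1) * g 1 \<le> real n * s * g 1"
    using m nonpos[of 1] by (auto intro!: mult_right_mono_neg)
  ultimately have "\<bar>real n * g s - real n * s * g 1\<bar> \<le> - g 1"
    by (simp add: algebra_simps abs_le_iff)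
  then have "real n * d \<le> - g 1"
    unfolding d_def using \<open>0 < real n\<close>
    by (metis abs_mult abs_of_nat mult.assoc right_diff_distrib)
  moreover have "- g 1 < real n * d"
    using n d by (simp add: field_simps)
  ultimately show False by simp
qed

lemma right_derivative_unique:
  fixes f :: "real \<Rightarrow> real"
  assumes "(f has_real_derivative a) (at_right x)" "(f has_real_derivative b) (at_right x)"
  shows "a = b"
  using assms unfolding has_field_derivative_iff
  by (intro tendsto_unique[OF trivial_limit_at_right_real]) auto

text \<open>Let \<open>H x y = (x + y) h (x / (x + y))\<close> be the homogeneous extension of \<open>h\<close>; the equation says that
  \<open>H\<close> is a cocycle. The right derivative of \<open>H\<close> in its first argument is homogeneous of degree \<open>0\<close>,
  hence a function \<open>R\<close> of the proportion, and differentiating the cocycle equation leaves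
  \<open>R (s t) = R s + R t\<close>. As \<open>R t\<close> is the value at \<open>1\<close> of the right tangent of \<open>h\<close> at \<open>t\<close>, it is
  at most \<open>h 1 = 0\<close>, and so \<open>R\<close> is a multiple of the logarithm. What remains is a linear first order
  differential equation for \<open>h\<close>, whose homogeneous solutions \<open>C (1 - t)\<close> are excluded by symmetry.\<close>

theorem fundamental_equation_of_information:
  fixes h :: "real \<Rightarrow> real"
  assumes convex: "convex_on {0..1} h" and h1: "h 1 = 0"
    and sym: "\<And>t. 0 < t \<Longrightarrow> t < 1 \<Longrightarrow> h (1 - t) = h t"
    and fei: "\<And>x y. 0 < x \<Longrightarrow> 0 < y \<Longrightarrow> x + y < 1 \<Longrightarrow>
      h (x + y) + (x + y) * h (x / (x + y)) = h x + (1 - x) * h (y / (1 - x))"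
  obtains \<kappa> where "0 \<le> \<kappa>" "\<And>t. 0 < t \<Longrightarrow> t < 1 \<Longrightarrow> h t = \<kappa> * (t * ln t + (1 - t) * ln (1 - t))"
proof -
  have "\<exists>r. (h has_real_derivative r) (at_right t) \<and> (\<forall>y\<in>{0..1}. h t + r * (y - t) \<le> h y)"
    if "0 < t" "t < 1" for t
    using convex_right_derivative[OF convex that] by metis
  then obtain r where r: "\<And>t. 0 < t \<Longrightarrow> t < 1 \<Longrightarrow> (h has_real_derivative r t) (at_right t)"
    and tangent: "\<And>t y. 0 < t \<Longrightarrow> t < 1 \<Longrightarrow> 0 \<le> y \<Longrightarrow> y \<le> 1 \<Longrightarrow> h t + r t * (y - t) \<le> h y"
    by (metis atLeastAtMost_iff)
  define R where "R = (\<lambda>t. h t + (1 - t) * r t)"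
  define H where "H = (\<lambda>x y. (x + y) * h (x / (x + y)))"
  have cocycle: "H x y + H (x + y) z = H x (y + z) + H y z" if "0 < x" "0 < y" "0 < z" for x y z
  proof -
    define S where "S = x + y + z"
    have "0 < S" using that by (simp add: S_def)
    moreover have "x + y < S" "S - x = y + z" using that by (auto simp: S_def)
    ultimately have S: "0 < S" "x / S + y / S < 1" "x / S + y / S = (x + y) / S" "1 - x / S = (y + z) / S"
      by (auto simp: add_divide_distrib[symmetric] field_simps)
    have "h ((x + y) / S) + (x + y) / S * h ((x / S) / ((x + y) / S)) =
      h (x / S) + (y + z) / S * h ((y / S) / ((y + z) / S))"
      using fei[of "x / S" "y / S"] S that by simp
    then have "h ((x + y) / S) + (x + y) / S * h (x / (x + y)) = h (x / S) + (y + z) / S * h (y / (y + z))"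
      using S(1) by simp
    then have "S * (h ((x + y) / S) + (x + y) / S * h (x / (x + y))) = S * (h (x / S) + (y + z) / S * h (y / (y + z)))"
      by simp
    then have "S * h ((x + y) / S) + (x + y) * h (x / (x + y)) = S * h (x / S) + (y + z) * h (y / (y + z))"
      using S(1) by (simp add: distrib_left)
    then show ?thesis
      by (simp add: H_def S_def add.assoc)
  qed
  have H_deriv: "((\<lambda>x. H x c) has_real_derivative R (x / (x + c))) (at_right x)" if "0 < x" "0 < c" for x c
  proof -
    let ?\<phi> = "\<lambda>x. x / (x + c)"
    have \<phi>: "0 < ?\<phi> x" "?\<phi> x < 1" using that by auto
    have "?\<phi> ` {x<..} \<subseteq> {?\<phi> x<..}"
      using that by (auto simp: divide_simps) (simp add: algebra_simps)
    then have "(h has_real_derivative r (?\<phi> x)) (at (?\<phi> x) within ?\<phi> ` {x<..})"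
      using r[OF \<phi>] has_field_derivative_subset by blast
    moreover have "(?\<phi> has_real_derivative c / (x + c)\<^sup>2) (at_right x)"
      using that by (auto intro!: derivative_eq_intros simp: power2_eq_square)
    ultimately have h\<phi>: "(h \<circ> ?\<phi> has_real_derivative r (?\<phi> x) * (c / (x + c)\<^sup>2)) (at_right x)"
      by (rule DERIV_image_chain)
    have "((\<lambda>x. (x + c) * (h \<circ> ?\<phi>) x) has_real_derivative
       1 * (h \<circ> ?\<phi>) x + r (?\<phi> x) * (c / (x + c)\<^sup>2) * (x + c)) (at_right x)"
      by (intro DERIV_mult h\<phi>) (auto intro!: derivative_eq_intros)
    moreover have "1 * (h \<circ> ?\<phi>) x + r (?\<phi> x) * (c / (x + c)\<^sup>2) * (x + c) = R (?\<phi> x)"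
    proof -
      have "c / (x + c)\<^sup>2 * (x + c) = 1 - x / (x + c)"
      proof -
        have nz: "x + c \<noteq> 0" using that by simp
        then have "c / (x + c)\<^sup>2 * (x + c) = c / (x + c)" by (simp add: power2_eq_square)
        also have "\<dots> = 1 - x / (x + c)" using nz by (simp add: diff_divide_eq_iff)
        finally show ?thesis .
      qed
      then have "r (?\<phi> x) * (c / (x + c)\<^sup>2) * (x + c) = r (?\<phi> x) * (1 - ?\<phi> x)"
        by (simp only: mult.assoc)
      then show ?thesis by (simp add: R_def mult.commute)
    qed
    ultimately show ?thesis by (simp add: H_def o_def)
  qed
  have R_mult: "R (s * t) = R s + R t" if "0 < s" "s < 1" "0 < t" "t < 1" for s t
  proof -
    define x y z where "x = s * t" and "y = t - s * t" and "z = 1 - t"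
    have pos: "0 < x" "0 < y" "0 < z" using that by (auto simp: x_def y_def z_def)
    have "((\<lambda>x. H (x + y) z) has_real_derivative R ((x + y) / (x + y + z))) (at_right x)"
    proof -
      have "((\<lambda>x. H x z) has_real_derivative R ((x + y) / (x + y + z))) (at (x + y) within (\<lambda>x. x + y) ` {x<..})"
        by (rule has_field_derivative_subset[OF H_deriv]) (use pos in auto)
      moreover have "((\<lambda>x. x + y) has_real_derivative 1) (at_right x)"
        by (auto intro!: derivative_eq_intros)
      ultimately show ?thesis
        using DERIV_image_chain[of "\<lambda>x. H x z" _ "\<lambda>x. x + y"] by (fastforce simp: o_def)
    qed
    with H_deriv[OF pos(1,2)]
    have "((\<lambda>x. H x y + H (x + y) z) has_real_derivative R (x / (x + y)) + R ((x + y) / (x + y + z))) (at_right x)"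
      by (rule DERIV_add)
    moreover have "((\<lambda>x. H x (y + z) + H y z) has_real_derivative R (x / (x + (y + z))) + 0) (at_right x)"
      by (intro DERIV_add H_deriv) (use pos in auto)
    then have "((\<lambda>x. H x y + H (x + y) z) has_real_derivative R (x / (x + (y + z))) + 0) (at_right x)"
    proof (rule has_field_derivative_cong_eventually[THEN iffD1, rotated 2])
      show "eventually (\<lambda>x. H x (y + z) + H y z = H x y + H (x + y) z) (at_right x)"
        using pos cocycle by (intro eventually_at_rightI[of x "x + 1"]) auto
    qed (use pos cocycle in simp)
    ultimately have "R (x / (x + y)) + R ((x + y) / (x + y + z)) = R (x / (x + (y + z))) + 0"
      by (rule right_derivative_unique)
    then show ?thesis using that by (simp add: x_def y_def z_def)
  qed
  have R_nonpos: "R t \<le> 0" if "0 < t" "t < 1" for t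
    using tangent[of t 1] that h1 by (simp add: R_def mult.commute)
  define \<kappa> where "\<kappa> = - R (exp (-1))"
  have "0 \<le> \<kappa>" using R_nonpos[of "exp (-1)"] by (simp add: \<kappa>_def)
  have R_ln: "R t = \<kappa> * ln t" if "0 < t" "t < 1" for t
  proof -
    have "(\<lambda>s. R (exp (- s))) (- ln t) = (- ln t) * (\<lambda>s. R (exp (- s))) 1"
    proof (rule additive_nonpos_linear)
      show "R (exp (- (s + t))) = R (exp (- s)) + R (exp (- t))" if "0 < s" "0 < t" for s t
        using R_mult[of "exp (- s)" "exp (- t)"] that by (simp add: exp_add[symmetric])
      show "R (exp (- s)) \<le> 0" if "0 < s" for s
        using that by (intro R_nonpos) auto
    qed (use that in auto)
    then show ?thesis using that by (simp add: \<kappa>_def)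
  qed
  have r_eq: "r t = (\<kappa> * ln t - h t) / (1 - t)" if "0 < t" "t < 1" for t
    using R_ln[OF that] that by (simp add: R_def field_simps)
  have h_cont: "continuous_on {0<..<1} h"
    by (intro convex_on_continuous convex_on_subset[OF convex]) auto
  have "continuous_on {0<..<1} r"
  proof -
    have "continuous_on {0<..<1} (\<lambda>t. (\<kappa> * ln t - h t) / (1 - t))"
      by (intro continuous_intros h_cont) auto
    then show ?thesis
      by (rule continuous_on_cong[THEN iffD1, rotated 2]) (auto simp: r_eq)
  qed
  \<comment> \<open>Tangents with slopes \<open>r t\<close> and \<open>r y\<close> enclose the difference quotient, so continuity of \<open>r\<close>
    upgrades the right derivative to a derivative.\<close>
  have h_deriv: "(h has_real_derivative r t) (at t)" if t: "0 < t" "t < 1" for t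
    unfolding has_field_derivative_iff
  proof (rule LIM_zero_cancel, rule Lim_null_comparison)
    have "isCont r t"
      using \<open>continuous_on {0<..<1} r\<close> t by (simp add: continuous_on_eq_continuous_at)
    then have "(\<lambda>y. r y - r t) \<midarrow>t\<rightarrow> r t - r t"
      by (intro tendsto_diff tendsto_const) (simp add: isCont_def)
    then show "(\<lambda>y. \<bar>r y - r t\<bar>) \<midarrow>t\<rightarrow> 0"
      by (simp add: tendsto_rabs_zero_iff)
    have "eventually (\<lambda>y. y \<in> {0<..<1}) (at t)"
      using t by (intro eventually_at_in_open') auto
    moreover have "eventually (\<lambda>y. y \<noteq> t) (at t)"
      by (simp add: eventually_at_filter)
    ultimately show "eventually (\<lambda>y. norm ((h y - h t) / (y - t) - r t) \<le> \<bar>r y - r t\<bar>) (at t)"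
    proof eventually_elim
      case (elim y)
      have *: "h t + r t * (y - t) \<le> h y" "h y + r y * (t - y) \<le> h t"
        using tangent[of t y] tangent[of y t] elim t by auto
      show ?case
      proof (cases "t < y")
        case True
        then have "r t \<le> (h y - h t) / (y - t)" "(h y - h t) / (y - t) \<le> r y"
          using * by (auto simp: field_simps)
        then show ?thesis by simp
      next
        case False
        then have "(h y - h t) / (y - t) \<le> r t" "r y \<le> (h y - h t) / (y - t)"
          using * elim by (auto simp: field_simps)
        then show ?thesis by simp
      qed
    qed
  qed
  \<comment> \<open>Dividing by the homogeneous solution \<open>1 - t\<close> turns \<open>h + (1 - t) h' = \<kappa> ln\<close> into
    \<open>(h / (1 - t))' = \<kappa> ln t / (1 - t)\<^sup>2\<close>; \<open>q\<close> subtracts an antiderivative of the right-hand side.\<close>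
  define q where "q = (\<lambda>t. h t / (1 - t) - \<kappa> * (t * ln t / (1 - t) + ln (1 - t)))"
  have "\<exists>C. \<forall>t\<in>{0<..<1}. q t = C"
  proof (rule has_field_derivative_zero_constant)
    fix t :: real assume t: "t \<in> {0<..<1}"
    then have nz: "1 - t \<noteq> 0" by auto
    have "(q has_real_derivative
        (r t * (1 - t) - h t * (-1)) / ((1 - t) * (1 - t)) -
        \<kappa> * (((1 * ln t + (1 / t) * t) * (1 - t) - (t * ln t) * (-1)) / ((1 - t) * (1 - t)) + (1 / (1 - t)) * (-1))) (at t)"
      unfolding q_def using t
      by (intro DERIV_diff DERIV_divide DERIV_cmult DERIV_add DERIV_mult h_deriv DERIV_ln_divide
          DERIV_chain2[of ln]) (auto intro!: derivative_eq_intros)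
    moreover have "(r t * (1 - t) - h t * (-1)) / ((1 - t) * (1 - t)) -
        \<kappa> * (((1 * ln t + (1 / t) * t) * (1 - t) - (t * ln t) * (-1)) / ((1 - t) * (1 - t)) + (1 / (1 - t)) * (-1)) = 0"
    proof -
      have "r t * (1 - t) - h t * (-1) = \<kappa> * ln t" using t by (simp add: r_eq)
      moreover have "(1 * ln t + (1 / t) * t) * (1 - t) - (t * ln t) * (-1) = ln t + (1 - t)"
        using t by (simp add: algebra_simps)
      moreover have "(ln t + (1 - t)) / ((1 - t) * (1 - t)) + (1 / (1 - t)) * (-1) = ln t / ((1 - t) * (1 - t))"
        using nz by (simp add: add_divide_distrib)
      ultimately show ?thesis by simp
    qed
    ultimately show "(q has_real_derivative 0) (at t within {0<..<1})"
      using has_field_derivative_at_within by fastforce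
  qed auto
  then obtain C where C: "\<And>t. 0 < t \<Longrightarrow> t < 1 \<Longrightarrow> q t = C" by auto
  have h_eq: "h t = \<kappa> * (t * ln t + (1 - t) * ln (1 - t)) + C * (1 - t)" if "0 < t" "t < 1" for t
  proof -
    have "(1 - t) * (h t / (1 - t)) = h t" "(1 - t) * (t * ln t / (1 - t)) = t * ln t"
      using that by auto
    moreover have "h t / (1 - t) = C + \<kappa> * (t * ln t / (1 - t) + ln (1 - t))"
      using C[OF that] by (simp add: q_def)
    ultimately have "h t = C * (1 - t) + \<kappa> * ((1 - t) * (t * ln t / (1 - t)) + (1 - t) * ln (1 - t))"
      by (simp only: distrib_left mult.commute mult.left_commute)
    then show ?thesis
      using \<open>(1 - t) * (t * ln t / (1 - t)) = t * ln t\<close> by (simp only: add.commute)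
  qed
  have "C = 0"
    using h_eq[of "1/3"] h_eq[of "2/3"] sym[of "1/3"] by (simp add: algebra_simps)
  then show thesis
    using that[OF \<open>0 \<le> \<kappa>\<close>] h_eq by simp
qed

section \<open>Classical state spaces\<close>

definition xlnx :: "real \<Rightarrow> real" where
  "xlnx x = x * ln x"

lemma xlnx_0 [simp]: "xlnx 0 = 0" and xlnx_1 [simp]: "xlnx 1 = 0"
  by (simp_all add: xlnx_def)

lemma shannon_entropy_eq: "shannon_entropy p = - (\<Sum>i\<in>UNIV. xlnx (p $ i))"
  by (simp add: shannon_entropy_def xlnx_def)

lemma prob_vectorsD:
  assumes "p \<in> prob_vectors"
  shows "0 \<le> p $ i" "(\<Sum>i\<in>UNIV. p $ i) = 1"
  using assms by (auto simp: prob_vectors_def)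

lemma convex_prob_vectors: "convex (prob_vectors :: (real^'n) set)"
  by (rule convexI) (auto simp: prob_vectors_def sum.distrib sum_distrib_left[symmetric])

lemma vertex_prob [simp]: "axis k 1 \<in> prob_vectors"
  by (simp add: prob_vectors_def axis_def)

lemma stochastic_map_prob:
  assumes "stochastic_map \<Phi>" "p \<in> prob_vectors"
  shows "\<Phi> p \<in> prob_vectors"
proof -
  obtain M where M: "\<And>i j. 0 \<le> M $ i $ j" "\<And>j. (\<Sum>i\<in>UNIV. M $ i $ j) = 1" "\<Phi> = (\<lambda>p. M *v p)"
    using assms(1) by (auto simp: stochastic_map_def)
  have "(\<Sum>i\<in>UNIV. (M *v p) $ i) = (\<Sum>j\<in>UNIV. (\<Sum>i\<in>UNIV. M $ i $ j) * p $ j)"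
    unfolding matrix_vector_mult_def sum_distrib_right by (simp, rule sum.swap)
  then show ?thesis
    using assms(2) M by (auto simp: prob_vectors_def matrix_vector_mult_def intro!: sum_nonneg)
qed

lemma affine_on_prob_vectors_eq:
  fixes p :: "real^'n"
  assumes l: "affine_on prob_vectors l" and p: "p \<in> prob_vectors"
  shows "l p = (\<Sum>k\<in>UNIV. p $ k * l (axis k 1))"
proof -
  have p_eq: "p = (\<Sum>k\<in>UNIV. p $ k *\<^sub>R axis k 1)"
    by (simp add: vec_eq_iff axis_def if_distrib[of "(*) _"] cong: if_cong)
  have convex: "convex_on prob_vectors l" "convex_on prob_vectors (\<lambda>x. - l x)"
    using l by (auto intro!: convex_onI convex_prob_vectors simp: affine_on_def)
  have "l (\<Sum>k\<in>UNIV. p $ k *\<^sub>R axis k 1) \<le> (\<Sum>k\<in>UNIV. p $ k * l (axis k 1))"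
    by (rule convex_on_sum[OF _ _ convex(1)]) (use prob_vectorsD[OF p] in auto)
  moreover have "- l (\<Sum>k\<in>UNIV. p $ k *\<^sub>R axis k 1) \<le> (\<Sum>k\<in>UNIV. p $ k * - l (axis k 1))"
    by (rule convex_on_sum[OF _ _ convex(2)]) (use prob_vectorsD[OF p] in auto)
  ultimately show ?thesis
    unfolding p_eq[symmetric] by (simp add: sum_negf)
qed

text \<open>Merging the letters \<open>i\<close> and \<open>j\<close> loses no information about vectors in which their masses have the
  same proportion; splitting again in the proportion \<open>w : 1 - w\<close> stays within one state space.\<close>

definition split_map :: "'n \<Rightarrow> 'n \<Rightarrow> real \<Rightarrow> real^'n \<Rightarrow> real^'n" where
  "split_map i j w p =
    (\<chi> k. if k = i then w * (p $ i + p $ j) else if k = j then (1 - w) * (p $ i + p $ j) else p $ k)"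

lemma stochastic_split_map:
  assumes ij: "i \<noteq> j" and w: "0 \<le> w" "w \<le> 1"
  shows "stochastic_map (split_map i j w :: real^'n \<Rightarrow> real^'n)"
proof -
  define c where "c = (\<lambda>k. if k = i then w else if k = j then 1 - w else 0)"
  define M :: "real^'n^'n" where
    "M = (\<chi> k l. if l = i \<or> l = j then c k else if k = l then 1 else 0)"
  have "(\<Sum>k\<in>UNIV. M $ k $ l) = 1" for l
  proof (cases "l = i \<or> l = j")
    case True
    then have "(\<Sum>k\<in>UNIV. M $ k $ l) = (\<Sum>k\<in>UNIV. (if k = i then w else 0) + (if k = j then 1 - w else 0))"
      using ij by (intro sum.cong) (auto simp: M_def c_def)
    then show ?thesis by (simp add: sum.distrib)
  qed (simp add: M_def)
  moreover have "(M *v p) $ k = split_map i j w p $ k" for p k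
  proof -
    have "(M *v p) $ k = (\<Sum>l\<in>UNIV. (if l = i then c k * p $ i else 0) + (if l = j then c k * p $ j else 0)
        + (if l = k then (if k = i \<or> k = j then 0 else p $ k) else 0))"
      unfolding matrix_vector_mult_def using ij by (auto simp: M_def intro!: sum.cong)
    then show ?thesis
      using ij by (simp add: sum.distrib split_map_def c_def distrib_left)
  qed
  then have "split_map i j w = (*v) M"
    by (simp add: fun_eq_iff vec_eq_iff)
  moreover have "0 \<le> M $ k $ l" for k l
    using w by (simp add: M_def c_def)
  ultimately show ?thesis
    unfolding stochastic_map_def by (intro exI[of _ M]) simp
qed

lemma split_map_split_map: "i \<noteq> j \<Longrightarrow> split_map i j w (split_map i j \<mu> p) = split_map i j w p"
  by (auto simp: split_map_def vec_eq_iff algebra_simps)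

lemma split_map_affine:
  "split_map i j w ((1 - u) *\<^sub>R s + u *\<^sub>R t) = (1 - u) *\<^sub>R split_map i j w s + u *\<^sub>R split_map i j w t"
  by (simp add: split_map_def vec_eq_iff algebra_simps)

lemma split_map_prob:
  "i \<noteq> j \<Longrightarrow> 0 \<le> w \<Longrightarrow> w \<le> 1 \<Longrightarrow> p \<in> prob_vectors \<Longrightarrow> split_map i j w p \<in> prob_vectors"
  by (rule stochastic_map_prob[OF stochastic_split_map])

definition edge :: "'n \<Rightarrow> 'n \<Rightarrow> real \<Rightarrow> real^'n" where
  "edge i j w = (1 - w) *\<^sub>R axis j 1 + w *\<^sub>R axis i 1"

lemma edge_prob: "0 \<le> w \<Longrightarrow> w \<le> 1 \<Longrightarrow> edge i j w \<in> prob_vectors"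
  unfolding edge_def using convex_prob_vectors by (intro convexD) auto

lemma edge_swap: "edge i j (1 - w) = edge j i w"
  by (simp add: edge_def add.commute)

lemma split_map_axis:
  assumes "i \<noteq> j"
  shows "split_map i j w (axis k 1) = (if k = i \<or> k = j then edge i j w else axis k 1)"
  using assms by (auto simp: split_map_def vec_eq_iff axis_def edge_def)

text \<open>The maps with parameters \<open>w\<close> and \<open>0\<close> undo each other on their ranges, so precomposing the actions
  with either of them gives the same regret. The optimal values then differ by an affine function,
  which vanishes at all vertices except those of \<open>i\<close> and \<open>j\<close>, where its values agree.\<close>

lemma value_split_map:
  assumes A: "action_set (prob_vectors :: (real^'n) set) A"
    and suff: "sufficiency_property prob_vectors stochastic_map A"
    and ij: "i \<noteq> j" and w: "0 \<le> w" "w \<le> 1" and p: "p \<in> prob_vectors"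
  shows "opt A (split_map i j w p) = opt A (split_map i j 0 p) +
    (p $ i + p $ j) * (opt A (edge i j w) - opt A (axis j 1))"
proof -
  define l where "l p = opt A (split_map i j w p) - opt A (split_map i j 0 p)" for p
  define B where "B \<mu> = (\<lambda>a s. a (split_map i j \<mu> s)) ` A" for \<mu>
  have B: "action_set prob_vectors (B \<mu>)" if "0 \<le> \<mu>" "\<mu> \<le> 1" for \<mu>
    unfolding B_def using A convex_prob_vectors
    by (rule action_set_pullback) (use ij that in \<open>auto intro!: split_map_prob simp: split_map_affine\<close>)
  have "regret (B w) s t = regret (B 0) s t" if st: "s \<in> prob_vectors" "t \<in> prob_vectors" for s t
  proof -
    let ?s = "split_map i j 0 s" and ?t = "split_map i j 0 t"
    have "sufficient_for stochastic_map (split_map i j w) {?s, ?t}"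
      unfolding sufficient_for_def using stochastic_split_map[OF ij, of 0]
      by (intro exI[of _ "split_map i j 0"]) (auto simp: split_map_split_map ij)
    then have "regret A (split_map i j w ?s) (split_map i j w ?t) = regret A ?s ?t"
      using suff stochastic_split_map[OF ij w] split_map_prob[OF ij, of 0] st
      unfolding sufficiency_property_def by simp
    then show ?thesis
      by (simp add: B_def regret_pullback split_map_split_map ij)
  qed
  then have "affine_on prob_vectors (\<lambda>s. opt (B w) s - opt (B 0) s)"
    using w by (intro regret_determines_value B) auto
  then have "affine_on prob_vectors l"
    by (simp add: B_def opt_pullback l_def[abs_def])
  then have "l p = (\<Sum>k\<in>UNIV. p $ k * l (axis k 1))"
    using p by (rule affine_on_prob_vectors_eq)
  also have "\<dots> = (\<Sum>k\<in>UNIV. (if k = i then p $ i * l (axis i 1) else 0) + (if k = j then p $ j * l (axis j 1) else 0))"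
    using ij by (intro sum.cong) (auto simp: l_def split_map_axis)
  also have "\<dots> = (p $ i + p $ j) * (opt A (edge i j w) - opt A (axis j 1))"
    using ij by (simp add: sum.distrib l_def split_map_axis edge_def algebra_simps)
  finally show ?thesis by (simp add: l_def)
qed

lemma sum_UNIV_remove_two:
  fixes f :: "'n::finite \<Rightarrow> 'a::comm_monoid_add"
  assumes "i \<noteq> j"
  shows "(\<Sum>k\<in>UNIV. f k) = f i + (f j + (\<Sum>k\<in>UNIV - {i} - {j}. f k))"
  using assms by (simp add: sum.remove[of UNIV i] sum.remove[of "UNIV - {i}" j])

text \<open>The hypotheses are the grouping identity for a function normalized to vanish at the vertices. The case
  \<open>w = 1\<close> says that mass may be moved from \<open>i\<close> to an empty letter \<open>j\<close> without changing \<open>G\<close>; with a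
  third letter this makes all edges of the simplex equivalent and their common function \<open>h\<close> symmetric.\<close>

theorem entropy_from_grouping:
  fixes G :: "real^'n \<Rightarrow> real"
  assumes card: "3 \<le> CARD('n)"
    and split: "\<And>i j w p. i \<noteq> j \<Longrightarrow> 0 \<le> w \<Longrightarrow> w \<le> 1 \<Longrightarrow> p \<in> prob_vectors \<Longrightarrow>
      G (split_map i j w p) = G (split_map i j 0 p) + (p $ i + p $ j) * G (edge i j w)"
    and vertex: "\<And>k. G (axis k 1) = 0"
    and convex: "\<And>i j. convex_on {0..1} (\<lambda>w. G (edge i j w))"
  obtains \<kappa> where "0 \<le> \<kappa>" "\<And>p. p \<in> prob_vectors \<Longrightarrow> G p = \<kappa> * (\<Sum>k\<in>UNIV. xlnx (p $ k))"
proof -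
  define h where "h i j w = G (edge i j w)" for i j w
  have third: "\<exists>k. k \<noteq> i \<and> k \<noteq> j" for i j :: 'n
  proof (rule ccontr)
    assume "\<not> ?thesis"
    then have "(UNIV :: 'n set) \<subseteq> {i, j}" by auto
    then have "CARD('n) \<le> card {i, j}" by (intro card_mono) auto
    also have "\<dots> \<le> 2" by (simp add: card_insert_if)
    finally show False using card by simp
  qed
  have h_flip: "h i j (1 - a) = h j i a" for i j a
    by (simp add: h_def edge_swap)
  have left: "h i k a = h j k a" if "i \<noteq> j" "k \<noteq> i" "k \<noteq> j" "0 \<le> a" "a \<le> 1" for i j k a
  proof -
    have "split_map i j 1 (edge i k a) = edge i k a" "split_map i j 0 (edge i k a) = edge j k a"
      using that by (auto simp: split_map_def vec_eq_iff axis_def edge_def)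
    moreover have "edge i j 1 = axis i 1" by (simp add: edge_def)
    ultimately show ?thesis
      using split[of i j 1 "edge i k a"] that by (simp add: h_def edge_prob vertex)
  qed
  have right: "h k i a = h k j a" if "i \<noteq> j" "k \<noteq> i" "k \<noteq> j" "0 \<le> a" "a \<le> 1" for i j k a
    using left[of i j k "1 - a"] that by (simp add: h_flip)
  have swap: "h i j a = h j i a" if "i \<noteq> j" "0 \<le> a" "a \<le> 1" for i j a
  proof -
    obtain k where "k \<noteq> i" "k \<noteq> j" using third by blast
    then show ?thesis
      using left[of i k j a] right[of j i k a] left[of k j i a] that by auto
  qed
  have all: "h i j a = h i' j' a" if "i \<noteq> j" "i' \<noteq> j'" "0 \<le> a" "a \<le> 1" for i j i' j' a
  proof (cases "i' = j")
    case True
    then show ?thesis using swap[of i j a] right[of i j' j a] that by (cases "i = j'") auto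
  next
    case False
    then show ?thesis
      using left[of i i' j a] right[of j j' i' a] that by (cases "i = i'"; cases "j = j'") auto
  qed
  obtain i j k :: 'n where ijk: "i \<noteq> j" "k \<noteq> i" "k \<noteq> j"
  proof -
    obtain j :: 'n where "j \<noteq> undefined" using third by blast
    then show thesis using that[of undefined j] third[of undefined j] by auto
  qed
  have h01: "h a b 0 = 0" "h a b 1 = 0" for a b
    by (simp_all add: h_def edge_def vertex)
  obtain \<kappa> where "0 \<le> \<kappa>" and \<kappa>: "\<And>t. 0 < t \<Longrightarrow> t < 1 \<Longrightarrow> h i j t = \<kappa> * (t * ln t + (1 - t) * ln (1 - t))"
  proof (rule fundamental_equation_of_information[of "h i j"])
    show "convex_on {0..1} (h i j)" unfolding h_def by (rule convex)
    show "h i j 1 = 0" by (rule h01)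
    show "h i j (1 - t) = h i j t" if "0 < t" "t < 1" for t
      using swap[of j i t] ijk that by (simp add: h_flip)
    \<comment> \<open>The vector \<open>p\<close> with masses \<open>x\<close>, \<open>y\<close>, \<open>z\<close> on three letters is evaluated by merging
      first \<open>i\<close> with \<open>j\<close>, or first \<open>j\<close> with \<open>k\<close>.\<close>
    show "h i j (x + y) + (x + y) * h i j (x / (x + y)) = h i j x + (1 - x) * h i j (y / (1 - x))"
      if xy: "0 < x" "0 < y" "x + y < 1" for x y
    proof -
      define z where "z = 1 - x - y"
      have z: "0 < z" "1 - x = y + z" using xy by (auto simp: z_def)
      define p where "p = x *\<^sub>R axis i 1 + y *\<^sub>R axis j 1 + z *\<^sub>R axis k (1::real)"
      have p_nth: "p $ l = (if l = i then x else if l = j then y else if l = k then z else 0)" for l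
        using ijk by (auto simp: p_def axis_def)
      have p: "p \<in> prob_vectors"
      proof -
        have "(\<Sum>l\<in>UNIV. p $ l) = (\<Sum>l\<in>UNIV. (if l = i then x else 0) + (if l = j then y else 0) + (if l = k then z else 0))"
          using ijk by (intro sum.cong) (auto simp: p_nth)
        then show ?thesis
          using xy z(1) by (auto simp: prob_vectors_def p_nth sum.distrib z_def)
      qed
      have "split_map i j (x / (x + y)) p = p"
      proof -
        have "1 - x / (x + y) = y / (x + y)" using xy by (simp add: field_simps)
        then show ?thesis using xy ijk by (auto simp: split_map_def vec_eq_iff p_nth)
      qed
      moreover have "split_map i j 0 p = edge j k (x + y)"
        using ijk by (auto simp: split_map_def vec_eq_iff p_nth edge_def axis_def z_def)
      ultimately have 1: "G p = h j k (x + y) + (x + y) * h i j (x / (x + y))"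
        using split[OF ijk(1), of "x / (x + y)" p] p xy ijk by (simp add: h_def p_nth)
      have "split_map j k (y / (y + z)) p = p"
      proof -
        have "1 - y / (y + z) = z / (y + z)" using xy z by (simp add: field_simps)
        then show ?thesis using xy z ijk by (auto simp: split_map_def vec_eq_iff p_nth)
      qed
      moreover have "split_map j k 0 p = edge i k x"
        using ijk z(2) by (auto simp: split_map_def vec_eq_iff p_nth edge_def axis_def)
      ultimately have 2: "G p = h i k x + (y + z) * h j k (y / (y + z))"
        using split[of j k "y / (y + z)" p] p xy z ijk by (simp add: h_def p_nth)
      have "h j k (x + y) = h i j (x + y)" "h i k x = h i j x" "h j k (y / (y + z)) = h i j (y / (y + z))"
        using xy z ijk by (intro all; simp)+
      then show ?thesis
        using 1 2 z by simp
    qed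
  qed blast
  have h_eq: "h a b t = \<kappa> * (xlnx t + xlnx (1 - t))" if "a \<noteq> b" "0 \<le> t" "t \<le> 1" for a b t
  proof -
    have "h a b t = h i j t" using that ijk by (intro all) auto
    then show ?thesis
      using \<kappa>[of t] h01[of i j] that by (cases "t = 0 \<or> t = 1") (auto simp: xlnx_def)
  qed
  have "G p = \<kappa> * (\<Sum>k\<in>UNIV. xlnx (p $ k))" if "p \<in> prob_vectors" for p
    using that
  proof (induction "card {k. p $ k \<noteq> 0}" arbitrary: p rule: less_induct)
    case less
    note nonneg = prob_vectorsD(1)[OF less.prems] and total = prob_vectorsD(2)[OF less.prems]
    show ?case
    proof (cases "\<exists>a b. a \<noteq> b \<and> p $ a \<noteq> 0 \<and> p $ b \<noteq> 0")
      case False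
      obtain a where a: "p $ a \<noteq> 0"
        using total by (metis sum.neutral zero_neq_one)
      then have zero: "p $ b = 0" if "b \<noteq> a" for b using False that by blast
      then have "(\<Sum>k\<in>UNIV. p $ k) = (\<Sum>k\<in>UNIV. if k = a then p $ a else 0)"
        by (intro sum.cong) auto
      then have "p $ a = 1" using total by simp
      then have "p = axis a 1" using zero by (auto simp: vec_eq_iff axis_def)
      moreover have "xlnx (axis a 1 $ k) = 0" for k by (simp add: axis_def)
      ultimately show ?thesis by (simp add: vertex)
    next
      case True
      then obtain a b where ab: "a \<noteq> b" "p $ a \<noteq> 0" "p $ b \<noteq> 0" by blast
      define q where "q = split_map a b 0 p"
      define m where "m = p $ a + p $ b"
      have pos: "0 < p $ a" "0 < p $ b" "0 < m"
        using nonneg[of a] nonneg[of b] ab by (auto simp: m_def)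
      have q: "q \<in> prob_vectors" unfolding q_def using less.prems ab by (intro split_map_prob) auto
      have "{k. q $ k \<noteq> 0} \<subset> {k. p $ k \<noteq> 0}"
        using ab by (auto simp: q_def split_map_def)
      then have IH: "G q = \<kappa> * (\<Sum>k\<in>UNIV. xlnx (q $ k))"
        by (intro less.hyps q psubset_card_mono) auto
      have frac: "1 - p $ a / m = p $ b / m" using pos by (simp add: m_def field_simps)
      then have "split_map a b (p $ a / m) p = p"
        using pos by (auto simp: split_map_def vec_eq_iff m_def[symmetric])
      moreover have "0 \<le> p $ a / m" "p $ a / m \<le> 1" using pos by (auto simp: m_def)
      ultimately have "G p = G q + m * h a b (p $ a / m)"
        using split[OF ab(1), of "p $ a / m" p] less.prems by (simp add: q_def m_def h_def)
      also have "m * h a b (p $ a / m) = \<kappa> * (xlnx (p $ a) + xlnx (p $ b) - xlnx m)"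
      proof -
        have "h a b (p $ a / m) = \<kappa> * (xlnx (p $ a / m) + xlnx (p $ b / m))"
          using h_eq[OF ab(1), of "p $ a / m"] pos frac by (simp add: m_def)
        moreover have *: "m * xlnx (x / m) = x * ln x - x * ln m" if "0 < x" for x
          using that pos by (simp add: xlnx_def ln_div right_diff_distrib)
        have "m * (xlnx (p $ a / m) + xlnx (p $ b / m)) = xlnx (p $ a) + xlnx (p $ b) - xlnx m"
          unfolding distrib_left *[OF pos(1)] *[OF pos(2)]
          by (simp add: xlnx_def m_def algebra_simps)
        ultimately show ?thesis by (metis mult.left_commute)
      qed
      also have "G q + \<kappa> * (xlnx (p $ a) + xlnx (p $ b) - xlnx m) = \<kappa> * (\<Sum>k\<in>UNIV. xlnx (p $ k))"
      proof -
        have "q $ a = 0" "q $ b = m" "\<And>k. k \<noteq> a \<Longrightarrow> k \<noteq> b \<Longrightarrow> q $ k = p $ k"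
          using ab by (auto simp: q_def split_map_def m_def)
        then have "(\<Sum>k\<in>UNIV. xlnx (q $ k)) = xlnx m + (\<Sum>k\<in>UNIV - {a} - {b}. xlnx (p $ k))"
          using sum_UNIV_remove_two[OF ab(1), of "\<lambda>k. xlnx (q $ k)"] by simp
        then show ?thesis
          unfolding IH using sum_UNIV_remove_two[OF ab(1), of "\<lambda>k. xlnx (p $ k)"] by (simp add: algebra_simps)
      qed
      finally show ?thesis .
    qed
  qed
  then show thesis using that \<open>0 \<le> \<kappa>\<close> by blast
qed

lemma sum_split_map:
  assumes "i \<noteq> j"
  shows "(\<Sum>k\<in>UNIV. split_map i j w p $ k * c k) = (\<Sum>k\<in>UNIV. p $ k * c k) +
    (w * (p $ i + p $ j) - p $ i) * c i + ((1 - w) * (p $ i + p $ j) - p $ j) * c j"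
  unfolding sum_UNIV_remove_two[OF assms] using assms by (simp add: split_map_def algebra_simps)

lemma sum_edge: "(\<Sum>k\<in>UNIV. edge i j w $ k * c k) = (1 - w) * c j + w * c i"
proof -
  have "(\<Sum>k\<in>UNIV. edge i j w $ k * c k) =
      (\<Sum>k\<in>UNIV. (if k = j then (1 - w) * c j else 0) + (if k = i then w * c i else 0))"
    by (intro sum.cong) (auto simp: edge_def axis_def algebra_simps)
  then show ?thesis by (simp add: sum.distrib)
qed

theorem classical_value_form:
  fixes A :: "(real^'n \<Rightarrow> real measure) set"
  assumes card: "3 \<le> CARD('n)" and A: "action_set prob_vectors A"
    and suff: "sufficiency_property prob_vectors stochastic_map A"
  obtains \<kappa> where "0 \<le> \<kappa>"
    "\<And>p. p \<in> prob_vectors \<Longrightarrow>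
      opt A p = \<kappa> * (\<Sum>k\<in>UNIV. xlnx (p $ k)) + (\<Sum>k\<in>UNIV. p $ k * opt A (axis k 1))"
proof -
  interpret action_set prob_vectors A by fact
  define c where "c k = F (axis k 1)" for k
  define G where "G p = F p - (\<Sum>k\<in>UNIV. p $ k * c k)" for p
  have G_edge: "G (edge i j w) = F (edge i j w) + ((w - 1) * c j - w * c i)" for i j w
    unfolding G_def sum_edge by (simp add: algebra_simps)
  obtain \<kappa> where \<kappa>: "0 \<le> \<kappa>" "\<And>p. p \<in> prob_vectors \<Longrightarrow> G p = \<kappa> * (\<Sum>k\<in>UNIV. xlnx (p $ k))"
  proof (rule entropy_from_grouping[OF card, of G])
    show "G (split_map i j w p) = G (split_map i j 0 p) + (p $ i + p $ j) * G (edge i j w)"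
      if "i \<noteq> j" "0 \<le> w" "w \<le> 1" "p \<in> prob_vectors" for i j w p
      unfolding G_edge unfolding G_def sum_split_map[OF that(1)] value_split_map[OF A suff that]
      by (simp add: c_def algebra_simps)
    show "G (axis k 1) = 0" for k
    proof -
      have "axis k 1 = edge k k 0" by (simp add: edge_def)
      then show ?thesis using G_edge[of k k 0] by (simp add: c_def)
    qed
    show "convex_on {0..1} (\<lambda>w. G (edge i j w))" for i j
    proof -
      have "convex_on {0..1} (\<lambda>w. F (edge i j w))"
        unfolding edge_def by (intro convex_on_segment[OF convex_F]) auto
      moreover have "convex_on {0..1} (\<lambda>w. (w - 1) * c j - w * c i)"
        by (rule convex_onI) (auto simp: algebra_simps)
      ultimately show ?thesis
        unfolding G_edge by (rule convex_on_add)
    qed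
  qed blast
  show thesis
    using that[OF \<kappa>(1)] \<kappa>(2) by (simp add: G_def c_def algebra_simps)
qed

lemma xlnx_slope_pos:
  assumes "0 < t" and \<tau>: "\<And>n. 0 < \<tau> n" "\<tau> \<longlonglongrightarrow> 0"
  shows "(\<lambda>n. (xlnx ((1 - \<tau> n) * t + \<tau> n * s) - xlnx t) / \<tau> n) \<longlonglongrightarrow> (s - t) * (ln t + 1)"
proof -
  have "((\<lambda>u. xlnx ((1 - u) * t + u * s)) has_real_derivative (s - t) * (ln t + 1)) (at 0)"
    unfolding xlnx_def using assms(1) by (auto intro!: derivative_eq_intros simp: field_simps)
  then have "((\<lambda>u. (xlnx ((1 - u) * t + u * s) - xlnx t) / u) \<longlongrightarrow> (s - t) * (ln t + 1)) (at 0)"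
    by (simp add: has_field_derivative_iff)
  moreover have "filterlim \<tau> (at 0) sequentially"
    using \<tau> by (auto simp: filterlim_at intro!: always_eventually less_imp_neq[symmetric])
  ultimately show ?thesis by (rule filterlim_compose)
qed

lemma ln_null_at_bot:
  assumes "\<And>n. 0 < \<tau> n" "\<tau> \<longlonglongrightarrow> (0::real)"
  shows "filterlim (\<lambda>n. ln (\<tau> n)) at_bot sequentially"
  by (rule filterlim_compose[OF ln_at_0]) (use assms in \<open>auto intro!: tendsto_imp_filterlim_at_right\<close>)

text \<open>On letters with \<open>t $ k = 0\<close> the difference quotient is \<open>xlnx (s $ k) + s $ k * ln u\<close>. The logarithmic
  parts add up to \<open>c ln u\<close>, where \<open>c\<close> is the mass of \<open>s\<close> outside the support of \<open>t\<close>.\<close>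

lemma classical_entropy_slope:
  fixes s t :: "real^'n"
  assumes s: "s \<in> prob_vectors" and t: "t \<in> prob_vectors"
    and \<tau>: "\<And>n. 0 < \<tau> n" "\<tau> \<longlonglongrightarrow> 0"
  shows "(\<lambda>n. ereal (slope (\<lambda>p. \<Sum>k\<in>UNIV. xlnx (p $ k)) s t (\<tau> n))) \<longlonglongrightarrow>
    (if {i. s $ i \<noteq> 0} \<subseteq> {i. t $ i \<noteq> 0} then ereal (\<Sum>k\<in>UNIV. (s $ k - t $ k) * ln (t $ k)) else - \<infinity>)"
proof -
  note s_nonneg = prob_vectorsD(1)[OF s] and t_nonneg = prob_vectorsD(1)[OF t]
  define g where "g k n = (if t $ k = 0 then xlnx (s $ k)
    else (xlnx ((1 - \<tau> n) * t $ k + \<tau> n * s $ k) - xlnx (t $ k)) / \<tau> n)" for k n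
  define \<gamma> where "\<gamma> k = (if t $ k = 0 then xlnx (s $ k) else (s $ k - t $ k) * (ln (t $ k) + 1))" for k
  define c where "c = (\<Sum>k\<in>UNIV. if t $ k = 0 then s $ k else 0)"
  have g: "g k \<longlonglongrightarrow> \<gamma> k" for k
    using xlnx_slope_pos[of "t $ k" \<tau> "s $ k", OF _ \<tau>] t_nonneg[of k]
    by (auto simp: g_def[abs_def] \<gamma>_def order_le_less)
  have slope: "slope (\<lambda>p. \<Sum>k\<in>UNIV. xlnx (p $ k)) s t (\<tau> n) = (\<Sum>k\<in>UNIV. g k n) + c * ln (\<tau> n)" for n
  proof -
    have "(xlnx ((1 - \<tau> n) * t $ k + \<tau> n * s $ k) - xlnx (t $ k)) / \<tau> n =
        g k n + (if t $ k = 0 then s $ k else 0) * ln (\<tau> n)" for k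
      using \<tau>(1)[of n] s_nonneg[of k]
      by (cases "s $ k = 0") (auto simp: g_def xlnx_def ln_mult field_simps)
    then show ?thesis
      by (simp add: slope_def c_def sum_subtractf[symmetric] sum_divide_distrib sum.distrib sum_distrib_right)
  qed
  have sum_g: "(\<lambda>n. \<Sum>k\<in>UNIV. g k n) \<longlonglongrightarrow> (\<Sum>k\<in>UNIV. \<gamma> k)"
    by (intro tendsto_sum g)
  show ?thesis
  proof (cases "{i. s $ i \<noteq> 0} \<subseteq> {i. t $ i \<noteq> 0}")
    case True
    then have zero: "t $ k = 0 \<Longrightarrow> s $ k = 0" for k by auto
    then have "c = 0" by (auto simp: c_def intro!: sum.neutral)
    have "\<gamma> k = (s $ k - t $ k) * ln (t $ k) + (s $ k - t $ k)" for k
      using zero[of k] by (simp add: \<gamma>_def algebra_simps)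
    then have "(\<Sum>k\<in>UNIV. \<gamma> k) = (\<Sum>k\<in>UNIV. (s $ k - t $ k) * ln (t $ k))"
      using prob_vectorsD(2)[OF s] prob_vectorsD(2)[OF t] by (simp add: sum.distrib sum_subtractf)
    with sum_g show ?thesis
      using True by (simp add: slope \<open>c = 0\<close>)
  next
    case False
    then obtain i where "t $ i = 0" "s $ i \<noteq> 0" by auto
    then have "0 < c"
      unfolding c_def using s_nonneg by (intro sum_pos2[of _ i]) (auto simp: order_le_less)
    then have "filterlim (\<lambda>n. c * ln (\<tau> n)) at_bot sequentially"
      by (intro filterlim_tendsto_pos_mult_at_bot[OF tendsto_const] ln_null_at_bot \<tau>)
    then have "filterlim (\<lambda>n. (\<Sum>k\<in>UNIV. g k n) + c * ln (\<tau> n)) at_bot sequentially"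
      using filterlim_tendsto_add_at_bot_iff[OF sum_g] by simp
    then have "(\<lambda>n. ereal ((\<Sum>k\<in>UNIV. g k n) + c * ln (\<tau> n))) \<longlonglongrightarrow> - \<infinity>"
      unfolding tendsto_MInfty filterlim_at_bot_dense by simp
    then show ?thesis
      using False by (simp add: slope)
  qed
qed

lemma classical_divergence_eq:
  assumes "s \<in> prob_vectors" "t \<in> prob_vectors"
  shows "ereal ((\<Sum>k\<in>UNIV. xlnx (s $ k)) - (\<Sum>k\<in>UNIV. xlnx (t $ k))) -
      (if {i. s $ i \<noteq> 0} \<subseteq> {i. t $ i \<noteq> 0} then ereal (\<Sum>k\<in>UNIV. (s $ k - t $ k) * ln (t $ k)) else - \<infinity>)
    = classical_divergence s t"
proof (cases "{i. s $ i \<noteq> 0} \<subseteq> {i. t $ i \<noteq> 0}")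
  case True
  have "xlnx (s $ k) - xlnx (t $ k) - (s $ k - t $ k) * ln (t $ k) = s $ k * ln (s $ k / t $ k)" for k
    using True prob_vectorsD(1)[OF assms(1), of k] prob_vectorsD(1)[OF assms(2), of k]
    by (cases "s $ k = 0"; cases "t $ k = 0") (auto simp: xlnx_def ln_div algebra_simps)
  then show ?thesis
    using True by (simp add: classical_divergence_def sum_subtractf[symmetric])
qed (simp add: classical_divergence_def)

text \<open>Two successors keep the times strictly below \<open>1\<close> from the start and at most \<open>1/2\<close>.\<close>

definition harmonic_times :: "nat \<Rightarrow> real" where
  "harmonic_times n = inverse (real (Suc (Suc n)))"

lemma harmonic_times_bounds:
  "0 < harmonic_times n" "harmonic_times n < 1" "harmonic_times n \<le> 1" "harmonic_times \<longlonglongrightarrow> 0"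
proof -
  show "0 < harmonic_times n" "harmonic_times n < 1" "harmonic_times n \<le> 1"
    by (auto simp: harmonic_times_def field_simps)
  show "harmonic_times \<longlonglongrightarrow> 0"
    unfolding harmonic_times_def using LIMSEQ_Suc[OF LIMSEQ_inverse_real_of_nat] by simp
qed

theorem classical_characterization:
  fixes A :: "(real^'n \<Rightarrow> real measure) set"
  assumes card: "3 \<le> CARD('n)" and A: "action_set prob_vectors A"
    and suff: "sufficiency_property prob_vectors stochastic_map A"
  obtains \<kappa> l where "0 \<le> \<kappa>" "affine_on prob_vectors l"
    "\<And>p. p \<in> prob_vectors \<Longrightarrow> opt A p = \<kappa> * (\<Sum>k\<in>UNIV. xlnx (p $ k)) + l p"
    "\<And>s t. s \<in> prob_vectors \<Longrightarrow> t \<in> prob_vectors \<Longrightarrow> regret A s t = ereal \<kappa> * classical_divergence s t"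
proof -
  interpret action_set prob_vectors A by fact
  define l where "l p = (\<Sum>k\<in>UNIV. p $ k * F (axis k 1))" for p
  obtain \<kappa> where \<kappa>: "0 \<le> \<kappa>"
    "\<And>p. p \<in> prob_vectors \<Longrightarrow> F p = \<kappa> * (\<Sum>k\<in>UNIV. xlnx (p $ k)) + l p"
    using classical_value_form[OF card A suff] unfolding l_def by blast
  have l: "affine_on prob_vectors l"
    by (simp add: affine_on_def l_def sum_distrib_left sum.distrib[symmetric] algebra_simps)
  have "regret A s t = ereal \<kappa> * classical_divergence s t" if st: "s \<in> prob_vectors" "t \<in> prob_vectors" for s t
    unfolding classical_divergence_eq[OF st, symmetric]
    by (rule regret_of_decomposition[OF \<kappa>(2) l \<kappa>(1) st harmonic_times_bounds(1,3,4)
          classical_entropy_slope[OF st harmonic_times_bounds(1,4)]]) (auto split: if_splits)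
  with \<kappa> l show thesis using that by blast
qed

section \<open>Unitary matrices and diagonalization\<close>

lemma adjoint_mat_nth [simp]: "adjoint_mat X $ i $ j = cnj (X $ j $ i)"
  by (simp add: adjoint_mat_def)

lemma adjoint_mat_mult: "adjoint_mat (A ** B) = adjoint_mat B ** adjoint_mat A"
  by (simp add: vec_eq_iff matrix_matrix_mult_def mult.commute)

lemma adjoint_mat_adjoint [simp]: "adjoint_mat (adjoint_mat A) = A"
  by (simp add: vec_eq_iff)

lemma adjoint_mat_1 [simp]: "adjoint_mat (mat 1) = mat 1"
  by (simp add: vec_eq_iff mat_def)

lemma unitary_matD: "unitary_mat U \<Longrightarrow> adjoint_mat U ** U = mat 1" "unitary_mat U \<Longrightarrow> U ** adjoint_mat U = mat 1"
  by (auto simp: unitary_mat_def)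

lemma unitary_matI: "adjoint_mat U ** U = mat 1 \<Longrightarrow> unitary_mat U"
  using matrix_left_right_inverse[of "adjoint_mat U" U] by (simp add: unitary_mat_def)

lemma unitary_mat_1 [simp]: "unitary_mat (mat 1)"
  by (simp add: unitary_mat_def)

lemma unitary_mat_adjoint: "unitary_mat U \<Longrightarrow> unitary_mat (adjoint_mat U)"
  by (simp add: unitary_mat_def)

lemma unitary_mat_mult:
  assumes "unitary_mat U" "unitary_mat V"
  shows "unitary_mat (U ** V)"
proof (rule unitary_matI)
  have "adjoint_mat (U ** V) ** (U ** V) = adjoint_mat V ** (adjoint_mat U ** U) ** V"
    by (simp only: adjoint_mat_mult matrix_mul_assoc)
  then show "adjoint_mat (U ** V) ** (U ** V) = mat 1"
    by (simp add: unitary_matD assms)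
qed

lemma unitary_conj_cancel:
  assumes "unitary_mat U"
  shows "adjoint_mat U ** (U ** X ** adjoint_mat U) ** U = X" "U ** (adjoint_mat U ** X ** U) ** adjoint_mat U = X"
proof -
  have "adjoint_mat U ** (U ** X ** adjoint_mat U) ** U = (adjoint_mat U ** U) ** X ** (adjoint_mat U ** U)"
    by (simp only: matrix_mul_assoc)
  then show "adjoint_mat U ** (U ** X ** adjoint_mat U) ** U = X"
    by (simp add: unitary_matD[OF assms])
  have "U ** (adjoint_mat U ** X ** U) ** adjoint_mat U = (U ** adjoint_mat U) ** X ** (U ** adjoint_mat U)"
    by (simp only: matrix_mul_assoc)
  then show "U ** (adjoint_mat U ** X ** U) ** adjoint_mat U = X"
    by (simp add: unitary_matD[OF assms])
qed

lemma scaleR_matrix_mult [simp]: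
  "(r *\<^sub>R A) ** B = r *\<^sub>R (A ** B)" "A ** (r *\<^sub>R B) = r *\<^sub>R (A ** (B::complex^'p^'n))" for A :: "complex^'n^'m"
  by (simp_all add: vec_eq_iff matrix_matrix_mult_def scaleR_sum_right)

lemma conj_affine:
  fixes A :: "complex^'n^'m" and X Y :: "complex^'k^'n" and B :: "complex^'p^'k"
  shows "A ** (r *\<^sub>R X + u *\<^sub>R Y) ** B = r *\<^sub>R (A ** X ** B) + u *\<^sub>R (A ** Y ** B)"
proof -
  have "(C + D) ** B = C ** B + D ** B" for C D :: "complex^'k^'m"
    by (simp add: vec_eq_iff matrix_matrix_mult_def distrib_right sum.distrib)
  then show ?thesis by (simp add: matrix_add_ldistrib)
qed

lemma cdot_mult_right: "cdot v (A *v w) = cdot (adjoint_mat A *v v) w"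
  by (simp add: cdot_def matrix_vector_mult_def sum_distrib_left sum_distrib_right)
    (subst sum.swap, simp add: mult.commute mult.left_commute)

lemma cdot_self: "cdot v v = complex_of_real ((norm v)\<^sup>2)"
proof -
  have "cdot v v = complex_of_real (\<Sum>i\<in>UNIV. (norm (v $ i))\<^sup>2)"
    unfolding cdot_def of_real_sum
    by (intro sum.cong refl) (simp only: complex_norm_square mult.commute)
  then show ?thesis
    by (simp add: norm_vec_def L2_set_def sum_nonneg)
qed

lemma cdot_add: "cdot (v + w) x = cdot v x + cdot w x" "cdot x (v + w) = cdot x v + cdot x w"
  by (simp_all add: cdot_def algebra_simps sum.distrib)

lemma cdot_smult: "cdot (c *s v) x = cnj c * cdot v x" "cdot x (c *s v) = c * cdot x v"
  by (simp_all add: cdot_def sum_distrib_left algebra_simps)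

lemma cdot_axis: "cdot (axis i 1) v = v $ i" "cdot v (axis i 1) = cnj (v $ i)"
proof -
  have "cdot (axis i 1) v = (\<Sum>k\<in>UNIV. if k = i then v $ k else 0)"
    unfolding cdot_def by (intro sum.cong) (auto simp: axis_def)
  then show "cdot (axis i 1) v = v $ i" by simp
  have "cdot v (axis i 1) = (\<Sum>k\<in>UNIV. if k = i then cnj (v $ k) else 0)"
    unfolding cdot_def by (intro sum.cong) (auto simp: axis_def)
  then show "cdot v (axis i 1) = cnj (v $ i)" by simp
qed

lemma conj_nth: "(adjoint_mat U ** X ** U) $ i $ j = cdot (column i U) (X *v column j U)"
proof -
  have "(adjoint_mat U ** X ** U) $ i $ j = (adjoint_mat U ** (X ** U)) $ i $ j"
    by (simp add: matrix_mul_assoc)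
  then show ?thesis
    by (simp add: cdot_def matrix_matrix_mult_def matrix_vector_mult_def column_def)
qed

lemma matrix_vector_mult_axis: "((X :: complex^'n^'m) *v axis i 1) $ j = X $ j $ i"
proof -
  have "(X *v axis i 1) $ j = (\<Sum>k\<in>UNIV. if k = i then X $ j $ k else 0)"
    unfolding matrix_vector_mult_def vec_lambda_beta by (intro sum.cong) (auto simp: axis_def)
  then show ?thesis by simp
qed

lemma positive_matD: "positive_mat X \<Longrightarrow> cdot v (X *v v) \<in> \<real>\<^sub>\<ge>\<^sub>0"
  by (simp add: positive_mat_def)

lemma positive_mat_nonneg: "positive_mat X \<Longrightarrow> 0 \<le> Re (cdot v (X *v v))" "positive_mat X \<Longrightarrow> Im (cdot v (X *v v)) = 0"
  using positive_matD[of X v] by (auto simp: complex_nonneg_Reals_iff)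

lemma positive_mat_hermitian:
  assumes "positive_mat X"
  shows "adjoint_mat X = X"
proof -
  have form: "cdot (axis i 1 + c *s axis j 1) (X *v (axis i 1 + c *s axis j 1)) =
      X $ i $ i + c * X $ i $ j + cnj c * X $ j $ i + (cnj c * c) * X $ j $ j" for i j c
    by (simp add: matrix_vector_right_distrib vec.scale cdot_add cdot_smult cdot_axis
        matrix_vector_mult_axis algebra_simps)
  have "cnj (X $ j $ i) = X $ i $ j" for i j
  proof -
    have "Im (X $ i $ i) = 0" for i
      using positive_mat_nonneg(2)[OF assms, of "axis i 1"]
      by (simp add: cdot_axis matrix_vector_mult_axis)
    then have "Im (X $ i $ j) + Im (X $ j $ i) = 0" "Re (X $ i $ j) - Re (X $ j $ i) = 0"
      using positive_mat_nonneg(2)[OF assms, of "axis i 1 + 1 *s axis j 1"]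
        positive_mat_nonneg(2)[OF assms, of "axis i 1 + \<i> *s axis j 1"]
      unfolding form by simp_all
    then show ?thesis by (simp add: complex_eq_iff)
  qed
  then show ?thesis by (simp add: vec_eq_iff)
qed

definition unitary_set :: "(complex^'n^'n) set" where
  "unitary_set = {U. unitary_mat U}"

lemma unitary_row_norm: "unitary_mat U \<Longrightarrow> norm (U $ i) = 1"
proof -
  assume U: "unitary_mat U"
  have "1 = (U ** adjoint_mat U) $ i $ i"
    by (simp add: unitary_matD[OF U] mat_def)
  also have "\<dots> = complex_of_real ((norm (U $ i))\<^sup>2)"
    unfolding cdot_self[symmetric] by (simp add: matrix_matrix_mult_def cdot_def mult.commute)
  finally have "(norm (U $ i))\<^sup>2 = 1"
    using of_real_eq_1_iff by metis
  then show ?thesis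
    using power2_eq_1_iff by (metis norm_ge_zero not_one_le_zero neg_0_le_iff_le)
qed

lemma tendsto_conj_nth:
  assumes "(U \<longlongrightarrow> U0) F" "(X \<longlongrightarrow> X0) F"
  shows "((\<lambda>n. (adjoint_mat (U n) ** X n ** U n) $ i $ j) \<longlongrightarrow> (adjoint_mat U0 ** X0 ** U0) $ i $ j) F"
  unfolding matrix_matrix_mult_def adjoint_mat_def vec_lambda_beta
  by (intro tendsto_intros assms)

lemma compact_unitary: "compact (unitary_set :: (complex^'n^'n) set)"
proof -
  have "bounded (unitary_set :: (complex^'n^'n) set)"
  proof (rule boundedI)
    fix U :: "complex^'n^'n" assume "U \<in> unitary_set"
    then have "norm (U $ i) = 1" for i by (simp add: unitary_set_def unitary_row_norm)
    then show "norm U \<le> real CARD('n)"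
      unfolding norm_vec_def[of U] by (intro order_trans[OF L2_set_le_sum]) auto
  qed
  moreover have "closed (unitary_set :: (complex^'n^'n) set)"
    unfolding closed_sequential_limits
  proof (intro allI impI, elim conjE)
    fix U :: "nat \<Rightarrow> complex^'n^'n" and V assume U: "\<forall>n. U n \<in> unitary_set" and lim: "U \<longlonglongrightarrow> V"
    have "(adjoint_mat V ** mat 1 ** V) $ i $ j = mat 1 $ i $ j" for i j
    proof -
      have "(\<lambda>n. (adjoint_mat (U n) ** mat 1 ** U n) $ i $ j) \<longlonglongrightarrow> (adjoint_mat V ** mat 1 ** V) $ i $ j"
        by (intro tendsto_conj_nth lim tendsto_const)
      moreover have "(adjoint_mat (U n) ** mat 1 ** U n) = mat 1" for n
        using U by (simp add: unitary_set_def unitary_matD)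
      ultimately show ?thesis
        by (simp add: LIMSEQ_const_iff)
    qed
    then have "adjoint_mat V ** V = mat 1" by (simp add: vec_eq_iff)
    then show "V \<in> unitary_set" by (simp add: unitary_set_def unitary_matI)
  qed
  ultimately show ?thesis by (simp add: compact_eq_bounded_closed)
qed

definition diag_val :: "complex^'n^'n \<Rightarrow> complex^'n^'n \<Rightarrow> 'n \<Rightarrow> real" where
  "diag_val U X i = Re ((adjoint_mat U ** X ** U) $ i $ i)"

lemma diag_val_cdot: "diag_val U X i = Re (cdot (column i U) (X *v column i U))"
  by (simp add: diag_val_def conj_nth)

lemma sum_diag_val:
  assumes "unitary_mat U"
  shows "(\<Sum>i\<in>UNIV. diag_val U X i) = Re (trace X)"
proof -
  have "(\<Sum>i\<in>UNIV. diag_val U X i) = Re (trace (adjoint_mat U ** X ** U))"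
    by (simp add: diag_val_def trace_def)
  also have "trace (adjoint_mat U ** X ** U) = trace (U ** (adjoint_mat U ** X))"
    by (rule trace_mul_sym)
  also have "\<dots> = trace X"
    by (simp add: matrix_mul_assoc unitary_matD[OF assms])
  finally show ?thesis .
qed

text \<open>The unitary of the plane of the letters \<open>p\<close>, \<open>q\<close> whose column \<open>p\<close> is \<open>a e\<^sub>p + b e\<^sub>q\<close>.\<close>

definition plane_rotation :: "'n \<Rightarrow> 'n \<Rightarrow> real \<Rightarrow> complex \<Rightarrow> complex^'n^'n" where
  "plane_rotation p q a b = (\<chi> i j.
     if j = p then (if i = p then of_real a else if i = q then b else 0)
     else if j = q then (if i = p then - cnj b else if i = q then of_real a else 0)
     else if i = j then 1 else 0)"

lemma unitary_plane_rotation: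
  assumes pq: "p \<noteq> q" and ab: "a\<^sup>2 + (cmod b)\<^sup>2 = 1"
  shows "unitary_mat (plane_rotation p q a b)"
proof (rule unitary_matI)
  have ab': "complex_of_real a * complex_of_real a + b * cnj b = 1"
    using arg_cong[OF ab, of complex_of_real] by (simp add: complex_norm_square[symmetric] power2_eq_square)
  have "(adjoint_mat (plane_rotation p q a b) ** plane_rotation p q a b) $ i $ j = (if i = j then 1 else 0)" for i j
  proof -
    have rest: "(\<Sum>k\<in>UNIV - {p} - {q}. cnj (plane_rotation p q a b $ k $ i) * plane_rotation p q a b $ k $ j) =
      (if i = j \<and> i \<noteq> p \<and> i \<noteq> q then 1 else 0)"
    proof -
      have "(\<Sum>k\<in>UNIV - {p} - {q}. cnj (plane_rotation p q a b $ k $ i) * plane_rotation p q a b $ k $ j) =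
        (\<Sum>k\<in>UNIV - {p} - {q}. if k = i then (if i = j then 1 else 0) else 0)"
        by (intro sum.cong) (auto simp: plane_rotation_def)
      then show ?thesis by simp
    qed
    show ?thesis
      unfolding matrix_matrix_mult_def vec_lambda_beta adjoint_mat_nth sum_UNIV_remove_two[OF pq] rest
      using pq ab' by (auto simp: plane_rotation_def algebra_simps)
  qed
  then show "adjoint_mat (plane_rotation p q a b) ** plane_rotation p q a b = mat 1"
    by (simp add: vec_eq_iff mat_def)
qed

lemma column_plane_rotation:
  assumes "p \<noteq> q"
  shows "column p (plane_rotation p q a b) = of_real a *s axis p 1 + b *s axis q 1"
    "i \<noteq> p \<Longrightarrow> i \<noteq> q \<Longrightarrow> column i (plane_rotation p q a b) = axis i 1"
  using assms by (auto simp: plane_rotation_def column_def vec_eq_iff axis_def)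

text \<open>To first order in the angle, a rotation in the plane of \<open>p\<close> and \<open>q\<close> changes the diagonal entry at
  \<open>p\<close> by twice the modulus of the off-diagonal entry, if the phase of \<open>b\<close> is chosen to match. The
  tangent \<open>t\<close> of the angle is small enough for the second order term \<open>t\<^sup>2 d\<close> not to spoil this.\<close>

lemma rotation_increases_entry:
  fixes Y :: "complex^'n^'n"
  assumes herm: "adjoint_mat Y = Y" and pq: "p \<noteq> q" and Y: "Y $ p $ q \<noteq> 0"
  shows "\<exists>V. unitary_mat V \<and> (\<forall>i. i \<noteq> p \<longrightarrow> i \<noteq> q \<longrightarrow> diag_val V Y i = Re (Y $ i $ i)) \<and>
    Re (Y $ p $ p) < diag_val V Y p"
proof -
  define m where "m = cmod (Y $ p $ q)"
  define d where "d = Re (Y $ q $ q) - Re (Y $ p $ p)"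
  have m: "0 < m" using Y by (simp add: m_def)
  define t where "t = m / (1 + \<bar>d\<bar>)"
  have t: "0 < t" using m by (simp add: t_def)
  define a where "a = 1 / sqrt (1 + t\<^sup>2)"
  define b where "b = of_real (t * a / m) * cnj (Y $ p $ q)"
  have a2: "a\<^sup>2 = 1 / (1 + t\<^sup>2)" by (simp add: a_def power_divide)
  have a: "0 < a" by (simp add: a_def add_pos_nonneg)
  have "cmod b = t * a"
  proof -
    have "cmod b = \<bar>t * a / m\<bar> * m"
      unfolding b_def norm_mult norm_of_real complex_mod_cnj m_def ..
    then show ?thesis using m t a by simp
  qed
  then have ab: "a\<^sup>2 + (cmod b)\<^sup>2 = 1"
    by (simp add: power_mult_distrib a2 add_divide_distrib[symmetric]) (simp add: field_simps add_nonneg_eq_0_iff)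
  let ?V = "plane_rotation p q a b"
  have "diag_val ?V Y i = Re (Y $ i $ i)" if "i \<noteq> p" "i \<noteq> q" for i
    by (simp add: diag_val_cdot column_plane_rotation[OF pq] that cdot_axis matrix_vector_mult_axis)
  moreover have "Re (Y $ p $ p) < diag_val ?V Y p"
  proof -
    have Yqp: "Y $ q $ p = cnj (Y $ p $ q)" using herm by (metis adjoint_mat_nth)
    have "diag_val ?V Y p = Re (of_real a * of_real a * Y $ p $ p + of_real a * (b * Y $ p $ q)
        + of_real a * (cnj b * Y $ q $ p) + (cnj b * b) * Y $ q $ q)"
      by (simp add: diag_val_cdot column_plane_rotation[OF pq] matrix_vector_right_distrib vec.scale
          cdot_add cdot_smult cdot_axis matrix_vector_mult_axis algebra_simps)
    also have "\<dots> = a\<^sup>2 * Re (Y $ p $ p) + 2 * a * Re (b * Y $ p $ q) + (cmod b)\<^sup>2 * Re (Y $ q $ q)"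
    proof -
      have "cnj b * Y $ q $ p = cnj (b * Y $ p $ q)" by (simp add: Yqp)
      moreover have "cnj b * b = of_real ((cmod b)\<^sup>2)" by (metis complex_norm_square mult.commute)
      ultimately show ?thesis by (simp add: Yqp power2_eq_square algebra_simps)
    qed
    also have "b * Y $ p $ q = of_real (t * a * m)"
    proof -
      have "b * Y $ p $ q = of_real (t * a / m) * (Y $ p $ q * cnj (Y $ p $ q))" by (simp add: b_def)
      also have "Y $ p $ q * cnj (Y $ p $ q) = of_real (m\<^sup>2)" by (simp only: m_def complex_norm_square)
      also have "of_real (t * a / m) * of_real (m\<^sup>2) = (of_real (t * a / m * m\<^sup>2) :: complex)" by simp
      also have "t * a / m * m\<^sup>2 = t * a * m" using m by (simp add: power2_eq_square)
      finally show ?thesis .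
    qed
    finally have "diag_val ?V Y p = a\<^sup>2 * (Re (Y $ p $ p) + 2 * t * m + t\<^sup>2 * Re (Y $ q $ q))"
      using \<open>cmod b = t * a\<close> by (simp add: power2_eq_square algebra_simps)
    also have "\<dots> = a\<^sup>2 * ((1 + t\<^sup>2) * Re (Y $ p $ p) + t * (2 * m + t * d))"
      by (simp add: d_def power2_eq_square algebra_simps)
    also have "\<dots> = Re (Y $ p $ p) + a\<^sup>2 * (t * (2 * m + t * d))"
    proof -
      have "a\<^sup>2 * (1 + t\<^sup>2) = 1" unfolding a2 by (simp add: add_nonneg_eq_0_iff)
      then have "a\<^sup>2 * (1 + t\<^sup>2) * Re (Y $ p $ p) = Re (Y $ p $ p)" by simp
      moreover have "x * (y * z + w) = x * y * z + x * w" for x y z w :: real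
        by (simp add: distrib_left)
      ultimately show ?thesis by (simp only:)
    qed
    also have "\<dots> > Re (Y $ p $ p)"
    proof -
      have "t * \<bar>d\<bar> \<le> m" using m by (simp add: t_def field_simps)
      moreover have "t * (- \<bar>d\<bar>) \<le> t * d" using t by (intro mult_left_mono) auto
      ultimately have "- m \<le> t * d" by simp
      then have "0 < 2 * m + t * d" using m by simp
      then show ?thesis using t a by simp
    qed
    finally show ?thesis .
  qed
  ultimately show ?thesis
    using unitary_plane_rotation[OF pq ab] by blast
qed

text \<open>Choose distinct weights \<open>c\<close> and maximize the weighted sum of the diagonal entries over the compact
  unitary group. At a maximum all off-diagonal entries vanish: otherwise a rotation would raise the
  diagonal entry with the larger weight at the expense of the one with the smaller weight, the trace
  being fixed.\<close>

theorem hermitian_diagonalization: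
  fixes X :: "complex^'n^'n"
  assumes herm: "adjoint_mat X = X"
  obtains U d where "unitary_mat U" "X = U ** diag_mat d ** adjoint_mat U"
proof -
  obtain c :: "'n \<Rightarrow> nat" where "inj c"
    using finite_imp_inj_to_nat_seg[of "UNIV :: 'n set"] by auto
  define f where "f U = (\<Sum>i\<in>UNIV. real (c i) * diag_val U X i)" for U
  have "continuous_on unitary_set f"
    unfolding f_def diag_val_def continuous_on_def
    by (intro ballI tendsto_sum tendsto_mult tendsto_const tendsto_Re tendsto_conj_nth tendsto_ident_at)
  moreover have "mat 1 \<in> unitary_set" by (simp add: unitary_set_def)
  then have "unitary_set \<noteq> {}" by blast
  ultimately obtain U where "U \<in> unitary_set" and "\<forall>V\<in>unitary_set. f V \<le> f U"
    using continuous_attains_sup[OF compact_unitary] by metis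
  then have U: "unitary_mat U" and max: "\<And>V. unitary_mat V \<Longrightarrow> f V \<le> f U"
    by (auto simp: unitary_set_def)
  define Y where "Y = adjoint_mat U ** X ** U"
  have Y_herm: "adjoint_mat Y = Y"
    by (simp add: Y_def adjoint_mat_mult herm matrix_mul_assoc)
  have comp: "diag_val (U ** V) X i = diag_val V Y i" for V i
    by (simp add: diag_val_def Y_def adjoint_mat_mult matrix_mul_assoc)
  have Re_Y: "Re (Y $ i $ i) = diag_val U X i" for i
    by (simp add: Y_def diag_val_def)
  have off: "Y $ p $ q = 0" if "c q < c p" for p q
  proof (rule ccontr)
    assume "Y $ p $ q \<noteq> 0"
    moreover have pq: "p \<noteq> q" using that by auto
    ultimately obtain V where V: "unitary_mat V"
      and same: "\<And>i. i \<noteq> p \<Longrightarrow> i \<noteq> q \<Longrightarrow> diag_val V Y i = diag_val U X i"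
      and more: "diag_val U X p < diag_val V Y p"
      using rotation_increases_entry[OF Y_herm, of p q] unfolding Re_Y by blast
    have "(\<Sum>i\<in>UNIV. diag_val (U ** V) X i) = (\<Sum>i\<in>UNIV. diag_val U X i)"
      using U V by (simp add: sum_diag_val unitary_mat_mult)
    then have q: "diag_val V Y q = diag_val U X p + diag_val U X q - diag_val V Y p"
      unfolding comp sum_UNIV_remove_two[OF pq] using same by simp
    have rest: "(\<Sum>i\<in>UNIV - {p} - {q}. real (c i) * diag_val V Y i) =
        (\<Sum>i\<in>UNIV - {p} - {q}. real (c i) * diag_val U X i)"
      using same by (intro sum.cong) auto
    have "f (U ** V) - f U = (real (c p) - real (c q)) * (diag_val V Y p - diag_val U X p)"
      unfolding f_def comp sum_UNIV_remove_two[OF pq] rest q by (simp add: algebra_simps)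
    moreover have "f (U ** V) \<le> f U" using U V by (intro max unitary_mat_mult)
    moreover have "0 < (real (c p) - real (c q)) * (diag_val V Y p - diag_val U X p)"
      using more that by simp
    ultimately show False by simp
  qed
  have "Y $ p $ q = 0" if "p \<noteq> q" for p q
  proof (cases "c q < c p")
    case False
    then have "c p < c q" using \<open>inj c\<close> that by (metis injD linorder_neqE_nat)
    then have "Y $ q $ p = 0" by (rule off)
    then show ?thesis using Y_herm by (metis adjoint_mat_nth complex_cnj_zero)
  qed (rule off)
  moreover have "Y $ p $ p = of_real (Re (Y $ p $ p))" for p
    using Y_herm by (metis adjoint_mat_nth complex_is_Real_iff Reals_cnj_iff of_real_Re)
  ultimately have "Y = diag_mat (\<chi> i. Re (Y $ i $ i))"
    by (auto simp: vec_eq_iff diag_mat_def)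
  moreover have "X = U ** Y ** adjoint_mat U"
    unfolding Y_def by (rule unitary_conj_cancel(2)[OF U, symmetric])
  ultimately show thesis using that[OF U] by metis
qed

section \<open>Density matrices\<close>

lemma diag_conj_vector:
  "((U ** diag_mat d ** adjoint_mat U) *v v) = U *v (\<chi> i. of_real (d $ i) * (adjoint_mat U *v v) $ i)"
proof -
  have "diag_mat d *v w = (\<chi> i. of_real (d $ i) * w $ i)" for w
  proof -
    have "(diag_mat d *v w) $ i = (\<Sum>k\<in>UNIV. if k = i then of_real (d $ i) * w $ i else 0)" for i
      unfolding matrix_vector_mult_def vec_lambda_beta by (intro sum.cong) (auto simp: diag_mat_def)
    then show ?thesis by (simp add: vec_eq_iff)
  qed
  then show ?thesis
    by (simp add: matrix_vector_mul_assoc[symmetric])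
qed

lemma diag_conj_form:
  "cdot v ((U ** diag_mat d ** adjoint_mat U) *v v) =
    of_real (\<Sum>i\<in>UNIV. d $ i * (cmod ((adjoint_mat U *v v) $ i))\<^sup>2)"
proof -
  have "cnj z * (of_real r * z) = of_real (r * (cmod z)\<^sup>2)" for r and z :: complex
    unfolding of_real_mult complex_norm_square by (simp only: mult.commute mult.left_commute)
  then show ?thesis
    unfolding diag_conj_vector cdot_mult_right by (simp only: cdot_def vec_lambda_beta of_real_sum)
qed

lemma diag_val_diag_conj: "unitary_mat U \<Longrightarrow> diag_val U (U ** diag_mat d ** adjoint_mat U) i = d $ i"
  by (simp add: diag_val_def unitary_conj_cancel diag_mat_def)

lemma positive_diag_conj_iff:
  assumes U: "unitary_mat U"
  shows "positive_mat (U ** diag_mat d ** adjoint_mat U) \<longleftrightarrow> (\<forall>i. 0 \<le> d $ i)"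
proof
  assume "positive_mat (U ** diag_mat d ** adjoint_mat U)"
  from positive_mat_nonneg(1)[OF this] show "\<forall>i. 0 \<le> d $ i"
    unfolding diag_val_diag_conj[OF U, symmetric] diag_val_cdot by blast
next
  assume "\<forall>i. 0 \<le> d $ i"
  then show "positive_mat (U ** diag_mat d ** adjoint_mat U)"
    unfolding positive_mat_def diag_conj_form
    by (intro allI) (auto simp: complex_nonneg_Reals_iff simp del: of_real_sum intro!: sum_nonneg)
qed

lemma trace_conj: "unitary_mat U \<Longrightarrow> trace (U ** X ** adjoint_mat U) = trace X"
  using trace_mul_sym[of "U ** X" "adjoint_mat U"] by (simp add: matrix_mul_assoc unitary_matD)

lemma trace_diag_mat: "trace (diag_mat d) = of_real (\<Sum>i\<in>UNIV. d $ i)"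
  by (simp add: trace_def diag_mat_def)

lemma diag_conj_density_iff:
  assumes U: "unitary_mat U"
  shows "U ** diag_mat d ** adjoint_mat U \<in> density_matrices \<longleftrightarrow> d \<in> prob_vectors"
  unfolding density_matrices_def prob_vectors_def mem_Collect_eq positive_diag_conj_iff[OF U]
    trace_conj[OF U] trace_diag_mat of_real_eq_1_iff ..

lemma positive_diagonalization:
  assumes "positive_mat X"
  obtains U d where "unitary_mat U" "X = U ** diag_mat d ** adjoint_mat U" "\<And>i. 0 \<le> d $ i"
  using hermitian_diagonalization[OF positive_mat_hermitian[OF assms]] positive_diag_conj_iff assms by metis

lemma density_diagonalization:
  assumes "s \<in> density_matrices"
  obtains U p where "unitary_mat U" "s = U ** diag_mat p ** adjoint_mat U" "p \<in> prob_vectors"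
proof -
  from assms have "positive_mat s" by (simp add: density_matrices_def)
  then obtain U p where "unitary_mat U" "s = U ** diag_mat p ** adjoint_mat U"
    by (rule positive_diagonalization)
  with assms show thesis using that diag_conj_density_iff by metis
qed

lemma convex_density_matrices: "convex (density_matrices :: (complex^'n^'n) set)"
proof (rule convexI)
  fix X Y :: "complex^'n^'n" and u v :: real
  assume *: "X \<in> density_matrices" "Y \<in> density_matrices" "0 \<le> u" "0 \<le> v" "u + v = 1"
  have "cdot w ((u *\<^sub>R X + v *\<^sub>R Y) *v w) = of_real u * cdot w (X *v w) + of_real v * cdot w (Y *v w)" for w
  proof -
    have "(r *\<^sub>R Z) *v w = of_real r *s (Z *v w)" for r and Z :: "complex^'n^'n"
      unfolding vec_eq_iff matrix_vector_mult_def by (simp add: scaleR_conv_of_real[where 'a=complex] sum_distrib_left mult.assoc)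
    then show ?thesis by (simp add: matrix_vector_mult_add_rdistrib cdot_add cdot_smult)
  qed
  then have "positive_mat (u *\<^sub>R X + v *\<^sub>R Y)"
    using * unfolding positive_mat_def density_matrices_def by (auto simp: complex_nonneg_Reals_iff)
  moreover have "trace (u *\<^sub>R X + v *\<^sub>R Y) = u *\<^sub>R trace X + v *\<^sub>R trace Y"
    by (simp add: trace_def sum.distrib scaleR_sum_right)
  then have "trace (u *\<^sub>R X + v *\<^sub>R Y) = 1"
    using * by (simp add: density_matrices_def scaleR_conv_of_real[where 'a=complex] flip: of_real_add)
  ultimately show "u *\<^sub>R X + v *\<^sub>R Y \<in> density_matrices" by (simp add: density_matrices_def)
qed

lemma diag_mat_affine: "diag_mat (u *\<^sub>R p + v *\<^sub>R q) = u *\<^sub>R diag_mat p + v *\<^sub>R diag_mat q"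
  by (simp add: vec_eq_iff diag_mat_def scaleR_conv_of_real[where 'a=complex])

lemma diag_conj_affine:
  "U ** diag_mat (u *\<^sub>R p + v *\<^sub>R q) ** adjoint_mat U =
    u *\<^sub>R (U ** diag_mat p ** adjoint_mat U) + v *\<^sub>R (U ** diag_mat q ** adjoint_mat U)"
  unfolding diag_mat_affine conj_affine ..

section \<open>Quantum channels\<close>

lemma quantum_channel_conj:
  fixes U :: "complex^'n^'n"
  assumes U: "unitary_mat U"
  shows "quantum_channel (\<lambda>X. U ** X ** adjoint_mat U)"
proof -
  have "complex_linear_map (\<lambda>X. U ** X ** adjoint_mat U)"
    unfolding complex_linear_map_def
  proof (intro conjI allI)
    fix X Y :: "complex^'n^'n" and c
    show "U ** (X + Y) ** adjoint_mat U = U ** X ** adjoint_mat U + U ** Y ** adjoint_mat U"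
      using conj_affine[of U 1 X 1 Y "adjoint_mat U"] by simp
    show "U ** (\<chi> i j. c * X $ i $ j) ** adjoint_mat U = (\<chi> i j. c * (U ** X ** adjoint_mat U) $ i $ j)"
      by (simp add: vec_eq_iff matrix_matrix_mult_def sum_distrib_left sum_distrib_right mult.assoc mult.left_commute)
  qed
  moreover have "positive_block_mat k (\<lambda>i j. U ** X i j ** adjoint_mat U)" if "positive_block_mat k X" for k X
    unfolding positive_block_mat_def
  proof
    fix v :: "nat \<Rightarrow> complex^'n"
    have "cdot (v i) ((U ** X i j ** adjoint_mat U) *v v j) = cdot (adjoint_mat U *v v i) (X i j *v (adjoint_mat U *v v j))" for i j
      by (simp add: matrix_vector_mul_assoc[symmetric] cdot_mult_right[of _ U])
    then show "(\<Sum>i<k. \<Sum>j<k. cdot (v i) ((U ** X i j ** adjoint_mat U) *v v j)) \<in> \<real>\<^sub>\<ge>\<^sub>0"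
      using that unfolding positive_block_mat_def by simp
  qed
  ultimately show ?thesis
    by (simp add: quantum_channel_def completely_positive_def trace_conj[OF U])
qed

text \<open>Measures in the standard basis and applies \<open>M\<close> to the resulting distribution.\<close>

definition diagonal_channel :: "real^'n^'n \<Rightarrow> complex^'n^'n \<Rightarrow> complex^'n^'n" where
  "diagonal_channel M X = (\<chi> a b. if a = b then \<Sum>j\<in>UNIV. of_real (M $ a $ j) * X $ j $ j else 0)"

lemma sum_nonneg_Reals: "(\<And>i. i \<in> I \<Longrightarrow> f i \<in> \<real>\<^sub>\<ge>\<^sub>0) \<Longrightarrow> (\<Sum>i\<in>I. f i) \<in> (\<real>\<^sub>\<ge>\<^sub>0 :: complex set)"
  by (auto simp: complex_nonneg_Reals_iff intro!: sum_nonneg sum.neutral)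

lemma quantum_channel_diagonal:
  fixes M :: "real^'n^'n"
  assumes M: "\<And>i j. 0 \<le> M $ i $ j" "\<And>j. (\<Sum>i\<in>UNIV. M $ i $ j) = 1"
  shows "quantum_channel (diagonal_channel M)"
proof -
  have "complex_linear_map (diagonal_channel M)"
    unfolding complex_linear_map_def
    by (auto simp: diagonal_channel_def vec_eq_iff distrib_left sum.distrib sum_distrib_left mult.left_commute)
  moreover have "positive_block_mat k (\<lambda>i j. diagonal_channel M (X i j))" if "positive_block_mat k X" for k X
    unfolding positive_block_mat_def
  proof
    fix v :: "nat \<Rightarrow> complex^'n"
    \<comment> \<open>These vectors are the images of \<open>v\<close> under the adjoints of the Kraus operators, up to the
      factors \<open>sqrt (M $ a $ l)\<close>.\<close>
    define w :: "'n \<Rightarrow> 'n \<Rightarrow> nat \<Rightarrow> complex^'n" where "w a l i = v i $ a *s axis l 1" for a l i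
    have "cdot (v i) (diagonal_channel M Y *v v j) =
        (\<Sum>a\<in>UNIV. \<Sum>l\<in>UNIV. of_real (M $ a $ l) * cdot (w a l i) (Y *v w a l j))" for i j Y
    proof -
      have "(diagonal_channel M Y *v v j) $ a = (\<Sum>l\<in>UNIV. of_real (M $ a $ l) * Y $ l $ l) * v j $ a" for a
      proof -
        have "(diagonal_channel M Y *v v j) $ a =
            (\<Sum>b\<in>UNIV. if b = a then (\<Sum>l\<in>UNIV. of_real (M $ a $ l) * Y $ l $ l) * v j $ a else 0)"
          unfolding matrix_vector_mult_def vec_lambda_beta
          by (intro sum.cong) (auto simp: diagonal_channel_def)
        then show ?thesis by simp
      qed
      moreover have "cdot (w a l i) (Y *v w a l j) = cnj (v i $ a) * v j $ a * Y $ l $ l" for a l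
        by (simp add: w_def vec.scale cdot_smult cdot_axis matrix_vector_mult_axis mult.assoc)
      ultimately show ?thesis
        by (simp add: cdot_def sum_distrib_left sum_distrib_right mult_ac)
    qed
    then have "(\<Sum>i<k. \<Sum>j<k. cdot (v i) (diagonal_channel M (X i j) *v v j)) =
        (\<Sum>i<k. \<Sum>j<k. \<Sum>a\<in>UNIV. \<Sum>l\<in>UNIV. of_real (M $ a $ l) * cdot (w a l i) (X i j *v w a l j))"
      by simp
    also have "\<dots> = (\<Sum>a\<in>UNIV. \<Sum>i<k. \<Sum>j<k. \<Sum>l\<in>UNIV. of_real (M $ a $ l) * cdot (w a l i) (X i j *v w a l j))"
      by (subst (2) sum.swap, subst sum.swap) (rule refl)
    also have "\<dots> = (\<Sum>a\<in>UNIV. \<Sum>l\<in>UNIV. \<Sum>i<k. \<Sum>j<k. of_real (M $ a $ l) * cdot (w a l i) (X i j *v w a l j))"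
      by (rule sum.cong[OF refl], subst (2) sum.swap, subst sum.swap) (rule refl)
    also have "\<dots> = (\<Sum>a\<in>UNIV. \<Sum>l\<in>UNIV. of_real (M $ a $ l) * (\<Sum>i<k. \<Sum>j<k. cdot (w a l i) (X i j *v w a l j)))"
      by (simp add: sum_distrib_left)
    also have "\<dots> \<in> \<real>\<^sub>\<ge>\<^sub>0"
      by (rule sum_nonneg_Reals, rule sum_nonneg_Reals, rule nonneg_Reals_mult_I)
        (use that M(1) in \<open>auto simp: positive_block_mat_def\<close>)
    finally show "(\<Sum>i<k. \<Sum>j<k. cdot (v i) (diagonal_channel M (X i j) *v v j)) \<in> \<real>\<^sub>\<ge>\<^sub>0" .
  qed
  moreover have "trace (diagonal_channel M X) = trace X" for X
  proof -
    have "trace (diagonal_channel M X) = (\<Sum>j\<in>UNIV. \<Sum>a\<in>UNIV. of_real (M $ a $ j) * X $ j $ j)"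
      unfolding trace_def diagonal_channel_def by simp (rule sum.swap)
    also have "\<dots> = (\<Sum>j\<in>UNIV. of_real (\<Sum>a\<in>UNIV. M $ a $ j) * X $ j $ j)"
      by (simp add: sum_distrib_right)
    finally show ?thesis by (simp add: M(2) trace_def)
  qed
  ultimately show ?thesis
    by (simp add: quantum_channel_def completely_positive_def)
qed

lemma diagonal_channel_diag_mat: "diagonal_channel M (diag_mat p) = diag_mat (M *v p)"
  by (simp add: diagonal_channel_def diag_mat_def vec_eq_iff matrix_vector_mult_def)

section \<open>Quantum entropy\<close>

definition neg_entropy :: "complex^'n^'n \<Rightarrow> real" where
  "neg_entropy s = - von_neumann_entropy s"

lemma trace_mult_hermitian_fun:
  assumes U: "unitary_mat U"
  shows "Re (trace (s ** hermitian_fun f (U ** diag_mat d ** adjoint_mat U))) =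
    (\<Sum>i\<in>UNIV. diag_val U s i * f (d $ i))"
proof -
  let ?D = "diag_mat (\<chi> i. f (d $ i))"
  have "trace (s ** hermitian_fun f (U ** diag_mat d ** adjoint_mat U)) = trace ((s ** U ** ?D) ** adjoint_mat U)"
    by (simp add: hermitian_fun_diag[OF U] matrix_mul_assoc)
  also have "\<dots> = trace (adjoint_mat U ** (s ** U ** ?D))"
    by (rule trace_mul_sym)
  also have "adjoint_mat U ** (s ** U ** ?D) = (adjoint_mat U ** s ** U) ** ?D"
    by (simp add: matrix_mul_assoc)
  finally show ?thesis
    by (simp add: trace_def diag_mat_mult_right diag_val_def)
qed

lemma neg_entropy_diag_conj:
  assumes U: "unitary_mat U"
  shows "neg_entropy (U ** diag_mat d ** adjoint_mat U) = (\<Sum>i\<in>UNIV. xlnx (d $ i))"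
  unfolding neg_entropy_def von_neumann_entropy_def trace_mult_hermitian_fun[OF U] diag_val_diag_conj[OF U]
  by (simp add: xlnx_def)

lemma xlnx_tangent:
  assumes "0 \<le> x" "0 < y"
  shows "xlnx y + (ln y + 1) * (x - y) \<le> xlnx x"
proof (cases "x = 0")
  case True
  then show ?thesis using assms by (simp add: xlnx_def algebra_simps)
next
  case False
  with assms have x: "0 < x" by simp
  have "ln (y / x) \<le> y / x - 1" using x assms by (intro ln_le_minus_one) simp
  then have "x * (ln y - ln x) \<le> x * (y / x - 1)"
    using x assms by (intro mult_left_mono) (auto simp: ln_div)
  also have "\<dots> = y - x" using x by (simp add: right_diff_distrib)
  finally show ?thesis by (simp add: xlnx_def algebra_simps)
qed

lemma convex_xlnx: "convex_on {0..} xlnx"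
proof (rule convex_onI)
  fix u x y :: real assume *: "0 < u" "u < 1" "x \<in> {0..}" "y \<in> {0..}"
  define m where "m = (1 - u) *\<^sub>R x + u *\<^sub>R y"
  show "xlnx m \<le> (1 - u) * xlnx x + u * xlnx y"
  proof (cases "m = 0")
    case True
    then have "x = 0" "y = 0"
      using * by (auto simp: m_def add_nonneg_eq_0_iff)
    then show ?thesis by (simp add: True)
  next
    case False
    moreover have "0 \<le> m" using * by (simp add: m_def)
    ultimately have m: "0 < m" by simp
    have "(1 - u) * (xlnx m + (ln m + 1) * (x - m)) + u * (xlnx m + (ln m + 1) * (y - m)) \<le>
        (1 - u) * xlnx x + u * xlnx y"
      using * m by (intro add_mono mult_left_mono xlnx_tangent) auto
    moreover have "(1 - u) * (xlnx m + (ln m + 1) * (x - m)) + u * (xlnx m + (ln m + 1) * (y - m)) =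
        xlnx m + (ln m + 1) * ((1 - u) * x + u * y - m)"
      by (simp add: algebra_simps)
    ultimately show ?thesis by (simp add: m_def)
  qed
qed simp

text \<open>The diagonal of a Hermitian matrix in one basis is the image of its eigenvalues under a doubly
  stochastic matrix, formed by the squared moduli of the overlaps of the two bases.\<close>

lemma diag_val_weights:
  fixes U V :: "complex^'n^'n"
  assumes U: "unitary_mat U" and V: "unitary_mat V"
  obtains w :: "'n \<Rightarrow> 'n \<Rightarrow> real" where "\<And>i j. 0 \<le> w i j" "\<And>i. (\<Sum>j\<in>UNIV. w i j) = 1"
    "\<And>j. (\<Sum>i\<in>UNIV. w i j) = 1"
    "\<And>d i. diag_val U (V ** diag_mat d ** adjoint_mat V) i = (\<Sum>j\<in>UNIV. w i j * d $ j)"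
proof -
  define W where "W = adjoint_mat U ** V"
  have W: "unitary_mat W" unfolding W_def using U V by (intro unitary_mat_mult unitary_mat_adjoint)
  define w where "w i j = (cmod (W $ i $ j))\<^sup>2" for i j
  have row: "(\<Sum>j\<in>UNIV. (cmod (X $ i $ j))\<^sup>2) = 1" if "unitary_mat X" for X :: "complex^'n^'n" and i
    using unitary_row_norm[OF that, of i] by (simp add: norm_vec_def L2_set_def)
  show thesis
  proof (rule that[of w])
    show "0 \<le> w i j" for i j by (simp add: w_def)
    show "(\<Sum>j\<in>UNIV. w i j) = 1" for i using row[OF W, of i] by (simp add: w_def)
    show "(\<Sum>i\<in>UNIV. w i j) = 1" for j using row[OF unitary_mat_adjoint[OF W], of j] by (simp add: w_def)
    show "diag_val U (V ** diag_mat d ** adjoint_mat V) i = (\<Sum>j\<in>UNIV. w i j * d $ j)" for d i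
    proof -
      have "adjoint_mat U ** (V ** diag_mat d ** adjoint_mat V) ** U = W ** diag_mat d ** adjoint_mat W"
        by (simp add: W_def adjoint_mat_mult matrix_mul_assoc)
      moreover have "(W ** diag_mat d ** adjoint_mat W) $ i $ i = (\<Sum>j\<in>UNIV. of_real (w i j * d $ j))"
      proof -
        have "W $ i $ j * of_real (d $ j) * cnj (W $ i $ j) = of_real (w i j * d $ j)" for j
          unfolding w_def of_real_mult complex_norm_square by (simp only: mult_ac)
        then show ?thesis
          by (simp add: matrix_matrix_mult_def[of "W ** diag_mat d"] diag_mat_mult_right del: of_real_mult)
      qed
      ultimately show ?thesis by (simp add: diag_val_def flip: of_real_sum)
    qed
  qed
qed

text \<open>Passing to the diagonal averages the eigenvalues with doubly stochastic weights, and \<open>xlnx\<close> is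
  convex.\<close>

lemma peierls_inequality:
  assumes U: "unitary_mat U" and s: "positive_mat s"
  shows "(\<Sum>i\<in>UNIV. xlnx (diag_val U s i)) \<le> neg_entropy s"
proof -
  obtain V d where V: "unitary_mat V" "s = V ** diag_mat d ** adjoint_mat V" and d: "\<And>i. 0 \<le> d $ i"
    using positive_diagonalization[OF s] by blast
  obtain w where w: "\<And>i j. 0 \<le> w i j" "\<And>i. (\<Sum>j\<in>UNIV. w i j) = 1" "\<And>j. (\<Sum>i\<in>UNIV. w i j) = 1"
    "\<And>d i. diag_val U (V ** diag_mat d ** adjoint_mat V) i = (\<Sum>j\<in>UNIV. w i j * d $ j)"
    using diag_val_weights[OF U V(1)] by blast
  have "xlnx (\<Sum>j\<in>UNIV. w i j *\<^sub>R d $ j) \<le> (\<Sum>j\<in>UNIV. w i j * xlnx (d $ j))" for i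
    by (rule convex_on_sum[OF _ _ convex_xlnx]) (use w d in auto)
  then have "(\<Sum>i\<in>UNIV. xlnx (diag_val U s i)) \<le> (\<Sum>i\<in>UNIV. \<Sum>j\<in>UNIV. w i j * xlnx (d $ j))"
    by (intro sum_mono) (simp add: V(2) w(4))
  also have "\<dots> = (\<Sum>j\<in>UNIV. \<Sum>i\<in>UNIV. w i j * xlnx (d $ j))"
    by (rule sum.swap)
  also have "\<dots> = (\<Sum>j\<in>UNIV. (\<Sum>i\<in>UNIV. w i j) * xlnx (d $ j))"
    by (simp only: sum_distrib_right)
  also have "\<dots> = neg_entropy s"
    by (simp add: w(3) V neg_entropy_diag_conj)
  finally show ?thesis .
qed

lemma positive_mat_kernel:
  assumes s: "positive_mat s" and v: "Re (cdot v (s *v v)) = 0"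
  shows "s *v v = 0"
proof -
  obtain V d where V: "unitary_mat V" "s = V ** diag_mat d ** adjoint_mat V" and d: "\<And>i. 0 \<le> d $ i"
    using positive_diagonalization[OF s] by blast
  have "(\<Sum>i\<in>UNIV. d $ i * (cmod ((adjoint_mat V *v v) $ i))\<^sup>2) = 0"
    using v unfolding V(2) diag_conj_form by simp
  then have "d $ i * (cmod ((adjoint_mat V *v v) $ i))\<^sup>2 = 0" for i
    using d by (subst (asm) sum_nonneg_eq_0_iff) auto
  then have "(\<chi> i. of_real (d $ i) * (adjoint_mat V *v v) $ i) = (0 :: complex^'a)"
    by (auto simp: vec_eq_iff)
  then show ?thesis
    unfolding V(2) diag_conj_vector by simp
qed

lemma range_subset_iff_diag_val:
  assumes s: "positive_mat s" and U: "unitary_mat U"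
  shows "range ((*v) s) \<subseteq> range ((*v) (U ** diag_mat d ** adjoint_mat U)) \<longleftrightarrow>
    (\<forall>i. d $ i = 0 \<longrightarrow> diag_val U s i = 0)" (is "_ \<subseteq> range ((*v) ?t) \<longleftrightarrow> _")
proof
  have column: "(adjoint_mat U *v v) $ i = cdot (column i U) v" for v i
    by (simp add: cdot_def matrix_vector_mult_def column_def)
  have adj: "cdot (s *v v) w = cdot v (s *v w)" for v w
    using cdot_mult_right[of v s w] positive_mat_hermitian[OF s] by simp
  show "\<forall>i. d $ i = 0 \<longrightarrow> diag_val U s i = 0" if sub: "range ((*v) s) \<subseteq> range ((*v) ?t)"
  proof (intro allI impI)
    fix i assume i: "d $ i = 0"
    obtain w where w: "s *v column i U = ?t *v w" using sub by blast
    have "cdot (column i U) (?t *v w) = (adjoint_mat U *v (?t *v w)) $ i" by (simp add: column)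
    also have "adjoint_mat U *v (?t *v w) = diag_mat d *v (adjoint_mat U *v w)"
      by (simp add: matrix_vector_mul_assoc matrix_mul_assoc unitary_matD[OF U])
    also have "\<dots> $ i = 0"
      using i unfolding matrix_vector_mult_def by (auto simp: diag_mat_def intro!: sum.neutral)
    finally show "diag_val U s i = 0" by (simp add: diag_val_cdot w)
  qed
  show "range ((*v) s) \<subseteq> range ((*v) ?t)" if zero: "\<forall>i. d $ i = 0 \<longrightarrow> diag_val U s i = 0"
  proof clarify
    fix v
    define y where "y = (\<chi> i. (adjoint_mat U *v (s *v v)) $ i / of_real (d $ i))"
    have "of_real (d $ i) * y $ i = (adjoint_mat U *v (s *v v)) $ i" for i
    proof (cases "d $ i = 0")
      case True
      then have "s *v column i U = 0"
        using zero by (intro positive_mat_kernel[OF s]) (simp flip: diag_val_cdot)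
      then have "(adjoint_mat U *v (s *v v)) $ i = 0"
        unfolding column adj[symmetric] by (simp add: cdot_def)
      then show ?thesis using True by simp
    qed (simp add: y_def)
    moreover have "adjoint_mat U *v (U *v y) = y"
      by (simp add: matrix_vector_mul_assoc unitary_matD[OF U])
    ultimately have "?t *v (U *v y) = U *v (adjoint_mat U *v (s *v v))"
      unfolding diag_conj_vector by (simp add: vec_lambda_eta)
    also have "\<dots> = s *v v"
      by (simp add: matrix_vector_mul_assoc unitary_matD[OF U] matrix_mul_assoc)
    finally show "s *v v \<in> range ((*v) ?t)" by (metis rangeI)
  qed
qed

section \<open>The directional derivative of the quantum entropy\<close>

lemma sum_diag_val_density: "unitary_mat U \<Longrightarrow> s \<in> density_matrices \<Longrightarrow> (\<Sum>i\<in>UNIV. diag_val U s i) = 1"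
  by (simp add: sum_diag_val density_matrices_def)

lemma diag_val_nonneg: "s \<in> density_matrices \<Longrightarrow> 0 \<le> diag_val U s i"
  unfolding diag_val_cdot by (rule positive_mat_nonneg(1)) (simp add: density_matrices_def)

lemma diag_val_affine: "diag_val U (u *\<^sub>R X + v *\<^sub>R Y) i = u * diag_val U X i + v * diag_val U Y i"
  unfolding diag_val_def conj_affine by simp

lemma tendsto_diag_val:
  "(U \<longlongrightarrow> U0) F \<Longrightarrow> (X \<longlongrightarrow> X0) F \<Longrightarrow> ((\<lambda>n. diag_val (U n) (X n) i) \<longlongrightarrow> diag_val U0 X0 i) F"
  unfolding diag_val_def by (intro tendsto_Re tendsto_conj_nth)

lemma prob_vector_le_1: "p \<in> prob_vectors \<Longrightarrow> p $ i \<le> 1"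
  using sum_nonneg_leq_bound[of UNIV "\<lambda>i. p $ i" 1 i] by (auto simp: prob_vectors_def)

text \<open>The rate \<open>2 * sqrt x\<close> comes from \<open>ln (1 / y) \<le> 1 / y - 1\<close> at \<open>y = sqrt x\<close>.\<close>

lemma tendsto_xlnx_0: "\<rho> \<longlonglongrightarrow> 0 \<Longrightarrow> (\<And>n. 0 \<le> \<rho> n) \<Longrightarrow> (\<lambda>n. xlnx (\<rho> n)) \<longlonglongrightarrow> 0"
proof -
  assume \<rho>: "\<rho> \<longlonglongrightarrow> 0" "\<And>n. 0 \<le> \<rho> n"
  have "\<bar>xlnx x\<bar> \<le> 2 * sqrt x" if "0 \<le> x" "x \<le> 1" for x
  proof (cases "x = 0")
    case False
    then have x: "0 < x" using that by simp
    define y where "y = sqrt x"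
    have y: "0 < y" "x = y * y" using x by (auto simp: y_def)
    have "- ln y \<le> inverse y - 1"
      using ln_le_minus_one[of "inverse y"] y(1) by (simp add: ln_inverse)
    then have "y * (- ln y) \<le> y * (inverse y - 1)"
      using y(1) by (intro mult_left_mono) auto
    also have "\<dots> \<le> 1" using y(1) by (simp add: right_diff_distrib)
    finally have "2 * y * (y * (- ln y)) \<le> 2 * y * 1"
      using y(1) by (intro mult_left_mono) auto
    moreover have "xlnx x = - (2 * y * (y * (- ln y)))"
      using y by (simp add: xlnx_def ln_mult)
    ultimately have "- xlnx x \<le> 2 * sqrt x" by (simp add: y_def)
    moreover have "xlnx x \<le> 0" using x that by (simp add: xlnx_def mult_nonneg_nonpos)
    ultimately show ?thesis by simp
  qed simp
  note bound = this
  have "eventually (\<lambda>n. \<rho> n < 1) sequentially"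
    using order_tendstoD(2)[OF \<rho>(1), of 1] by simp
  then have "eventually (\<lambda>n. norm (xlnx (\<rho> n)) \<le> 2 * sqrt (\<rho> n)) sequentially"
  proof eventually_elim
    case (elim n)
    then show ?case using bound[OF \<rho>(2), of n] by simp
  qed
  moreover have "(\<lambda>n. 2 * sqrt (\<rho> n)) \<longlonglongrightarrow> 2 * sqrt 0"
    by (intro tendsto_intros \<rho>)
  ultimately show ?thesis by (auto intro: Lim_null_comparison)
qed

text \<open>In an eigenbasis of \<open>t\<close>, the inequality of Peierls for the state \<open>(1 - u) t + u s\<close>, followed by
  tangents of \<open>xlnx\<close> at the eigenvalues of \<open>t\<close>. The constants \<open>1\<close> in the slopes \<open>ln + 1\<close> of the
  tangents cancel because both states have trace one.\<close>

lemma entropy_slope_lower: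
  assumes s: "s \<in> density_matrices" and U: "unitary_mat U" and p: "p \<in> prob_vectors"
    and t: "t = U ** diag_mat p ** adjoint_mat U"
    and supp: "\<And>i. p $ i = 0 \<Longrightarrow> diag_val U s i = 0" and u: "0 < u" "u \<le> 1"
  shows "(\<Sum>i\<in>UNIV. (diag_val U s i - p $ i) * ln (p $ i)) \<le> slope neg_entropy s t u"
proof -
  have td: "t \<in> density_matrices" using diag_conj_density_iff[OF U] p t by simp
  define x where "x = (1 - u) *\<^sub>R t + u *\<^sub>R s"
  have x: "x \<in> density_matrices"
    unfolding x_def using convex_density_matrices td s u by (intro convexD) auto
  have dx: "diag_val U x i = p $ i + u * (diag_val U s i - p $ i)" for i
    unfolding x_def diag_val_affine by (simp add: t diag_val_diag_conj[OF U] algebra_simps)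
  have "xlnx (p $ i) + u * ((diag_val U s i - p $ i) * ln (p $ i) + (diag_val U s i - p $ i)) \<le> xlnx (diag_val U x i)" for i
  proof (cases "p $ i = 0")
    case True
    then show ?thesis using supp[of i] by (simp add: dx)
  next
    case False
    then have "0 < p $ i" using prob_vectorsD(1)[OF p, of i] by simp
    from xlnx_tangent[OF diag_val_nonneg[OF x] this, of U i]
    show ?thesis by (simp add: dx algebra_simps)
  qed
  then have "(\<Sum>i\<in>UNIV. xlnx (p $ i) + u * ((diag_val U s i - p $ i) * ln (p $ i) + (diag_val U s i - p $ i)))
      \<le> (\<Sum>i\<in>UNIV. xlnx (diag_val U x i))"
    by (intro sum_mono) auto
  also have "\<dots> \<le> neg_entropy x"
    using x by (intro peierls_inequality U) (simp add: density_matrices_def)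
  finally have "neg_entropy t + u * (\<Sum>i\<in>UNIV. (diag_val U s i - p $ i) * ln (p $ i)) \<le> neg_entropy x"
    using sum_diag_val_density[OF U s] prob_vectorsD(2)[OF p]
    by (simp add: sum.distrib sum_distrib_left[symmetric] sum_subtractf t neg_entropy_diag_conj[OF U])
  then show ?thesis
    using u by (simp add: slope_def x_def field_simps)
qed

text \<open>In an eigenbasis of \<open>(1 - u) t + u s\<close>, the inequality of Peierls for \<open>t\<close>, with tangents of \<open>xlnx\<close>
  at the eigenvalues of \<open>(1 - u) t + u s\<close>.\<close>

lemma entropy_slope_upper:
  assumes s: "s \<in> density_matrices" and t: "t \<in> density_matrices" and u: "0 < u" "u < 1"
    and V: "unitary_mat V" and x: "(1 - u) *\<^sub>R t + u *\<^sub>R s = V ** diag_mat r ** adjoint_mat V"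
  shows "slope neg_entropy s t u \<le> (\<Sum>j\<in>UNIV. (diag_val V s j - diag_val V t j) * ln (r $ j))"
proof -
  have r: "r $ j = diag_val V t j + u * (diag_val V s j - diag_val V t j)" for j
    using diag_val_diag_conj[OF V, of r j] unfolding x[symmetric] diag_val_affine by (simp add: algebra_simps)
  note s0 = diag_val_nonneg[OF s, of V] and t0 = diag_val_nonneg[OF t, of V]
  have "xlnx (r $ j) \<le> xlnx (diag_val V t j) +
      u * ((diag_val V s j - diag_val V t j) * ln (r $ j) + (diag_val V s j - diag_val V t j))" for j
  proof (cases "r $ j = 0")
    case True
    have "r $ j = (1 - u) * diag_val V t j + u * diag_val V s j" by (simp add: r algebra_simps)
    then have "diag_val V t j = 0" "diag_val V s j = 0"
      using True s0[of j] t0[of j] u by (auto simp: add_nonneg_eq_0_iff)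
    then show ?thesis by (simp add: True)
  next
    case False
    have "r $ j = (1 - u) * diag_val V t j + u * diag_val V s j" by (simp add: r algebra_simps)
    then have "0 \<le> r $ j" using s0[of j] t0[of j] u by simp
    with False have "0 < r $ j" by simp
    from xlnx_tangent[OF t0 this, of j]
    have "xlnx (r $ j) + (ln (r $ j) + 1) * (diag_val V t j - r $ j) \<le> xlnx (diag_val V t j)" .
    moreover have "diag_val V t j - r $ j = - (u * (diag_val V s j - diag_val V t j))" by (simp add: r)
    ultimately show ?thesis by (simp add: algebra_simps)
  qed
  then have "(\<Sum>j\<in>UNIV. xlnx (r $ j)) \<le> (\<Sum>j\<in>UNIV. xlnx (diag_val V t j) +
      u * ((diag_val V s j - diag_val V t j) * ln (r $ j) + (diag_val V s j - diag_val V t j)))"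
    by (intro sum_mono) auto
  also have "\<dots> = (\<Sum>j\<in>UNIV. xlnx (diag_val V t j)) + u * (\<Sum>j\<in>UNIV. (diag_val V s j - diag_val V t j) * ln (r $ j))"
    using sum_diag_val_density[OF V s] sum_diag_val_density[OF V t]
    by (simp add: sum.distrib sum_distrib_left[symmetric] sum_subtractf)
  also have "\<dots> \<le> neg_entropy t + u * (\<Sum>j\<in>UNIV. (diag_val V s j - diag_val V t j) * ln (r $ j))"
    using t by (intro add_right_mono peierls_inequality V) (simp add: density_matrices_def)
  finally have *: "(\<Sum>j\<in>UNIV. xlnx (r $ j)) \<le>
      neg_entropy t + u * (\<Sum>j\<in>UNIV. (diag_val V s j - diag_val V t j) * ln (r $ j))" .
  have "(a - b) / u \<le> c" if "a \<le> b + u * c" for a b c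
    using that u by (simp add: field_simps)
  from this[OF *] show ?thesis
    unfolding slope_def x neg_entropy_diag_conj[OF V] .
qed

text \<open>By compactness the eigenbases of the states \<open>x n\<close> converge along a subsequence, and the limit is an
  eigenbasis of \<open>t\<close>. In the upper bound the terms with a positive limiting eigenvalue converge. In the
  others the eigenvalue \<open>R\<close> tends to \<open>0\<close>: the part \<open>\<sigma> ln R\<close> is dominated by \<open>R ln R\<close> and vanishes,
  and \<open>\<nu> ln R\<close> is nonpositive, tending to \<open>-\<infinity>\<close> as soon as \<open>\<nu>\<close> has a positive limit. Such a
  limit exists exactly when the support condition fails.\<close>

lemma quantum_entropy_slope:
  fixes s t :: "complex^'n^'n"
  assumes s: "s \<in> density_matrices" and t: "t \<in> density_matrices"
  obtains r where "strict_mono r" "(\<lambda>n. ereal (slope neg_entropy s t (harmonic_times (r n)))) \<longlonglongrightarrow>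
    (if range ((*v) s) \<subseteq> range ((*v) t) then ereal (Re (trace (s ** hermitian_fun ln t)) - neg_entropy t) else - \<infinity>)"
proof -
  define x where "x n = (1 - harmonic_times n) *\<^sub>R t + harmonic_times n *\<^sub>R s" for n
  have "x n \<in> density_matrices" for n
    unfolding x_def using convex_density_matrices s t harmonic_times_bounds(1,3)[of n] by (intro convexD) auto
  then have "\<forall>n. \<exists>U p. unitary_mat U \<and> x n = U ** diag_mat p ** adjoint_mat U \<and> p \<in> prob_vectors"
    by (metis density_diagonalization)
  then obtain V \<rho> where V: "\<And>n. unitary_mat (V n)" and xV: "\<And>n. x n = V n ** diag_mat (\<rho> n) ** adjoint_mat (V n)"
    and \<rho>: "\<And>n. \<rho> n \<in> prob_vectors"
    by metis
  have "\<forall>n. V n \<in> unitary_set" using V by (simp add: unitary_set_def)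
  then obtain U r where "U \<in> unitary_set" and r: "strict_mono r" and VU: "(V \<circ> r) \<longlonglongrightarrow> U"
    using compact_unitary unfolding compact_def by metis
  then have U: "unitary_mat U" by (simp add: unitary_set_def)
  define \<tau> where "\<tau> n = harmonic_times (r n)" for n
  have \<tau>: "0 < \<tau> n" "\<tau> n < 1" "\<tau> n \<le> 1" "\<tau> n \<le> 1/2" for n
    using harmonic_times_bounds(1-3)[of "r n"] by (auto simp: \<tau>_def) (simp add: harmonic_times_def field_simps)
  have \<tau>_lim: "\<tau> \<longlonglongrightarrow> 0"
    using LIMSEQ_subseq_LIMSEQ[OF harmonic_times_bounds(4) r] by (simp add: \<tau>_def[abs_def] o_def)
  define \<nu> \<sigma> where "\<nu> j n = diag_val (V (r n)) s j" and "\<sigma> j n = diag_val (V (r n)) t j" for j n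
  define R where "R j n = \<rho> (r n) $ j" for j n
  define \<mu> where "\<mu> j = diag_val U s j" for j
  define p where "p = (\<chi> j. diag_val U t j)"
  have x_lim: "(\<lambda>n. x (r n)) \<longlonglongrightarrow> t"
  proof -
    have "(\<lambda>n. (1 - \<tau> n) *\<^sub>R t + \<tau> n *\<^sub>R s) \<longlonglongrightarrow> (1 - 0) *\<^sub>R t + 0 *\<^sub>R s"
      by (intro tendsto_intros \<tau>_lim)
    then show ?thesis by (simp add: x_def \<tau>_def)
  qed
  have VU': "(\<lambda>n. V (r n)) \<longlonglongrightarrow> U" using VU by (simp add: o_def)
  have \<nu>_lim: "\<nu> j \<longlonglongrightarrow> \<mu> j" for j
    unfolding \<nu>_def \<mu>_def by (intro tendsto_diag_val VU' tendsto_const)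
  have \<sigma>_lim: "\<sigma> j \<longlonglongrightarrow> p $ j" for j
    unfolding \<sigma>_def p_def vec_lambda_beta by (intro tendsto_diag_val VU' tendsto_const)
  have R_eq: "R j n = (1 - \<tau> n) * \<sigma> j n + \<tau> n * \<nu> j n" for j n
  proof -
    have "R j n = diag_val (V (r n)) (x (r n)) j"
      unfolding R_def xV[of "r n"] diag_val_diag_conj[OF V] ..
    then show ?thesis unfolding x_def diag_val_affine by (simp add: \<nu>_def \<sigma>_def \<tau>_def)
  qed
  have R_lim: "R j \<longlonglongrightarrow> p $ j" for j
  proof -
    have "(\<lambda>n. (1 - \<tau> n) * \<sigma> j n + \<tau> n * \<nu> j n) \<longlonglongrightarrow> (1 - 0) * p $ j + 0 * \<mu> j"
      by (intro tendsto_intros \<tau>_lim \<nu>_lim \<sigma>_lim)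
    then show ?thesis by (simp add: R_eq[abs_def])
  qed
  have R0: "0 \<le> R j n" and R1: "R j n \<le> 1" for j n
    using prob_vectorsD(1)[OF \<rho>] prob_vector_le_1[OF \<rho>] by (auto simp: R_def)
  have \<nu>0: "0 \<le> \<nu> j n" and \<sigma>0: "0 \<le> \<sigma> j n" for j n
    by (auto simp: \<nu>_def \<sigma>_def diag_val_nonneg s t)
  have t_eq: "t = U ** diag_mat p ** adjoint_mat U"
  proof -
    have "(adjoint_mat U ** t ** U) $ i $ j = diag_mat p $ i $ j" for i j
    proof (rule LIMSEQ_unique)
      show "(\<lambda>n. (adjoint_mat (V (r n)) ** x (r n) ** V (r n)) $ i $ j) \<longlonglongrightarrow> (adjoint_mat U ** t ** U) $ i $ j"
        by (intro tendsto_conj_nth VU' x_lim)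
      have "(adjoint_mat (V (r n)) ** x (r n) ** V (r n)) $ i $ j = (if i = j then complex_of_real (R i n) else 0)" for n
        unfolding xV[of "r n"] unitary_conj_cancel[OF V] by (simp add: diag_mat_def R_def)
      then show "(\<lambda>n. (adjoint_mat (V (r n)) ** x (r n) ** V (r n)) $ i $ j) \<longlonglongrightarrow> diag_mat p $ i $ j"
        using R_lim[of i] by (auto simp: diag_mat_def intro: tendsto_of_real)
    qed
    then have "adjoint_mat U ** t ** U = diag_mat p" by (simp add: vec_eq_iff)
    then show ?thesis using unitary_conj_cancel(2)[OF U, of t] by simp
  qed
  have p: "p \<in> prob_vectors" using t diag_conj_density_iff[OF U] t_eq by simp
  \<comment> \<open>The parts of the upper bound that converge.\<close>
  define b where "b j n = (if p $ j = 0 then 2 * \<bar>xlnx (R j n)\<bar> else (\<nu> j n - \<sigma> j n) * ln (R j n))" for j n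
  have b_lim: "b j \<longlonglongrightarrow> (\<mu> j - p $ j) * ln (p $ j)" for j
  proof (cases "p $ j = 0")
    case True
    then have "(\<lambda>n. 2 * \<bar>xlnx (R j n)\<bar>) \<longlonglongrightarrow> 2 * \<bar>0\<bar>"
      using R_lim[of j] by (intro tendsto_intros tendsto_xlnx_0 R0) simp
    then show ?thesis by (simp add: b_def[abs_def] True)
  next
    case False
    then have "(\<lambda>n. (\<nu> j n - \<sigma> j n) * ln (R j n)) \<longlonglongrightarrow> (\<mu> j - p $ j) * ln (p $ j)"
      by (intro tendsto_intros \<nu>_lim \<sigma>_lim R_lim)
    then show ?thesis by (simp add: b_def[abs_def] False)
  qed
  have bound: "(\<nu> j n - \<sigma> j n) * ln (R j n) \<le> b j n + (if p $ j = 0 then \<nu> j n * ln (R j n) else 0)" for j n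
  proof (cases "p $ j = 0")
    case True
    have "(1/2) * \<sigma> j n \<le> (1 - \<tau> n) * \<sigma> j n"
      using \<tau>(4)[of n] \<sigma>0 by (intro mult_right_mono) auto
    moreover have "0 \<le> \<tau> n * \<nu> j n" using \<nu>0[of j n] \<tau>(1)[of n] by simp
    ultimately have *: "\<sigma> j n \<le> 2 * R j n" by (simp add: R_eq)
    have "ln (R j n) \<le> 0"
      using R0[of j n] R1[of j n] by (cases "R j n = 0") auto
    with * have "2 * R j n * ln (R j n) \<le> \<sigma> j n * ln (R j n)"
      by (rule mult_right_mono_neg)
    then have "- (\<sigma> j n * ln (R j n)) \<le> - (2 * R j n * ln (R j n))"
      by simp
    also have "\<dots> \<le> 2 * \<bar>xlnx (R j n)\<bar>" by (simp add: xlnx_def)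
    finally show ?thesis by (simp add: b_def True algebra_simps)
  qed (simp add: b_def)
  have upper: "slope neg_entropy s t (\<tau> n) \<le> (\<Sum>j\<in>UNIV. b j n) + (\<Sum>j\<in>UNIV. if p $ j = 0 then \<nu> j n * ln (R j n) else 0)" for n
  proof -
    have "slope neg_entropy s t (\<tau> n) \<le> (\<Sum>j\<in>UNIV. (\<nu> j n - \<sigma> j n) * ln (R j n))"
      unfolding \<nu>_def \<sigma>_def R_def
      by (rule entropy_slope_upper[OF s t \<tau>(1,2) V]) (simp add: xV[symmetric] x_def \<tau>_def)
    also have "\<dots> \<le> (\<Sum>j\<in>UNIV. b j n + (if p $ j = 0 then \<nu> j n * ln (R j n) else 0))"
      by (intro sum_mono bound)
    finally show ?thesis by (simp add: sum.distrib)
  qed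
  have nonpos: "(if p $ j = 0 then \<nu> j n * ln (R j n) else 0) \<le> 0" for j n
    using \<nu>0[of j n] R0[of j n] R1[of j n] by (cases "R j n = 0") (auto intro!: mult_nonneg_nonpos)
  have sum_b: "(\<lambda>n. \<Sum>j\<in>UNIV. b j n) \<longlonglongrightarrow> (\<Sum>j\<in>UNIV. (\<mu> j - p $ j) * ln (p $ j))"
    by (intro tendsto_sum b_lim)
  have supp: "range ((*v) s) \<subseteq> range ((*v) t) \<longleftrightarrow> (\<forall>i. p $ i = 0 \<longrightarrow> \<mu> i = 0)"
    unfolding t_eq \<mu>_def using s by (intro range_subset_iff_diag_val U) (simp add: density_matrices_def)
  have target: "Re (trace (s ** hermitian_fun ln t)) - neg_entropy t = (\<Sum>j\<in>UNIV. (\<mu> j - p $ j) * ln (p $ j))"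
    unfolding t_eq trace_mult_hermitian_fun[OF U] neg_entropy_diag_conj[OF U]
    by (simp add: \<mu>_def xlnx_def sum_subtractf left_diff_distrib)
  have "(\<lambda>n. ereal (slope neg_entropy s t (\<tau> n))) \<longlonglongrightarrow>
    (if range ((*v) s) \<subseteq> range ((*v) t) then ereal (Re (trace (s ** hermitian_fun ln t)) - neg_entropy t) else - \<infinity>)"
  proof (cases "range ((*v) s) \<subseteq> range ((*v) t)")
    case True
    have "(\<lambda>n. slope neg_entropy s t (\<tau> n)) \<longlonglongrightarrow> (\<Sum>j\<in>UNIV. (\<mu> j - p $ j) * ln (p $ j))"
    proof (rule tendsto_sandwich[OF _ _ tendsto_const sum_b]; intro always_eventually allI)
      fix n
      show "(\<Sum>j\<in>UNIV. (\<mu> j - p $ j) * ln (p $ j)) \<le> slope neg_entropy s t (\<tau> n)"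
        unfolding \<mu>_def using True supp \<tau>[of n]
        by (intro entropy_slope_lower[OF s U p t_eq]) (auto simp: \<mu>_def)
      show "slope neg_entropy s t (\<tau> n) \<le> (\<Sum>j\<in>UNIV. b j n)"
      proof -
        have "(\<Sum>j\<in>UNIV. if p $ j = 0 then \<nu> j n * ln (R j n) else 0) \<le> 0"
          by (intro sum_nonpos nonpos)
        then show ?thesis using upper[of n] by linarith
      qed
    qed
    then show ?thesis using True by (simp add: target)
  next
    case False
    then obtain i where i: "p $ i = 0" "\<mu> i \<noteq> 0" using supp by auto
    then have "0 < \<mu> i" using diag_val_nonneg[OF s, of U i] by (simp add: \<mu>_def)
    have "eventually (\<lambda>n. 0 < \<nu> i n) sequentially"
      using \<nu>_lim[of i] \<open>0 < \<mu> i\<close> by (rule order_tendstoD)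
    then have "eventually (\<lambda>n. 0 < R i n) sequentially"
    proof eventually_elim
      case (elim n)
      have "0 < \<tau> n * \<nu> i n" using elim \<tau>(1)[of n] by simp
      moreover have "0 \<le> (1 - \<tau> n) * \<sigma> i n" using \<sigma>0[of i n] \<tau>(3)[of n] by simp
      ultimately show ?case by (simp add: R_eq)
    qed
    then have "filterlim (R i) (at_right 0) sequentially"
      using R_lim[of i] i(1) by (intro tendsto_imp_filterlim_at_right) auto
    then have "filterlim (\<lambda>n. ln (R i n)) at_bot sequentially"
      by (rule filterlim_compose[OF ln_at_0])
    then have "filterlim (\<lambda>n. \<nu> i n * ln (R i n)) at_bot sequentially"
      by (rule filterlim_tendsto_pos_mult_at_bot[OF \<nu>_lim \<open>0 < \<mu> i\<close>])
    then have lim: "filterlim (\<lambda>n. (\<Sum>j\<in>UNIV. b j n) + \<nu> i n * ln (R i n)) at_bot sequentially"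
      using filterlim_tendsto_add_at_bot_iff[OF sum_b] by simp
    have "slope neg_entropy s t (\<tau> n) \<le> (\<Sum>j\<in>UNIV. b j n) + \<nu> i n * ln (R i n)" for n
    proof -
      have "(\<Sum>j\<in>UNIV. if p $ j = 0 then \<nu> j n * ln (R j n) else 0) \<le> \<nu> i n * ln (R i n)"
      proof -
        have "(\<Sum>j\<in>UNIV - {i}. if p $ j = 0 then \<nu> j n * ln (R j n) else 0) \<le> 0"
          by (intro sum_nonpos nonpos)
        then show ?thesis
          unfolding sum.remove[OF finite UNIV_I[of i]] using i(1) by simp
      qed
      then show ?thesis using upper[of n] by linarith
    qed
    then have "filterlim (\<lambda>n. slope neg_entropy s t (\<tau> n)) at_bot sequentially"
      using filterlim_at_bot_mono[OF lim] by simp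
    then have "(\<lambda>n. ereal (slope neg_entropy s t (\<tau> n))) \<longlonglongrightarrow> - \<infinity>"
      unfolding tendsto_MInfty filterlim_at_bot_dense by simp
    then show ?thesis using False by simp
  qed
  then show thesis using that[OF r] by (simp add: \<tau>_def)
qed

lemma quantum_divergence_eq:
  assumes "s \<in> density_matrices" "t \<in> density_matrices"
  shows "ereal (neg_entropy s - neg_entropy t) -
      (if range ((*v) s) \<subseteq> range ((*v) t) then ereal (Re (trace (s ** hermitian_fun ln t)) - neg_entropy t) else - \<infinity>)
    = quantum_divergence s t"
proof -
  have "trace (s ** (hermitian_fun ln s - hermitian_fun ln t)) =
      trace (s ** hermitian_fun ln s) - trace (s ** hermitian_fun ln t)"
    by (simp add: trace_def matrix_matrix_mult_def right_diff_distrib sum_subtractf)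
  then show ?thesis
    by (simp add: quantum_divergence_def neg_entropy_def von_neumann_entropy_def)
qed

section \<open>From commuting states to all states\<close>

definition restrict_actions :: "complex^'n^'n \<Rightarrow> (complex^'n^'n \<Rightarrow> real measure) set \<Rightarrow> (real^'n \<Rightarrow> real measure) set" where
  "restrict_actions U B = (\<lambda>a p. a (U ** diag_mat p ** adjoint_mat U)) ` B"

lemma opt_restrict: "opt (restrict_actions U B) p = opt B (U ** diag_mat p ** adjoint_mat U)"
  unfolding restrict_actions_def by (rule opt_pullback)

lemma regret_restrict: "regret (restrict_actions U B) p q =
    regret B (U ** diag_mat p ** adjoint_mat U) (U ** diag_mat q ** adjoint_mat U)"
  unfolding restrict_actions_def by (rule regret_pullback)

lemma action_set_restrict:
  assumes "action_set density_matrices B" and U: "unitary_mat U"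
  shows "action_set prob_vectors (restrict_actions U B)"
  unfolding restrict_actions_def using assms(1) convex_prob_vectors
  by (rule action_set_pullback) (auto simp: diag_conj_density_iff[OF U] diag_conj_affine)

lemma regret_unitary_invariant:
  assumes suff: "sufficiency_property density_matrices quantum_channel B" and U: "unitary_mat U"
    and st: "s \<in> density_matrices" "t \<in> density_matrices"
  shows "regret B (U ** s ** adjoint_mat U) (U ** t ** adjoint_mat U) = regret B s t"
proof -
  have "sufficient_for quantum_channel (\<lambda>X. U ** X ** adjoint_mat U) {s, t}"
    unfolding sufficient_for_def
    using quantum_channel_conj[OF unitary_mat_adjoint[OF U]] unitary_conj_cancel(1)[OF U]
    by (intro exI[of _ "\<lambda>X. adjoint_mat U ** X ** adjoint_mat (adjoint_mat U)"]) simp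
  then show ?thesis
    using suff quantum_channel_conj[OF U] st unfolding sufficiency_property_def by blast
qed

text \<open>A stochastic map that recovers \<open>p\<close> and \<open>q\<close> lifts to a channel that recovers the corresponding
  diagonal matrices.\<close>

lemma sufficiency_restrict:
  fixes B :: "(complex^'n^'n \<Rightarrow> real measure) set"
  assumes suff: "sufficiency_property density_matrices quantum_channel B"
  shows "sufficiency_property prob_vectors stochastic_map (restrict_actions (mat 1) B)"
  unfolding sufficiency_property_def
proof (intro allI impI ballI)
  fix \<Phi> :: "real^'n \<Rightarrow> real^'n" and p q
  assume \<Phi>: "stochastic_map \<Phi>" and pq: "p \<in> prob_vectors" "q \<in> prob_vectors"
    and "sufficient_for stochastic_map \<Phi> {p, q}"
  then obtain \<Psi> where \<Psi>: "stochastic_map \<Psi>" "\<Psi> (\<Phi> p) = p" "\<Psi> (\<Phi> q) = q"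
    by (auto simp: sufficient_for_def)
  have lift: "\<exists>\<Gamma>. quantum_channel \<Gamma> \<and> (\<forall>p. \<Gamma> (diag_mat p) = diag_mat (f p))" if f: "stochastic_map f" for f :: "real^'n \<Rightarrow> real^'n"
    using f unfolding stochastic_map_def by (metis diagonal_channel_diag_mat quantum_channel_diagonal)
  obtain \<Gamma> where \<Gamma>: "quantum_channel \<Gamma>" "\<And>p. \<Gamma> (diag_mat p) = diag_mat (\<Phi> p)" using lift[OF \<Phi>] by blast
  obtain \<Delta> where \<Delta>: "quantum_channel \<Delta>" "\<And>p. \<Delta> (diag_mat p) = diag_mat (\<Psi> p)" using lift[OF \<Psi>(1)] by blast
  have "sufficient_for quantum_channel \<Gamma> {diag_mat p, diag_mat q}"
    unfolding sufficient_for_def using \<Delta> \<Gamma>(2) \<Psi>(2,3) by (intro exI[of _ \<Delta>]) simp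
  moreover have "diag_mat r \<in> density_matrices" if "r \<in> prob_vectors" for r :: "real^'n"
    using diag_conj_density_iff[OF unitary_mat_1, of r] that by simp
  ultimately have "regret B (\<Gamma> (diag_mat p)) (\<Gamma> (diag_mat q)) = regret B (diag_mat p) (diag_mat q)"
    using suff \<Gamma>(1) pq unfolding sufficiency_property_def by blast
  then show "regret (restrict_actions (mat 1) B) (\<Phi> p) (\<Phi> q) = regret (restrict_actions (mat 1) B) p q"
    by (simp add: regret_restrict \<Gamma>(2))
qed

lemma regret_restrict_eq:
  assumes "sufficiency_property density_matrices quantum_channel B" "unitary_mat U"
    and "p \<in> prob_vectors" "q \<in> prob_vectors"
  shows "regret (restrict_actions U B) p q = regret (restrict_actions (mat 1) B) p q"
proof -
  have "diag_mat r \<in> density_matrices" if "r \<in> prob_vectors" for r :: "real^'a"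
    using diag_conj_density_iff[OF unitary_mat_1, of r] that by simp
  then show ?thesis
    using regret_unitary_invariant[OF assms(1,2), of "diag_mat p" "diag_mat q"] assms(3,4)
    by (simp add: regret_restrict)
qed

lemma sufficiency_restrict_unitary:
  assumes suff: "sufficiency_property density_matrices quantum_channel B" and U: "unitary_mat U"
  shows "sufficiency_property prob_vectors stochastic_map (restrict_actions U B)"
  using sufficiency_restrict[OF suff] regret_restrict_eq[OF suff U]
  unfolding sufficiency_property_def by (simp add: stochastic_map_prob)

text \<open>A pair of states with finite nonzero divergence, used to compare the factors of two regrets.\<close>

lemma classical_divergence_vertex_edge:
  assumes "a \<noteq> b"
  shows "classical_divergence (axis a 1) (edge a b (1/2)) = ereal (ln 2)"
proof -
  have "(\<Sum>i\<in>UNIV. axis a 1 $ i * ln (axis a 1 $ i / edge a b (1/2) $ i)) = (\<Sum>i\<in>UNIV. if i = a then ln 2 else (0::real))"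
    using assms by (intro sum.cong) (auto simp: axis_def edge_def)
  moreover have "{i. axis a (1::real) $ i \<noteq> 0} \<subseteq> {i. edge a b (1/2) $ i \<noteq> 0}"
    using assms by (auto simp: axis_def edge_def)
  ultimately show ?thesis by (simp add: classical_divergence_def)
qed

theorem value_on_commuting_states:
  fixes B :: "(complex^'n^'n \<Rightarrow> real measure) set"
  assumes card: "3 \<le> CARD('n)" and B: "action_set density_matrices B"
    and suff: "sufficiency_property density_matrices quantum_channel B"
  obtains \<kappa> l where "0 \<le> \<kappa>" "\<And>U. unitary_mat U \<Longrightarrow> affine_on prob_vectors (l U)"
    "\<And>U p. unitary_mat U \<Longrightarrow> p \<in> prob_vectors \<Longrightarrow>
      opt B (U ** diag_mat p ** adjoint_mat U) = \<kappa> * (\<Sum>k\<in>UNIV. xlnx (p $ k)) + l U p"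
proof -
  define Q where "Q U k l \<longleftrightarrow> affine_on prob_vectors l \<and>
    (\<forall>p\<in>prob_vectors. opt B (U ** diag_mat p ** adjoint_mat U) = k * (\<Sum>k\<in>UNIV. xlnx (p $ k)) + l p)"
    for U :: "complex^'n^'n" and k l
  define D where "D k \<longleftrightarrow> (\<forall>p\<in>prob_vectors. \<forall>q\<in>prob_vectors.
    regret (restrict_actions (mat 1) B) p q = ereal k * classical_divergence p q)" for k
  have restricted: "\<exists>k l. 0 \<le> k \<and> Q U k l \<and> D k" if U: "unitary_mat U" for U
  proof -
    obtain k l where "0 \<le> k" "affine_on prob_vectors l"
      "\<And>p. p \<in> prob_vectors \<Longrightarrow> opt (restrict_actions U B) p = k * (\<Sum>k\<in>UNIV. xlnx (p $ k)) + l p"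
      "\<And>p q. p \<in> prob_vectors \<Longrightarrow> q \<in> prob_vectors \<Longrightarrow>
        regret (restrict_actions U B) p q = ereal k * classical_divergence p q"
      using classical_characterization[OF card action_set_restrict[OF B U] sufficiency_restrict_unitary[OF suff U]]
      by blast
    then show ?thesis
      by (intro exI[of _ k] exI[of _ l]) (simp add: opt_restrict regret_restrict_eq[OF suff U] Q_def D_def)
  qed
  have "\<exists>a b :: 'n. a \<noteq> b"
  proof (rule ccontr)
    assume "\<not> ?thesis"
    then have "(UNIV :: 'n set) \<subseteq> {undefined}" by auto
    then have "CARD('n) \<le> card {undefined :: 'n}" by (intro card_mono) auto
    then show False using card by simp
  qed
  then obtain a b :: 'n where ab: "a \<noteq> b" by blast
  have D_unique: "k = k'" if "D k" "D k'" for k k'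
  proof -
    have "ereal k * ereal (ln 2) = ereal k' * ereal (ln 2)"
    proof -
      have "edge a b (1/2) \<in> prob_vectors" by (rule edge_prob) auto
      then have "regret (restrict_actions (mat 1) B) (axis a 1) (edge a b (1/2)) = ereal k * ereal (ln 2)"
        "regret (restrict_actions (mat 1) B) (axis a 1) (edge a b (1/2)) = ereal k' * ereal (ln 2)"
        using that unfolding D_def classical_divergence_vertex_edge[OF ab, symmetric] by auto
      then show ?thesis by (rule trans[OF sym])
    qed
    then show ?thesis by simp
  qed
  obtain \<kappa> where \<kappa>: "0 \<le> \<kappa>" "D \<kappa>" using restricted[OF unitary_mat_1] by blast
  have "\<forall>U. \<exists>l. unitary_mat U \<longrightarrow> Q U \<kappa> l"
    using restricted D_unique[OF \<kappa>(2)] by blast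
  then obtain l where "\<And>U. unitary_mat U \<Longrightarrow> Q U \<kappa> (l U)"
    using choice[of "\<lambda>U l. unitary_mat U \<longrightarrow> Q U \<kappa> l"] by blast
  then show thesis
    using that[OF \<kappa>(1), of l] by (simp add: Q_def)
qed

definition uniform :: "real^'n" where
  "uniform = (\<chi> i. 1 / real CARD('n))"

lemma uniform_prob: "(uniform :: real^'n) \<in> prob_vectors"
  by (simp add: prob_vectors_def uniform_def)

lemma uniform_conj:
  assumes "unitary_mat U"
  shows "U ** diag_mat uniform ** adjoint_mat U = diag_mat uniform"
proof -
  have "diag_mat (uniform :: real^'a) = (1 / real CARD('a)) *\<^sub>R mat 1"
    by (simp add: vec_eq_iff diag_mat_def uniform_def mat_def scaleR_conv_of_real[where 'a = complex])
  then show ?thesis by (simp add: unitary_matD[OF assms])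
qed

text \<open>Let \<open>G\<close> be the function in question and \<open>c\<close> the maximally mixed state. Every state is diagonal in a
  basis in which \<open>c\<close> is diagonal as well, so \<open>G\<close> is affine on lines through \<open>c\<close>, also beyond \<open>c\<close> up
  to the reflected state \<open>(1 + \<epsilon>) c - \<epsilon> s\<close>. Contracting a convex combination of states towards \<open>c\<close>
  by a factor \<open>\<tau>\<close> scales the convexity defect of \<open>G\<close> by \<open>\<tau>\<close>, while the entropy contributes only
  \<open>o(\<tau>)\<close>; since \<open>F\<close> is convex, so is \<open>G\<close>. Reflection in \<open>c\<close> reverses the inequality.\<close>

theorem value_minus_entropy_affine:
  fixes B :: "(complex^'n^'n \<Rightarrow> real measure) set"
  assumes B: "action_set density_matrices B" and \<kappa>: "0 \<le> \<kappa>"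
    and l: "\<And>U. unitary_mat U \<Longrightarrow> affine_on prob_vectors (l U)"
    and val: "\<And>U p. unitary_mat U \<Longrightarrow> p \<in> prob_vectors \<Longrightarrow>
      opt B (U ** diag_mat p ** adjoint_mat U) = \<kappa> * (\<Sum>k\<in>UNIV. xlnx (p $ k)) + l U p"
  shows "affine_on density_matrices (\<lambda>s. opt B s - \<kappa> * neg_entropy s)"
proof -
  interpret action_set density_matrices B by fact
  define G where "G s = F s - \<kappa> * neg_entropy s" for s
  have unif: "(uniform :: real^'n) \<in> prob_vectors" by (rule uniform_prob)
  define c :: "complex^'n^'n" where "c = diag_mat uniform"
  \<comment> \<open>Small enough for \<open>(1 + \<epsilon>) c - \<epsilon> s\<close> to be positive: the eigenvalues of \<open>s\<close> are at most \<open>1\<close>.\<close>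
  define \<epsilon> where "\<epsilon> = 1 / real CARD('n)"
  have \<epsilon>: "0 < \<epsilon>" by (simp add: \<epsilon>_def)
  have G_diag: "G (U ** diag_mat p ** adjoint_mat U) = l U p" if "unitary_mat U" "p \<in> prob_vectors" for U p
    using val[OF that] by (simp add: G_def neg_entropy_diag_conj[OF that(1)])
  have c: "c \<in> density_matrices"
    using diag_conj_density_iff[OF unitary_mat_1] unif by (metis c_def uniform_conj unitary_mat_1)
  have G_ray: "G ((1 - u) *\<^sub>R c + u *\<^sub>R s) = (1 - u) * G c + u * G s"
    if s: "s \<in> density_matrices" and u: "0 \<le> u" "u \<le> 1" for s u
  proof -
    obtain U p where U: "unitary_mat U" "s = U ** diag_mat p ** adjoint_mat U" and p: "p \<in> prob_vectors"
      using density_diagonalization[OF s] by blast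
    have c_eq: "c = U ** diag_mat uniform ** adjoint_mat U" unfolding c_def uniform_conj[OF U(1)] ..
    have "(1 - u) *\<^sub>R c + u *\<^sub>R s = U ** diag_mat ((1 - u) *\<^sub>R uniform + u *\<^sub>R p) ** adjoint_mat U"
      unfolding diag_conj_affine c_eq U(2) ..
    moreover have "(1 - u) *\<^sub>R uniform + u *\<^sub>R p \<in> prob_vectors"
      using convex_prob_vectors unif p u by (intro convexD) auto
    moreover have "l U ((1 - u) *\<^sub>R uniform + u *\<^sub>R p) = (1 - u) * l U uniform + u * l U p"
      using l[OF U(1)] unif p u by (metis affine_on_def atLeastAtMost_iff)
    ultimately show ?thesis
      using G_diag[OF U(1)] unif p by (simp add: c_eq U(2))
  qed
  have reflect: "(1 + \<epsilon>) *\<^sub>R c - \<epsilon> *\<^sub>R s \<in> density_matrices \<and>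
      G ((1 + \<epsilon>) *\<^sub>R c - \<epsilon> *\<^sub>R s) = (1 + \<epsilon>) * G c - \<epsilon> * G s" if s: "s \<in> density_matrices" for s
  proof -
    obtain U p where U: "unitary_mat U" "s = U ** diag_mat p ** adjoint_mat U" and p: "p \<in> prob_vectors"
      using density_diagonalization[OF s] by blast
    have c_eq: "c = U ** diag_mat uniform ** adjoint_mat U" unfolding c_def uniform_conj[OF U(1)] ..
    define q where "q = (1 + \<epsilon>) *\<^sub>R uniform + (- \<epsilon>) *\<^sub>R p"
    define r where "r = (1 + \<epsilon>) *\<^sub>R c - \<epsilon> *\<^sub>R s"
    have r: "r = U ** diag_mat q ** adjoint_mat U"
      unfolding q_def r_def diag_conj_affine c_eq[symmetric] U(2)[symmetric] by simp
    have q: "q \<in> prob_vectors"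
    proof -
      have "0 \<le> q $ i" for i
      proof -
        have "\<epsilon> * p $ i \<le> \<epsilon> * 1" using prob_vector_le_1[OF p] \<epsilon> by (intro mult_left_mono) auto
        moreover have "q $ i = \<epsilon> + \<epsilon> * \<epsilon> - \<epsilon> * p $ i" by (simp add: q_def uniform_def \<epsilon>_def algebra_simps)
        moreover have "0 \<le> \<epsilon> * \<epsilon>" by simp
        ultimately show ?thesis by linarith
      qed
      moreover have "(\<Sum>i\<in>UNIV. q $ i) = 1"
        using prob_vectorsD(2)[OF p] prob_vectorsD(2)[OF unif]
        by (simp add: q_def sum_subtractf sum_distrib_left[symmetric])
      ultimately show ?thesis by (simp add: prob_vectors_def)
    qed
    then have rd: "r \<in> density_matrices" using diag_conj_density_iff[OF U(1)] r by simp
    define w where "w = 1 / (1 + \<epsilon>)"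
    have w: "0 \<le> w" "w \<le> 1" "w * (1 + \<epsilon>) = 1" using \<epsilon> by (auto simp: w_def field_simps)
    have "uniform = (1 - w) *\<^sub>R p + w *\<^sub>R q"
    proof -
      have "w * \<epsilon> = 1 - w" using w(3) by (simp add: algebra_simps)
      then have "w *\<^sub>R q = uniform - (1 - w) *\<^sub>R p"
        using w(3) by (simp add: q_def scaleR_right_diff_distrib)
      then show ?thesis by simp
    qed
    then have "l U uniform = (1 - w) * l U p + w * l U q"
      using l[OF U(1)] p q w by (metis affine_on_def atLeastAtMost_iff)
    then have "G c = (1 - w) * G s + w * G r"
      using G_diag[OF U(1)] unif p q by (simp add: c_eq U(2) r)
    then have "(1 + \<epsilon>) * G c = (1 + \<epsilon>) * ((1 - w) * G s + w * G r)"
      by simp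
    also have "\<dots> = ((1 + \<epsilon>) - w * (1 + \<epsilon>)) * G s + (w * (1 + \<epsilon>)) * G r"
      by (simp add: algebra_simps)
    finally have "G r = (1 + \<epsilon>) * G c - \<epsilon> * G s" using w(3) by simp
    with rd show ?thesis by (simp add: r_def)
  qed
  \<comment> \<open>The logarithm of \<open>c\<close> is a multiple of the identity and all states have the same trace, so the
    entropy is stationary at \<open>c\<close>.\<close>
  have flat: "(\<lambda>n. slope neg_entropy s c (harmonic_times n)) \<longlonglongrightarrow> 0" if s: "s \<in> density_matrices" for s
  proof -
    obtain U p where U: "unitary_mat U" "s = U ** diag_mat p ** adjoint_mat U" and p: "p \<in> prob_vectors"
      using density_diagonalization[OF s] by blast
    have c_eq: "c = U ** diag_mat uniform ** adjoint_mat U" unfolding c_def uniform_conj[OF U(1)] ..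
    have "slope neg_entropy s c u = slope (\<lambda>p. \<Sum>k\<in>UNIV. xlnx (p $ k)) p uniform u" for u
      unfolding slope_def c_eq U(2) diag_conj_affine[symmetric] neg_entropy_diag_conj[OF U(1)] ..
    moreover have "(\<Sum>k\<in>UNIV. (p $ k - uniform $ k) * ln (uniform $ k)) = 0"
    proof -
      have "(\<Sum>k\<in>UNIV. (p $ k - uniform $ k) * ln (uniform $ k)) = (\<Sum>k\<in>UNIV. p $ k - uniform $ k) * ln \<epsilon>"
        by (simp add: sum_distrib_right uniform_def \<epsilon>_def)
      then show ?thesis
        using prob_vectorsD(2)[OF p] prob_vectorsD(2)[OF unif] by (simp add: sum_subtractf)
    qed
    moreover have "{i. p $ i \<noteq> 0} \<subseteq> {i. (uniform :: real^'n) $ i \<noteq> 0}" by (auto simp: uniform_def)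
    ultimately show ?thesis
      using classical_entropy_slope[OF p unif harmonic_times_bounds(1,4)] by simp
  qed
  have convex_G: "G ((1 - u) *\<^sub>R s + u *\<^sub>R t) \<le> (1 - u) * G s + u * G t"
    if s: "s \<in> density_matrices" and t: "t \<in> density_matrices" and u: "0 \<le> u" "u \<le> 1" for s t u
  proof -
    define m where "m = (1 - u) *\<^sub>R s + u *\<^sub>R t"
    have m: "m \<in> density_matrices" unfolding m_def using s t u by (rule segment_mem)
    define \<eta> where "\<eta> x n = slope neg_entropy x c (harmonic_times n)" for x n
    have Fray: "F ((1 - \<tau>) *\<^sub>R c + \<tau> *\<^sub>R x) = (1 - \<tau>) * G c + \<tau> * G x + \<kappa> * (neg_entropy c + \<tau> * \<eta> x n)"
      if x: "x \<in> density_matrices" and \<tau>: "\<tau> = harmonic_times n" for x n \<tau>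
    proof -
      have "0 < \<tau>" "\<tau> \<le> 1" using harmonic_times_bounds(1,3)[of n] by (auto simp: \<tau>)
      then show ?thesis
        using G_ray[OF x, of \<tau>] by (simp add: G_def \<eta>_def slope_def \<tau>[symmetric])
    qed
    have "G m + \<kappa> * \<eta> m n \<le> (1 - u) * G s + u * G t + \<kappa> * ((1 - u) * \<eta> s n + u * \<eta> t n)" for n
    proof -
      define \<tau> where "\<tau> = harmonic_times n"
      have \<tau>: "0 < \<tau>" "\<tau> \<le> 1" using harmonic_times_bounds(1,3)[of n] by (auto simp: \<tau>_def)
      let ?x = "\<lambda>y. (1 - \<tau>) *\<^sub>R c + \<tau> *\<^sub>R y"
      have "?x m = (1 - u) *\<^sub>R ?x s + u *\<^sub>R ?x t"
        by (simp add: m_def algebra_simps)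
      moreover have "?x s \<in> density_matrices" "?x t \<in> density_matrices"
        using c s t \<tau> by (auto intro!: segment_mem)
      ultimately have "F (?x m) \<le> (1 - u) * F (?x s) + u * F (?x t)"
        using convex_onD[OF convex_F, of u] u by simp
      then have "\<tau> * (G m + \<kappa> * \<eta> m n) \<le> \<tau> * ((1 - u) * G s + u * G t + \<kappa> * ((1 - u) * \<eta> s n + u * \<eta> t n))"
        unfolding Fray[OF m \<tau>_def] Fray[OF s \<tau>_def] Fray[OF t \<tau>_def] by (simp add: algebra_simps)
      then show ?thesis using \<tau> by simp
    qed
    moreover have "(\<lambda>n. G m + \<kappa> * \<eta> m n) \<longlonglongrightarrow> G m + \<kappa> * 0"
      unfolding \<eta>_def by (intro tendsto_intros flat m)
    moreover have "(\<lambda>n. (1 - u) * G s + u * G t + \<kappa> * ((1 - u) * \<eta> s n + u * \<eta> t n)) \<longlonglongrightarrow>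
        (1 - u) * G s + u * G t + \<kappa> * ((1 - u) * 0 + u * 0)"
      unfolding \<eta>_def by (intro tendsto_intros flat s t)
    ultimately have "G m + \<kappa> * 0 \<le> (1 - u) * G s + u * G t + \<kappa> * ((1 - u) * 0 + u * 0)"
      by (intro LIMSEQ_le) auto
    then show ?thesis by (simp add: m_def)
  qed
  have "G ((1 - u) *\<^sub>R s + u *\<^sub>R t) = (1 - u) * G s + u * G t"
    if s: "s \<in> density_matrices" and t: "t \<in> density_matrices" and u: "0 \<le> u" "u \<le> 1" for s t u
  proof (rule antisym[OF convex_G[OF that]])
    define m where "m = (1 - u) *\<^sub>R s + u *\<^sub>R t"
    have m: "m \<in> density_matrices" unfolding m_def using s t u by (rule segment_mem)
    let ?r = "\<lambda>x. (1 + \<epsilon>) *\<^sub>R c - \<epsilon> *\<^sub>R x"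
    have "?r m = (1 - u) *\<^sub>R ?r s + u *\<^sub>R ?r t"
      by (simp add: m_def algebra_simps)
    then have "G (?r m) \<le> (1 - u) * G (?r s) + u * G (?r t)"
      using convex_G[of "?r s" "?r t" u] reflect[OF s] reflect[OF t] u by simp
    then have "(1 + \<epsilon>) * G c - \<epsilon> * G m \<le>
        (1 - u) * ((1 + \<epsilon>) * G c - \<epsilon> * G s) + u * ((1 + \<epsilon>) * G c - \<epsilon> * G t)"
      unfolding conjunct2[OF reflect[OF s]] conjunct2[OF reflect[OF t]] conjunct2[OF reflect[OF m]] .
    then have "\<epsilon> * ((1 - u) * G s + u * G t) \<le> \<epsilon> * G m"
      by (simp add: algebra_simps)
    then show "(1 - u) * G s + u * G t \<le> G ((1 - u) *\<^sub>R s + u *\<^sub>R t)"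
      using \<epsilon> by (simp add: m_def)
  qed
  then show ?thesis
    by (simp add: affine_on_def G_def)
qed

theorem quantum_characterization:
  fixes B :: "(complex^'n^'n \<Rightarrow> real measure) set"
  assumes card: "3 \<le> CARD('n)" and B: "action_set density_matrices B"
    and suff: "sufficiency_property density_matrices quantum_channel B"
  obtains \<kappa> l where "0 \<le> \<kappa>" "affine_on density_matrices l"
    "\<And>s. s \<in> density_matrices \<Longrightarrow> opt B s = \<kappa> * neg_entropy s + l s"
    "\<And>s t. s \<in> density_matrices \<Longrightarrow> t \<in> density_matrices \<Longrightarrow> regret B s t = ereal \<kappa> * quantum_divergence s t"
proof -
  interpret action_set density_matrices B by fact
  obtain \<kappa> lU where \<kappa>: "0 \<le> \<kappa>" and lU: "\<And>U. unitary_mat U \<Longrightarrow> affine_on prob_vectors (lU U)"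
    "\<And>U p. unitary_mat U \<Longrightarrow> p \<in> prob_vectors \<Longrightarrow>
      F (U ** diag_mat p ** adjoint_mat U) = \<kappa> * (\<Sum>k\<in>UNIV. xlnx (p $ k)) + lU U p"
    using value_on_commuting_states[OF card B suff] by metis
  define l where "l s = F s - \<kappa> * neg_entropy s" for s
  have l: "affine_on density_matrices l"
    unfolding l_def by (rule value_minus_entropy_affine[OF B \<kappa> lU])
  have dec: "F s = \<kappa> * neg_entropy s + l s" for s by (simp add: l_def)
  have "regret B s t = ereal \<kappa> * quantum_divergence s t"
    if s: "s \<in> density_matrices" and t: "t \<in> density_matrices" for s t
  proof -
    obtain r where r: "strict_mono r" and lim: "(\<lambda>n. ereal (slope neg_entropy s t (harmonic_times (r n)))) \<longlonglongrightarrow>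
      (if range ((*v) s) \<subseteq> range ((*v) t) then ereal (Re (trace (s ** hermitian_fun ln t)) - neg_entropy t) else - \<infinity>)"
      using quantum_entropy_slope[OF s t] by blast
    have "(\<lambda>n. harmonic_times (r n)) \<longlonglongrightarrow> 0"
      using LIMSEQ_subseq_LIMSEQ[OF harmonic_times_bounds(4) r] by (simp add: o_def)
    then show ?thesis
      unfolding quantum_divergence_eq[OF s t, symmetric]
      by (rule regret_of_decomposition[OF dec l \<kappa> s t harmonic_times_bounds(1,3) _ lim]) (auto split: if_splits)
  qed
  with \<kappa> l dec show thesis using that by blast
qed

section \<open>The characterization of entropy\<close>

theorem theorem4:
  fixes A :: "(real^'n \<Rightarrow> real measure) set"
    and B :: "(complex^'m^'m \<Rightarrow> real measure) set"
  shows
    "(3 \<le> CARD('n) \<longrightarrow>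
      (\<forall>a\<in>A. action_on prob_vectors a) \<longrightarrow>
      (\<forall>s\<in>prob_vectors. \<bar>optimal_value A s\<bar> \<noteq> \<infinity>) \<longrightarrow>
      sufficiency_property prob_vectors stochastic_map A \<longrightarrow>
      (\<exists>k l. affine_on prob_vectors l \<and>
        (\<forall>s\<in>prob_vectors. optimal_value A s = ereal (k * shannon_entropy s + l s))) \<and>
      (\<exists>c::real. \<forall>s1\<in>prob_vectors. \<forall>s2\<in>prob_vectors.
        regret A s1 s2 = ereal c * classical_divergence s1 s2))
     \<and>
     (3 \<le> CARD('m) \<longrightarrow>
      (\<forall>a\<in>B. action_on density_matrices a) \<longrightarrow>
      (\<forall>s\<in>density_matrices. \<bar>optimal_value B s\<bar> \<noteq> \<infinity>) \<longrightarrow>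
      sufficiency_property density_matrices quantum_channel B \<longrightarrow>
      (\<exists>k l. affine_on density_matrices l \<and>
        (\<forall>s\<in>density_matrices. optimal_value B s = ereal (k * von_neumann_entropy s + l s))) \<and>
      (\<exists>c::real. \<forall>s1\<in>density_matrices. \<forall>s2\<in>density_matrices.
        regret B s1 s2 = ereal c * quantum_divergence s1 s2))"
proof (intro conjI impI)
  assume card: "3 \<le> CARD('n)" and suff: "sufficiency_property prob_vectors stochastic_map A"
    and "\<forall>a\<in>A. action_on prob_vectors a" "\<forall>s\<in>prob_vectors. \<bar>optimal_value A s\<bar> \<noteq> \<infinity>"
  then have A: "action_set prob_vectors A"
    using convex_prob_vectors by (simp add: action_set_def)
  obtain \<kappa> l where *: "affine_on prob_vectors l"
    "\<And>p. p \<in> prob_vectors \<Longrightarrow> opt A p = \<kappa> * (\<Sum>k\<in>UNIV. xlnx (p $ k)) + l p"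
    "\<And>s t. s \<in> prob_vectors \<Longrightarrow> t \<in> prob_vectors \<Longrightarrow> regret A s t = ereal \<kappa> * classical_divergence s t"
    using classical_characterization[OF card A suff] by metis
  have "\<forall>s\<in>prob_vectors. optimal_value A s = ereal (- \<kappa> * shannon_entropy s + l s)"
    using *(2) by (simp add: action_set.optimal_value_eq[OF A] shannon_entropy_eq)
  then show "\<exists>k l. affine_on prob_vectors l \<and>
      (\<forall>s\<in>prob_vectors. optimal_value A s = ereal (k * shannon_entropy s + l s))"
    using *(1) by blast
  show "\<exists>c::real. \<forall>s1\<in>prob_vectors. \<forall>s2\<in>prob_vectors. regret A s1 s2 = ereal c * classical_divergence s1 s2"
    using *(3) by blast
next
  assume card: "3 \<le> CARD('m)" and suff: "sufficiency_property density_matrices quantum_channel B"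
    and "\<forall>a\<in>B. action_on density_matrices a" "\<forall>s\<in>density_matrices. \<bar>optimal_value B s\<bar> \<noteq> \<infinity>"
  then have B: "action_set density_matrices B"
    using convex_density_matrices by (simp add: action_set_def)
  obtain \<kappa> l where *: "affine_on density_matrices l"
    "\<And>s. s \<in> density_matrices \<Longrightarrow> opt B s = \<kappa> * neg_entropy s + l s"
    "\<And>s t. s \<in> density_matrices \<Longrightarrow> t \<in> density_matrices \<Longrightarrow> regret B s t = ereal \<kappa> * quantum_divergence s t"
    using quantum_characterization[OF card B suff] by metis
  have "\<forall>s\<in>density_matrices. optimal_value B s = ereal (- \<kappa> * von_neumann_entropy s + l s)"
    using *(2) by (simp add: action_set.optimal_value_eq[OF B] neg_entropy_def)
  then show "\<exists>k l. affine_on density_matrices l \<and>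
      (\<forall>s\<in>density_matrices. optimal_value B s = ereal (k * von_neumann_entropy s + l s))"
    using *(1) by blast
  show "\<exists>c::real. \<forall>s1\<in>density_matrices. \<forall>s2\<in>density_matrices. regret B s1 s2 = ereal c * quantum_divergence s1 s2"
    using *(3) by blast
qed

end
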